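(* The following groupoids $\mathscr{C}$ and $\mathscr{D}$ are isomorphic. (1) The class $\operatorname{Ob}(\mathscr{C})$ of objects of $\mathscr{C}$ is the tropical curves. For $\Gamma_1,\Gamma_2\in\operatorname{Ob}(\mathscr{C})$, the set $\operatorname{Hom}_{\mathscr{C}}(\Gamma_1,\Gamma_2)$ of morphisms from $\Gamma_1$ to $\Gamma_2$ consists of the semiring isomorphisms $\operatorname{Rat}(\Gamma_1)\to\operatorname{Rat}(\Gamma_2)$. (2) The class $\operatorname{Ob}(\mathscr{D})$ of objects of $\mathscr{D}$ is the tropical curves. For $\Gamma_1,\Gamma_2\in\operatorname{Ob}(\mathscr{D})$, the set $\operatorname{Hom}_{\mathscr{D}}(\Gamma_1,\Gamma_2)$ of morphisms from $\Gamma_1$ to $\Gamma_2$ consists of the $r$-expansive maps $\Gamma_1\to\Gamma_2$ for all $r\in\mathbb{R}_{>0}$.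
   Context: A groupoid is a category in which every morphism is invertible; in both $\mathscr{C}$ and $\mathscr{D}$ composition is composition of maps. **Semirings.** A semiring is a commutative semiring with absorbing additive neutral element, multiplicative identity, and these two distinct. A semiring homomorphism preserves addition, multiplication, the additive neutral element and the multiplicative identity; a semiring isomorphism is a bijective one. **Tropical curves.** A graph is an unweighted, undirected, finite, connected nonempty multigraph, possibly with loops. A leaf end is a vertex of valence one (loops count twice); a leaf edge is an edge incident to a leaf end. An edge-weighted graph $(G,l)$ is a graph $G$ with a function $l : E(G) \to \mathbb{R}_{>0} \cup \{\infty\}$ on its set of edges $E(G)$ that takes the value $\infty$ only on leaf edges. A tropical curve $\Gamma$ is the underlying topological space of some $(G,l)$ together with an identification of each edge $e$ with $[0,l(e)]$, where $[0,\infty]$ is the one-point compactification of $[0,\infty)$; if $l(e)=\infty$, the leaf end of $e$ is identified with $\infty$ (if $E(G)=\{e\}$ and $l(e)=\infty$, either leaf end may be chosen). Points identified with $\infty$ are points at infinity and form the set $\Gamma_\infty$; other points are finite points. $\operatorname{dist}$ is the path-length distance; the distance between a point at infinity and any other point is $\infty$. **Rational functions.** A rational function on $\Gamma$ is either the constant function $-\infty$ or a continuous map $f:\Gamma\to\mathbb{R}\cup\{\pm\infty\}$ that is piecewise affine with integer slopes and finitely many pieces and takes values $\pm\infty$ only at points at infinity. $\operatorname{Rat}(\Gamma)$ is the set of these; with $(f\oplus g)(x)=\max\{f(x),g(x)\}$ and $(f\odot g)(x)=f(x)+g(x)$ at finite points, extended continuously to points at infinity (and $f\oplus(-\infty)=f$,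 $f\odot(-\infty)=-\infty$), it is a semifield, that is, a semiring in which every element other than the additive neutral element is multiplicatively invertible. **Expansive maps.** For $r\in\mathbb{R}_{>0}$, an $r$-expansive map $\varphi:\Gamma_1\to\Gamma_2$ between tropical curves is a continuous bijection that induces a bijection $\Gamma_1\setminus\Gamma_{1\infty}\to\Gamma_2\setminus\Gamma_{2\infty}$ with $r\cdot\operatorname{dist}(x,y)=\operatorname{dist}(\varphi(x),\varphi(y))$ for all $x,y\in\Gamma_1\setminus\Gamma_{1\infty}$, where $\Gamma_{i\infty}$ is the set of points at infinity of $\Gamma_i$.
   Formalization: Morphisms in D are r-expansive maps together with their factor r (composition multiplies factors); this changes Hom only for one-point curves, where the identity is r-expansive for all r while Rat has automorphism group R_{>0}, so the claim with bare maps is false. *)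

theory Defs
  imports "HOL-Analysis.Analysis" "HOL-Algebra.Ring"
begin

section \<open>Categories, groupoids, isomorphism of categories\<close>

text \<open>
  Hom-sets are indexed by source and target and need not be disjoint, so composition takes the
  three objects involved as arguments: \<open>Comp C X Y Z g f\<close> is the composite of
  \<open>f \<in> Hom C X Y\<close> followed by \<open>g \<in> Hom C Y Z\<close>.
\<close>

record ('o, 'm) cat =
  Ob :: "'o set"
  Hom :: "'o \<Rightarrow> 'o \<Rightarrow> 'm set"
  Comp :: "'o \<Rightarrow> 'o \<Rightarrow> 'o \<Rightarrow> 'm \<Rightarrow> 'm \<Rightarrow> 'm"
  Ident :: "'o \<Rightarrow> 'm"

definition is_category :: "('o, 'm) cat \<Rightarrow> bool" where
  "is_category C \<longleftrightarrow>
     (\<forall>X\<in>Ob C. Ident C X \<in> Hom C X X) \<and>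
     (\<forall>X\<in>Ob C. \<forall>Y\<in>Ob C. \<forall>Z\<in>Ob C. \<forall>f\<in>Hom C X Y. \<forall>g\<in>Hom C Y Z.
        Comp C X Y Z g f \<in> Hom C X Z) \<and>
     (\<forall>X\<in>Ob C. \<forall>Y\<in>Ob C. \<forall>f\<in>Hom C X Y.
        Comp C X X Y f (Ident C X) = f \<and> Comp C X Y Y (Ident C Y) f = f) \<and>
     (\<forall>W\<in>Ob C. \<forall>X\<in>Ob C. \<forall>Y\<in>Ob C. \<forall>Z\<in>Ob C.
        \<forall>f\<in>Hom C W X. \<forall>g\<in>Hom C X Y. \<forall>h\<in>Hom C Y Z.
        Comp C W Y Z h (Comp C W X Y g f) = Comp C W X Z (Comp C X Y Z h g) f)"

definition is_groupoid :: "('o, 'm) cat \<Rightarrow> bool" where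
  "is_groupoid C \<longleftrightarrow> is_category C \<and>
     (\<forall>X\<in>Ob C. \<forall>Y\<in>Ob C. \<forall>f\<in>Hom C X Y. \<exists>g\<in>Hom C Y X.
        Comp C X Y X g f = Ident C X \<and> Comp C Y X Y f g = Ident C Y)"

definition is_functor ::
  "('o, 'm) cat \<Rightarrow> ('p, 'n) cat \<Rightarrow> ('o \<Rightarrow> 'p) \<Rightarrow> ('o \<Rightarrow> 'o \<Rightarrow> 'm \<Rightarrow> 'n) \<Rightarrow> bool" where
  "is_functor C D F0 F1 \<longleftrightarrow>
     (\<forall>X\<in>Ob C. F0 X \<in> Ob D) \<and>
     (\<forall>X\<in>Ob C. \<forall>Y\<in>Ob C. \<forall>f\<in>Hom C X Y. F1 X Y f \<in> Hom D (F0 X) (F0 Y)) \<and>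
     (\<forall>X\<in>Ob C. F1 X X (Ident C X) = Ident D (F0 X)) \<and>
     (\<forall>X\<in>Ob C. \<forall>Y\<in>Ob C. \<forall>Z\<in>Ob C. \<forall>f\<in>Hom C X Y. \<forall>g\<in>Hom C Y Z.
        F1 X Z (Comp C X Y Z g f) = Comp D (F0 X) (F0 Y) (F0 Z) (F1 Y Z g) (F1 X Y f))"

definition isomorphic_categories :: "('o, 'm) cat \<Rightarrow> ('p, 'n) cat \<Rightarrow> bool" where
  "isomorphic_categories C D \<longleftrightarrow>
     (\<exists>F0 F1 G0 G1. is_functor C D F0 F1 \<and> is_functor D C G0 G1 \<and>
        (\<forall>X\<in>Ob C. G0 (F0 X) = X) \<and>
        (\<forall>X\<in>Ob C. \<forall>Y\<in>Ob C. \<forall>f\<in>Hom C X Y. G1 (F0 X) (F0 Y) (F1 X Y f) = f) \<and>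
        (\<forall>X\<in>Ob D. F0 (G0 X) = X) \<and>
        (\<forall>X\<in>Ob D. \<forall>Y\<in>Ob D. \<forall>g\<in>Hom D X Y. F1 (G0 X) (G0 Y) (G1 X Y g) = g))"

section \<open>Tropical curves\<close>

text \<open>
  A curve carries its topological space, a graph (whose vertices are points of the space), the
  edge lengths and, for every edge \<open>e\<close>, the identification \<open>chart e\<close> of
  the interval \<open>[0, len e]\<close> of extended reals with the edge; as a subspace of the
  extended reals, \<open>{0..\<infinity>}\<close> is the one-point compactification of \<open>[0,\<infinity>)\<close>.
  The end vertices of \<open>e\<close> are \<open>chart e 0\<close> and \<open>chart e (len e)\<close>;
  they coincide precisely when \<open>e\<close> is a loop.
\<close>

record ('a, 'e) curve =
  topo :: "'a topology"
  verts :: "'a set"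
  edges :: "'e set"
  len :: "'e \<Rightarrow> ereal"
  chart :: "'e \<Rightarrow> ereal \<Rightarrow> 'a"

abbreviation points :: "('a, 'e) curve \<Rightarrow> 'a set" where
  "points \<Gamma> \<equiv> topspace (topo \<Gamma>)"

definition valence :: "('a, 'e) curve \<Rightarrow> 'a \<Rightarrow> nat" where
  "valence \<Gamma> v = card {e \<in> edges \<Gamma>. chart \<Gamma> e 0 = v}
                + card {e \<in> edges \<Gamma>. chart \<Gamma> e (len \<Gamma> e) = v}"

definition leaf_end :: "('a, 'e) curve \<Rightarrow> 'a \<Rightarrow> bool" where
  "leaf_end \<Gamma> v \<longleftrightarrow> v \<in> verts \<Gamma> \<and> valence \<Gamma> v = 1"

definition leaf_edge :: "('a, 'e) curve \<Rightarrow> 'e \<Rightarrow> bool" where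
  "leaf_edge \<Gamma> e \<longleftrightarrow> e \<in> edges \<Gamma> \<and>
     (leaf_end \<Gamma> (chart \<Gamma> e 0) \<or> leaf_end \<Gamma> (chart \<Gamma> e (len \<Gamma> e)))"

definition adjacent :: "('a, 'e) curve \<Rightarrow> ('a \<times> 'a) set" where
  "adjacent \<Gamma> = {(u, v). \<exists>e\<in>edges \<Gamma>. {u, v} = {chart \<Gamma> e 0, chart \<Gamma> e (len \<Gamma> e)}}"

text \<open>
  The groups of conditions: a finite connected nonempty multigraph; an edge weight, infinite on
  leaf edges only; the space is the quotient of the disjoint union of the vertex set and the
  intervals \<open>[0, len e]\<close> that glues the ends of the intervals to the end vertices; and
  \<open>\<infinity>\<close> is identified with a leaf end. The extensionality implicit in
  \<open>Pi\<^sub>E\<close> makes functions on edges, and charts on intervals, comparable by equality.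
\<close>

definition tropical_curve :: "('a, 'e) curve \<Rightarrow> bool" where
  "tropical_curve \<Gamma> \<longleftrightarrow>
     finite (verts \<Gamma>) \<and> verts \<Gamma> \<noteq> {} \<and> finite (edges \<Gamma>) \<and>
     (\<forall>e\<in>edges \<Gamma>. chart \<Gamma> e 0 \<in> verts \<Gamma> \<and> chart \<Gamma> e (len \<Gamma> e) \<in> verts \<Gamma>) \<and>
     (\<forall>u\<in>verts \<Gamma>. \<forall>v\<in>verts \<Gamma>. (u, v) \<in> (adjacent \<Gamma>)\<^sup>*) \<and>

     len \<Gamma> \<in> edges \<Gamma> \<rightarrow>\<^sub>E {0<..} \<and>
     (\<forall>e\<in>edges \<Gamma>. len \<Gamma> e = \<infinity> \<longrightarrow> leaf_edge \<Gamma> e) \<and>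

     chart \<Gamma> \<in> (\<Pi>\<^sub>E e\<in>edges \<Gamma>. {0..len \<Gamma> e} \<rightarrow>\<^sub>E points \<Gamma>) \<and>
     points \<Gamma> = verts \<Gamma> \<union> (\<Union>e\<in>edges \<Gamma>. chart \<Gamma> e ` {0..len \<Gamma> e}) \<and>
     inj_on (\<lambda>(e, t). chart \<Gamma> e t) (SIGMA e:edges \<Gamma>. {0<..<len \<Gamma> e}) \<and>
     (\<forall>e\<in>edges \<Gamma>. chart \<Gamma> e ` {0<..<len \<Gamma> e} \<inter> verts \<Gamma> = {}) \<and>
     (\<forall>U. openin (topo \<Gamma>) U \<longleftrightarrow> U \<subseteq> points \<Gamma> \<and>
        (\<forall>e\<in>edges \<Gamma>. openin (top_of_set {0..len \<Gamma> e}) {t \<in> {0..len \<Gamma> e}. chart \<Gamma> e t \<in> U})) \<and>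

     (\<forall>e\<in>edges \<Gamma>. len \<Gamma> e = \<infinity> \<longrightarrow> leaf_end \<Gamma> (chart \<Gamma> e \<infinity>))"

definition points_at_infinity :: "('a, 'e) curve \<Rightarrow> 'a set" where
  "points_at_infinity \<Gamma> = {chart \<Gamma> e \<infinity> |e. e \<in> edges \<Gamma> \<and> len \<Gamma> e = \<infinity>}"

definition finite_points :: "('a, 'e) curve \<Rightarrow> 'a set" where
  "finite_points \<Gamma> = points \<Gamma> - points_at_infinity \<Gamma>"

text \<open>
  \<open>path_length \<Gamma> x y d\<close>: some path from \<open>x\<close> to \<open>y\<close>, traversing finitely
  many segments of edges, has length \<open>d\<close>. The parameters \<open>s\<close> and \<open>t\<close>
  are real, so no such path leads from a point at infinity to another point, and the infimum
  defining the distance of these is \<open>Inf {} = \<infinity>\<close>.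
\<close>

inductive path_length :: "('a, 'e) curve \<Rightarrow> 'a \<Rightarrow> 'a \<Rightarrow> real \<Rightarrow> bool" for \<Gamma> where
  trivial: "x \<in> points \<Gamma> \<Longrightarrow> path_length \<Gamma> x x 0"
| segment: "\<lbrakk>path_length \<Gamma> x (chart \<Gamma> e (ereal s)) d; e \<in> edges \<Gamma>;
             ereal s \<in> {0..len \<Gamma> e}; ereal t \<in> {0..len \<Gamma> e}\<rbrakk>
            \<Longrightarrow> path_length \<Gamma> x (chart \<Gamma> e (ereal t)) (d + \<bar>s - t\<bar>)"

definition curve_dist :: "('a, 'e) curve \<Rightarrow> 'a \<Rightarrow> 'a \<Rightarrow> ereal" where
  "curve_dist \<Gamma> x y = Inf {ereal d |d. path_length \<Gamma> x y d}"

section \<open>Rational functions\<close>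

definition piecewise_affine :: "ereal \<Rightarrow> (ereal \<Rightarrow> ereal) \<Rightarrow> bool" where
  "piecewise_affine L g \<longleftrightarrow>
     (\<exists>n. \<exists>p :: nat \<Rightarrow> ereal. p 0 = 0 \<and> p n = L \<and> (\<forall>i<n. p i < p (Suc i)) \<and>
        (\<forall>i<n. \<exists>m :: int. \<exists>c :: real. \<forall>t :: real.
           ereal t \<in> {p i..p (Suc i)} \<longrightarrow> g (ereal t) = ereal (of_int m * t + c)))"

definition rational_functions :: "('a, 'e) curve \<Rightarrow> ('a \<Rightarrow> ereal) set" where
  "rational_functions \<Gamma> =
     {\<lambda>x\<in>points \<Gamma>. -\<infinity>} \<union>
     {f \<in> extensional (points \<Gamma>).
        continuous_map (topo \<Gamma>) euclidean f \<and>
        (\<forall>e\<in>edges \<Gamma>. piecewise_affine (len \<Gamma> e) (\<lambda>t. f (chart \<Gamma> e t))) \<and>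
        (\<forall>x\<in>finite_points \<Gamma>. f x \<noteq> \<infinity> \<and> f x \<noteq> -\<infinity>)}"

text \<open>
  The continuous function on \<open>\<Gamma>\<close> that agrees with \<open>h\<close> at the finite points. The
  extension matters for sums, since \<open>\<infinity> + (-\<infinity>)\<close> may occur at a point at infinity. Applied to
  a sum or maximum one of whose arguments is the constant \<open>-\<infinity>\<close>, it yields the
  conventions for the additive neutral element.
\<close>

definition continuous_extension :: "('a, 'e) curve \<Rightarrow> ('a \<Rightarrow> ereal) \<Rightarrow> 'a \<Rightarrow> ereal" where
  "continuous_extension \<Gamma> h =
     (THE k. k \<in> extensional (points \<Gamma>) \<and> continuous_map (topo \<Gamma>) euclidean k \<and>
             (\<forall>x\<in>finite_points \<Gamma>. k x = h x))"

definition Rat :: "('a, 'e) curve \<Rightarrow> ('a \<Rightarrow> ereal) ring" where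
  "Rat \<Gamma> =
     \<lparr>carrier = rational_functions \<Gamma>,
      monoid.mult = (\<lambda>f g. continuous_extension \<Gamma> (\<lambda>x. f x + g x)),
      one = (\<lambda>x\<in>points \<Gamma>. 0),
      zero = (\<lambda>x\<in>points \<Gamma>. -\<infinity>),
      add = (\<lambda>f g. continuous_extension \<Gamma> (\<lambda>x. max (f x) (g x)))\<rparr>"

text \<open>\<open>ring_hom\<close> does not require preservation of the additive neutral element.\<close>

definition semiring_isos :: "'s ring \<Rightarrow> 't ring \<Rightarrow> ('s \<Rightarrow> 't) set" where
  "semiring_isos R S =
     {\<psi> \<in> extensional (carrier R).
        \<psi> \<in> ring_hom R S \<and> \<psi> \<zero>\<^bsub>R\<^esub> = \<zero>\<^bsub>S\<^esub> \<and> bij_betw \<psi> (carrier R) (carrier S)}"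

section \<open>Expansive maps\<close>

definition expansive_map ::
  "real \<Rightarrow> ('a, 'e) curve \<Rightarrow> ('b, 'f) curve \<Rightarrow> ('a \<Rightarrow> 'b) \<Rightarrow> bool" where
  "expansive_map r \<Gamma>1 \<Gamma>2 \<phi> \<longleftrightarrow>
     continuous_map (topo \<Gamma>1) (topo \<Gamma>2) \<phi> \<and>
     bij_betw \<phi> (points \<Gamma>1) (points \<Gamma>2) \<and>
     bij_betw \<phi> (finite_points \<Gamma>1) (finite_points \<Gamma>2) \<and>
     (\<forall>x\<in>finite_points \<Gamma>1. \<forall>y\<in>finite_points \<Gamma>1.
        ereal r * curve_dist \<Gamma>1 x y = curve_dist \<Gamma>2 (\<phi> x) (\<phi> y))"

section \<open>The two groupoids\<close>

definition semifield_groupoid ::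
  "(('a, 'e) curve, ('a \<Rightarrow> ereal) \<Rightarrow> 'a \<Rightarrow> ereal) cat" where
  "semifield_groupoid =
     \<lparr>Ob = {\<Gamma>. tropical_curve \<Gamma>},
      Hom = (\<lambda>\<Gamma>1 \<Gamma>2. semiring_isos (Rat \<Gamma>1) (Rat \<Gamma>2)),
      Comp = (\<lambda>\<Gamma>1 \<Gamma>2 \<Gamma>3 \<psi>' \<psi>. compose (carrier (Rat \<Gamma>1)) \<psi>' \<psi>),
      Ident = (\<lambda>\<Gamma>. \<lambda>f\<in>carrier (Rat \<Gamma>). f)\<rparr>"

text \<open>
  A morphism is an \<open>r\<close>-expansive map \<open>\<phi>\<close> together with its expansion factor
  \<open>r > 0\<close>: the Hom-set is the disjoint union over \<open>r\<close> of the sets of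
  \<open>r\<close>-expansive maps. If the source has more than one point, then \<open>\<phi>\<close> determines
  \<open>r\<close>. On a one-point curve, however, the identity is \<open>r\<close>-expansive for every
  \<open>r\<close>, while \<open>Rat\<close> is the semiring of constants in \<open>\<real> \<union> {-\<infinity>}\<close>, whose
  automorphisms are the multiplications by the positive reals; only with \<open>r\<close>
  recorded do the two groupoids correspond there.
\<close>

definition expansive_groupoid :: "(('a, 'e) curve, real \<times> ('a \<Rightarrow> 'a)) cat" where
  "expansive_groupoid =
     \<lparr>Ob = {\<Gamma>. tropical_curve \<Gamma>},
      Hom = (\<lambda>\<Gamma>1 \<Gamma>2. {(r, \<phi>). 0 < r \<and> \<phi> \<in> extensional (points \<Gamma>1) \<and> expansive_map r \<Gamma>1 \<Gamma>2 \<phi>}),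
      Comp = (\<lambda>\<Gamma>1 \<Gamma>2 \<Gamma>3 (r', \<phi>') (r, \<phi>). (r' * r, compose (points \<Gamma>1) \<phi>' \<phi>)),
      Ident = (\<lambda>\<Gamma>. (1, \<lambda>x\<in>points \<Gamma>. x))\<rparr>"

end

theory Submission
  imports Defs
begin

text \<open>
  The isomorphism is the identity on objects and sends an \<open>r\<close>-expansive map \<open>\<phi>\<close>
  to \<open>f \<mapsto> r f \<circ> \<phi>\<^sup>-\<^sup>1\<close>. This is functorial, and injective because rational
  functions separate points; the substance is that these maps are semiring isomorphisms and that there
  are no others.

  A rational function other than \<open>-\<infinity>\<close> is determined by its values at the finite points. So
  it is replaced by a real function that, on both sides of every point of every edge, is affine with
  an integer slope (\<open>PL UNIV \<Gamma>\<close>); the value at infinity is the limit, and is recovered by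
  \<open>extend\<close>. The semiring operations become pointwise addition and maximum.

  \<^item> \<^emph>\<open>Expansive maps preserve rational functions.\<close> An expansive map need not send vertices to
  vertices, so rational functions have to be described by the topology and the distance alone: they
  are continuous, real at finite points, and near every point they differ from their value at some
  finite point \<open>z\<close> by integer multiples of the distance from \<open>z\<close>. By continuity and discreteness of the integers the multiple is
  constant on each side of the point, so this forces integer slopes
  (\<open>PL_imp_locally_integral\<close>, \<open>locally_integral_imp_PL\<close>). As a continuous bijection between
  compact Hausdorff spaces is a homeomorphism, an expansive map preserves this description.

  \<^item> \<^emph>\<open>Isomorphisms scale constants.\<close> A constant is divisible by every \<open>n\<close>, hence so
  is its image under an isomorphism \<open>\<psi>\<close>; the slopes of the image are then divisible by every
  \<open>n\<close>, that is, zero. So \<open>\<psi>\<close> acts on the constants as a monotone, additive and injective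
  map, that is, as multiplication by some \<open>r > 0\<close> (\<open>Psi_const\<close>, \<open>factor_pos\<close>).

  \<^item> \<^emph>\<open>Isomorphisms move points.\<close> For a point \<open>y\<close> of the target there is a point
  \<open>x\<close> of the source with \<open>\<psi> f y = r f x\<close> for all \<open>f\<close>; otherwise compactness of the
  source contradicts monotonicity of \<open>\<psi>\<close> (\<open>evaluation_point_exists\<close>). Rational functions
  separate points and generate the topology (\<open>separating_function\<close>), so \<open>x\<close> is unique, and
  \<open>\<psi>\<close> together with its inverse yields a homeomorphism. Points at infinity are those where
  the distance from a finite point, itself a rational function, is infinite.

  \<^item> \<^emph>\<open>Isomorphisms scale the distance.\<close> Having all slopes in \<open>{-1, 0, 1}\<close> can be
  expressed through the semiring: such a function takes only finitely many values where it coincides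
  with some \<open>n k + c\<close>, \<open>n \<ge> 2\<close>, and this characterises it
  (\<open>unit_slopes_imp_not_divisible\<close>, \<open>not_divisible_imp_unit_slopes\<close>). So \<open>\<psi>\<close> maps the
  distance from a point to a function that does not grow faster than the distance. This is one of the
  inequalities between the two distances; the inverse of \<open>\<psi>\<close> gives the other.
\<close>

section \<open>Locally affine functions on an interval\<close>

definition affine_on :: "int set \<Rightarrow> ereal \<Rightarrow> ereal \<Rightarrow> (real \<Rightarrow> real) \<Rightarrow> bool" where
  "affine_on M a b g \<longleftrightarrow>
     (\<exists>m\<in>M. \<exists>c. \<forall>t. a \<le> ereal t \<longrightarrow> ereal t \<le> b \<longrightarrow> g t = of_int m * t + c)"

text \<open>The two one-sided conditions replace a subdivision into finitely many pieces: they can be checked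
  and combined point by point. The interval contains the point itself, so that they imply continuity
  at real points. The function has real arguments; an endpoint \<open>\<infinity>\<close> of the interval
  records the behaviour for large arguments. The set \<open>M\<close> of admissible slopes serves to
  single out the distance (slopes \<open>\<plusminus>1\<close>) and Lipschitz functions.\<close>

definition locally_affine :: "int set \<Rightarrow> ereal \<Rightarrow> ereal \<Rightarrow> (real \<Rightarrow> real) \<Rightarrow> bool" where
  "locally_affine M a b g \<longleftrightarrow>
     (\<forall>t. a \<le> t \<and> t < b \<longrightarrow> (\<exists>s>t. s \<le> b \<and> affine_on M t s g)) \<and>
     (\<forall>t. a < t \<and> t \<le> b \<longrightarrow> (\<exists>s<t. a \<le> s \<and> affine_on M s t g))"

lemma affine_onE:
  assumes "affine_on M a b g"
  obtains m c where "m \<in> M" "\<And>t. a \<le> ereal t \<Longrightarrow> ereal t \<le> b \<Longrightarrow> g t = of_int m * t + c"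
  using assms unfolding affine_on_def by blast

lemma locally_affine_rightE:
  assumes "locally_affine M a b g" "a \<le> t" "t < b"
  obtains s where "t < s" "s \<le> b" "affine_on M t s g"
  using assms unfolding locally_affine_def by blast

lemma locally_affine_leftE:
  assumes "locally_affine M a b g" "a < t" "t \<le> b"
  obtains s where "s < t" "a \<le> s" "affine_on M s t g"
  using assms unfolding locally_affine_def by blast

lemma affine_coefficients_unique:
  fixes m c m' c' :: real
  assumes "m * u + c = m' * u + c'" "m * v + c = m' * v + c'" "u \<noteq> v"
  shows "m = m' \<and> c = c'"
proof -
  have "(m - m') * (u - v) = 0" using assms by (simp add: algebra_simps)
  thus ?thesis using assms by auto
qed

lemma two_reals_between:
  fixes x y :: ereal
  assumes "x < y"
  obtains u v where "x < ereal u" "u < v" "ereal v < y"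
proof -
  obtain u where u: "x < ereal u" "ereal u < y" using ereal_dense2[OF assms] by blast
  obtain v where "ereal u < ereal v" "ereal v < y" using ereal_dense2[OF u(2)] by blast
  thus ?thesis using that u by simp
qed

text \<open>Compactness of an interval in the form used throughout: the supremum of the points \<open>x\<close>
  with \<open>P a x\<close> is such a point by the condition on the left, and cannot be smaller than
  \<open>b\<close> by the condition on the right.\<close>

lemma interval_glue_induct:
  fixes P :: "'a::complete_linorder \<Rightarrow> 'a \<Rightarrow> bool"
  assumes "a < b"
    and glue: "\<And>x y z. a \<le> x \<Longrightarrow> x < y \<Longrightarrow> y < z \<Longrightarrow> z \<le> b \<Longrightarrow> P x y \<Longrightarrow> P y z \<Longrightarrow> P x z"
    and right: "\<And>t. a \<le> t \<Longrightarrow> t < b \<Longrightarrow> \<exists>s>t. s \<le> b \<and> (\<forall>u. t < u \<and> u \<le> s \<longrightarrow> P t u)"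
    and left: "\<And>t. a < t \<Longrightarrow> t \<le> b \<Longrightarrow> \<exists>s<t. a \<le> s \<and> (\<forall>u. s \<le> u \<and> u < t \<longrightarrow> P u t)"
  shows "P a b"
proof -
  define S where "S = {x. a < x \<and> x \<le> b \<and> P a x}"
  define u where "u = Sup S"
  obtain s0 where s0: "s0 > a" "s0 \<le> b" "\<forall>u. a < u \<and> u \<le> s0 \<longrightarrow> P a u"
    using right[of a] \<open>a < b\<close> by auto
  have "s0 \<in> S" using s0 by (auto simp: S_def)
  hence au: "a < u" using s0(1) by (metis Sup_upper less_le_trans u_def)
  have ub: "u \<le> b" unfolding u_def by (rule Sup_least) (auto simp: S_def)
  have Pau: "P a u"
  proof -
    obtain s where s: "s < u" "a \<le> s" "\<forall>w. s \<le> w \<and> w < u \<longrightarrow> P w u"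
      using left[OF au ub] by auto
    obtain x where x: "x \<in> S" "s < x" using s(1) unfolding u_def less_Sup_iff by auto
    have "x \<le> u" using x(1) by (simp add: u_def Sup_upper)
    show ?thesis
    proof (cases "x = u")
      case True thus ?thesis using x by (simp add: S_def)
    next
      case False
      hence "x < u" using \<open>x \<le> u\<close> by simp
      thus ?thesis using glue[of a x u] x s ub by (auto simp: S_def)
    qed
  qed
  have "\<not> u < b"
  proof
    assume "u < b"
    then obtain s where s: "s > u" "s \<le> b" "\<forall>w. u < w \<and> w \<le> s \<longrightarrow> P u w"
      using right[of u] au by (meson less_imp_le)
    have "P a s" using glue[of a u s] Pau s au by auto
    hence "s \<in> S" using s au by (auto simp: S_def)
    hence "s \<le> u" by (simp add: u_def Sup_upper)
    thus False using s by simp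
  qed
  thus ?thesis using Pau ub by simp
qed

lemma affine_on_subinterval:
  "affine_on M a b g \<Longrightarrow> a \<le> a' \<Longrightarrow> b' \<le> b \<Longrightarrow> affine_on M a' b' g"
  unfolding affine_on_def by (meson order_trans)

lemma locally_affine_subinterval:
  assumes "locally_affine M a b g" "a \<le> a'" "b' \<le> b"
  shows "locally_affine M a' b' g"
  unfolding locally_affine_def
proof (intro conjI allI impI)
  fix t assume t: "a' \<le> t \<and> t < b'"
  then obtain s where "s > t" "s \<le> b" "affine_on M t s g"
    using assms unfolding locally_affine_def by (meson less_le_trans order_trans)
  thus "\<exists>s>t. s \<le> b' \<and> affine_on M t s g"
    using t by (intro exI[of _ "min s b'"]) (auto intro: affine_on_subinterval)
next
  fix t assume t: "a' < t \<and> t \<le> b'"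
  then obtain s where "s < t" "a \<le> s" "affine_on M s t g"
    using assms unfolding locally_affine_def by (meson le_less_trans order_trans)
  thus "\<exists>s<t. a' \<le> s \<and> affine_on M s t g"
    using t by (intro exI[of _ "max s a'"]) (auto intro: affine_on_subinterval)
qed

lemma affine_imp_locally_affine:
  assumes "affine_on M a b g" shows "locally_affine M a b g"
  unfolding locally_affine_def using affine_on_subinterval[OF assms]
  by (meson order_refl order_less_imp_le)

lemma locally_affine_mono: "locally_affine M a b g \<Longrightarrow> M \<subseteq> N \<Longrightarrow> locally_affine N a b g"
  unfolding locally_affine_def affine_on_def by (meson subsetD)

lemma locally_affine_cong:
  assumes "\<And>t. a \<le> ereal t \<Longrightarrow> ereal t \<le> b \<Longrightarrow> f t = g t"
  shows "locally_affine M a b f \<longleftrightarrow> locally_affine M a b g"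
proof -
  have *: "affine_on M x y f \<longleftrightarrow> affine_on M x y g" if "a \<le> x" "y \<le> b" for x y
  proof -
    have "f t = g t" if "x \<le> ereal t" "ereal t \<le> y" for t
      using assms[of t] that \<open>a \<le> x\<close> \<open>y \<le> b\<close> by auto
    thus ?thesis unfolding affine_on_def by simp
  qed
  show ?thesis unfolding locally_affine_def
    by (intro conj_cong all_cong ex_cong1) (use * in \<open>blast+\<close>)
qed

lemma locally_affine_glue:
  assumes "locally_affine M a b g" "locally_affine M b c g" "a \<le> b" "b \<le> c"
  shows "locally_affine M a c g"
  unfolding locally_affine_def
proof (intro conjI allI impI)
  fix t assume t: "a \<le> t \<and> t < c"
  show "\<exists>s>t. s \<le> c \<and> affine_on M t s g"
  proof (cases "t < b")
    case True
    with t obtain s where "t < s" "s \<le> b" "affine_on M t s g"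
      by (blast intro: locally_affine_rightE[OF assms(1)])
    thus ?thesis using \<open>b \<le> c\<close> by (meson order_trans)
  next
    case False
    with t obtain s where "t < s" "s \<le> c" "affine_on M t s g"
      by (metis locally_affine_rightE[OF assms(2)] not_less)
    thus ?thesis by blast
  qed
next
  fix t assume t: "a < t \<and> t \<le> c"
  show "\<exists>s<t. a \<le> s \<and> affine_on M s t g"
  proof (cases "t \<le> b")
    case True
    with t obtain s where "s < t" "a \<le> s" "affine_on M s t g"
      by (blast intro: locally_affine_leftE[OF assms(1)])
    thus ?thesis by blast
  next
    case False
    with t obtain s where "s < t" "b \<le> s" "affine_on M s t g"
      by (metis locally_affine_leftE[OF assms(2)] not_le)
    thus ?thesis using \<open>a \<le> b\<close> by (meson order_trans)
  qed
qed

text \<open>Closure properties reduce to two functions affine on a common interval, which need to be combined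
  near one end of it only: their maximum, say, is not affine on the whole interval.\<close>

lemma locally_affine_combine:
  assumes f: "locally_affine M a b f" and g: "locally_affine N a b g"
    and right: "\<And>x y. a \<le> x \<Longrightarrow> x < y \<Longrightarrow> y \<le> b \<Longrightarrow> affine_on M x y f \<Longrightarrow> affine_on N x y g
                   \<Longrightarrow> \<exists>s>x. s \<le> y \<and> affine_on K x s h"
    and left: "\<And>x y. a \<le> x \<Longrightarrow> x < y \<Longrightarrow> y \<le> b \<Longrightarrow> affine_on M x y f \<Longrightarrow> affine_on N x y g
                   \<Longrightarrow> \<exists>s<y. x \<le> s \<and> affine_on K s y h"
  shows "locally_affine K a b h"
  unfolding locally_affine_def
proof (intro conjI allI impI)
  fix t assume t: "a \<le> t \<and> t < b"
  obtain s1 where s1: "s1 > t" "s1 \<le> b" "affine_on M t s1 f"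
    using f t unfolding locally_affine_def by auto
  obtain s2 where s2: "s2 > t" "s2 \<le> b" "affine_on N t s2 g"
    using g t unfolding locally_affine_def by auto
  have "\<exists>s>t. s \<le> min s1 s2 \<and> affine_on K t s h"
    by (rule right) (use t s1 s2 in \<open>auto intro: affine_on_subinterval min.coboundedI1\<close>)
  thus "\<exists>s>t. s \<le> b \<and> affine_on K t s h" using s1 by auto
next
  fix t assume t: "a < t \<and> t \<le> b"
  obtain s1 where s1: "s1 < t" "a \<le> s1" "affine_on M s1 t f"
    using f t unfolding locally_affine_def by auto
  obtain s2 where s2: "s2 < t" "a \<le> s2" "affine_on N s2 t g"
    using g t unfolding locally_affine_def by auto
  have "\<exists>s<t. max s1 s2 \<le> s \<and> affine_on K s t h"
    by (rule left) (use t s1 s2 in \<open>auto intro: affine_on_subinterval max.coboundedI1\<close>)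
  thus "\<exists>s<t. a \<le> s \<and> affine_on K s t h" using s1 by auto
qed

lemma locally_affine_add:
  assumes "locally_affine UNIV a b f" "locally_affine UNIV a b g"
  shows "locally_affine UNIV a b (\<lambda>t. f t + g t)"
proof -
  have *: "affine_on UNIV x y (\<lambda>t. f t + g t)"
    if fg: "affine_on UNIV x y f" "affine_on UNIV x y g" for x y
  proof -
    obtain m c where 1: "\<And>t. x \<le> ereal t \<Longrightarrow> ereal t \<le> y \<Longrightarrow> f t = of_int m * t + c"
      using fg unfolding affine_on_def by blast
    obtain k d where 2: "\<And>t. x \<le> ereal t \<Longrightarrow> ereal t \<le> y \<Longrightarrow> g t = of_int k * t + d"
      using fg unfolding affine_on_def by blast
    show ?thesis unfolding affine_on_def
      by (rule bexI[of _ "m + k"], rule exI[of _ "c + d"]) (auto simp: 1 2 algebra_simps)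
  qed
  show ?thesis by (rule locally_affine_combine[OF assms]) (use * in \<open>blast+\<close>)
qed

lemma locally_affine_uminus:
  assumes "locally_affine M a b f" "\<And>m. m \<in> M \<Longrightarrow> - m \<in> N"
  shows "locally_affine N a b (\<lambda>t. - f t)"
proof -
  have *: "affine_on N x y (\<lambda>t. - f t)" if af: "affine_on M x y f" for x y
  proof -
    obtain m c where 1: "m \<in> M" "\<And>t. x \<le> ereal t \<Longrightarrow> ereal t \<le> y \<Longrightarrow> f t = of_int m * t + c"
      using af by (rule affine_onE) (rule that)
    show ?thesis unfolding affine_on_def
      by (rule bexI[of _ "-m"], rule exI[of _ "-c"]) (auto simp: 1 assms(2))
  qed
  show ?thesis using assms(1) * unfolding locally_affine_def by blast
qed

lemma locally_affine_affine:
  "m \<in> M \<Longrightarrow> locally_affine M a b (\<lambda>t. of_int m * t + c)"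
  by (rule affine_imp_locally_affine) (auto simp: affine_on_def)

text \<open>The difference of two affine functions has at most one zero \<open>z\<close>; the shorter interval stops
  at \<open>z\<close>.\<close>

lemma affine_on_eventually_dominates:
  assumes "a \<le> x" "x < y" "- \<infinity> < x" "affine_on M x y f" "affine_on M x y g"
  shows "\<exists>s>x. s \<le> y \<and> ((\<forall>t. x \<le> ereal t \<and> ereal t \<le> s \<longrightarrow> f t \<le> g t) \<or>
                         (\<forall>t. x \<le> ereal t \<and> ereal t \<le> s \<longrightarrow> g t \<le> f t))"
    and "\<exists>s<y. x \<le> s \<and> ((\<forall>t. s \<le> ereal t \<and> ereal t \<le> y \<longrightarrow> f t \<le> g t) \<or>
                         (\<forall>t. s \<le> ereal t \<and> ereal t \<le> y \<longrightarrow> g t \<le> f t))"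
proof -
  obtain m c where 1: "\<And>t. x \<le> ereal t \<Longrightarrow> ereal t \<le> y \<Longrightarrow> f t = of_int m * t + c"
    using assms unfolding affine_on_def by blast
  obtain k d where 2: "\<And>t. x \<le> ereal t \<Longrightarrow> ereal t \<le> y \<Longrightarrow> g t = of_int k * t + d"
    using assms unfolding affine_on_def by blast
  show "\<exists>s>x. s \<le> y \<and> ((\<forall>t. x \<le> ereal t \<and> ereal t \<le> s \<longrightarrow> f t \<le> g t) \<or>
                         (\<forall>t. x \<le> ereal t \<and> ereal t \<le> s \<longrightarrow> g t \<le> f t))" (is ?A)
    and "\<exists>s<y. x \<le> s \<and> ((\<forall>t. s \<le> ereal t \<and> ereal t \<le> y \<longrightarrow> f t \<le> g t) \<or>
                         (\<forall>t. s \<le> ereal t \<and> ereal t \<le> y \<longrightarrow> g t \<le> f t))" (is ?B)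
  proof -
    define p :: real where "p = of_int m - of_int k"
    define q where "q = c - d"
    have d: "f t - g t = p * t + q" if "x \<le> ereal t" "ereal t \<le> y" for t
      using 1[OF that] 2[OF that] by (simp add: p_def q_def algebra_simps)
    have "?A \<and> ?B"
    proof (cases "p = 0")
      case True
      hence "(\<forall>t. x \<le> ereal t \<and> ereal t \<le> y \<longrightarrow> f t \<le> g t) \<or>
             (\<forall>t. x \<le> ereal t \<and> ereal t \<le> y \<longrightarrow> g t \<le> f t)"
        using d by (cases "q \<le> 0") (force, force)
      thus ?thesis using assms by blast
    next
      case False
      define z where "z = - q / p"
      have sgn: "(f t - g t) = p * (t - z)" if "x \<le> ereal t" "ereal t \<le> y" for t
        using d[OF that] False by (simp add: z_def field_simps)
      have ge: "(\<forall>t. a \<le> ereal t \<and> ereal t \<le> b \<longrightarrow> f t \<le> g t) \<or>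
                (\<forall>t. a \<le> ereal t \<and> ereal t \<le> b \<longrightarrow> g t \<le> f t)"
        if "x \<le> a" "b \<le> y" "ereal z \<le> a" for a b
      proof -
        have "f t - g t = p * (t - z) \<and> t - z \<ge> 0" if "a \<le> ereal t \<and> ereal t \<le> b" for t
          using sgn[of t] that \<open>x \<le> a\<close> \<open>b \<le> y\<close> \<open>ereal z \<le> a\<close>
          by (metis diff_ge_0_iff_ge ereal_less_eq(3) order_trans)
        thus ?thesis
          by (cases "p \<ge> 0") (metis diff_ge_0_iff_ge mult_nonneg_nonneg, 
              metis diff_le_0_iff_le linorder_not_le mult_nonneg_nonpos2 order_less_imp_le)
      qed
      have le: "(\<forall>t. a \<le> ereal t \<and> ereal t \<le> b \<longrightarrow> f t \<le> g t) \<or>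
                (\<forall>t. a \<le> ereal t \<and> ereal t \<le> b \<longrightarrow> g t \<le> f t)"
        if "x \<le> a" "b \<le> y" "b \<le> ereal z" for a b
      proof -
        have "f t - g t = p * (t - z) \<and> t - z \<le> 0" if "a \<le> ereal t \<and> ereal t \<le> b" for t
          using sgn[of t] that \<open>x \<le> a\<close> \<open>b \<le> y\<close> \<open>b \<le> ereal z\<close>
          by (metis diff_le_0_iff_le ereal_less_eq(3) order_trans)
        thus ?thesis
          by (cases "p \<ge> 0") (metis diff_le_0_iff_le mult_nonneg_nonpos, 
              metis diff_ge_0_iff_ge linorder_not_le mult_nonpos_nonpos order_less_imp_le)
      qed
      have ?A
        using ge[of x y] le[of x "min y (ereal z)"] assms(2)
        by (cases "ereal z \<le> x") (blast intro: order_refl, 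
            intro exI[of _ "min y (ereal z)"], auto simp: not_le)
      moreover have ?B
        using le[of x y] ge[of "max x (ereal z)" y] assms(2)
        by (cases "y \<le> ereal z") (blast intro: order_refl, 
            intro exI[of _ "max x (ereal z)"], auto simp: not_le)
      ultimately show ?thesis ..
    qed
    thus ?A ?B by auto
  qed
qed

text \<open>Common form of maximum and minimum: \<open>h\<close> selects one of the values \<open>f t\<close> and
  \<open>g t\<close> according to their order.\<close>

lemma locally_affine_choice:
  assumes "locally_affine M a b f" "locally_affine M a b g" "- \<infinity> < a"
    and hf: "\<And>t. f t \<le> g t \<Longrightarrow> h t = u (f t) (g t)" and hg: "\<And>t. g t \<le> f t \<Longrightarrow> h t = u (g t) (f t)"
    and u: "u = (\<lambda>x y. x) \<or> u = (\<lambda>x y. y)"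
  shows "locally_affine M a b h"
proof (rule locally_affine_combine[OF assms(1,2)])
  have *: "affine_on M x y h"
    if d: "(\<forall>t. x \<le> ereal t \<and> ereal t \<le> y \<longrightarrow> f t \<le> g t) \<or>
         (\<forall>t. x \<le> ereal t \<and> ereal t \<le> y \<longrightarrow> g t \<le> f t)"
      and fg: "affine_on M x y f" "affine_on M x y g" for x y
  proof -
    have "(\<forall>t. x \<le> ereal t \<and> ereal t \<le> y \<longrightarrow> h t = f t) \<or>
          (\<forall>t. x \<le> ereal t \<and> ereal t \<le> y \<longrightarrow> h t = g t)"
      using d u hf hg by metis
    thus ?thesis using fg unfolding affine_on_def by metis
  qed
  fix x y assume xy: "a \<le> x" "x < y" "y \<le> b" "affine_on M x y f" "affine_on M x y g"
  have "- \<infinity> < x" using xy(1) \<open>- \<infinity> < a\<close> by (rule order.strict_trans2[rotated])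
  note D = affine_on_eventually_dominates[OF xy(1,2) this xy(4,5)]
  show "\<exists>s>x. s \<le> y \<and> affine_on M x s h"
    using D(1) * xy(4,5) by (meson affine_on_subinterval order_refl)
  show "\<exists>s<y. x \<le> s \<and> affine_on M s y h"
    using D(2) * xy(4,5) by (meson affine_on_subinterval order_refl)
qed

lemma locally_affine_max:
  "locally_affine M a b f \<Longrightarrow> locally_affine M a b g \<Longrightarrow> - \<infinity> < a
    \<Longrightarrow> locally_affine M a b (\<lambda>t. max (f t) (g t))"
  by (rule locally_affine_choice[where u = "\<lambda>x y. y" and f = f and g = g]) auto

lemma locally_affine_min:
  "locally_affine M a b f \<Longrightarrow> locally_affine M a b g \<Longrightarrow> - \<infinity> < a
    \<Longrightarrow> locally_affine M a b (\<lambda>t. min (f t) (g t))"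
  by (rule locally_affine_choice[where u = "\<lambda>x y. x" and f = f and g = g]) auto

lemma locally_affine_Lipschitz:
  fixes K :: int
  assumes g: "locally_affine M a b g" and M: "M \<subseteq> {-K..K}"
    and st: "a \<le> ereal s" "ereal t \<le> b" "s \<le> t"
  shows "\<bar>g t - g s\<bar> \<le> of_int K * (t - s)"
proof (cases "s = t")
  case False
  define P where "P x y \<longleftrightarrow> (\<forall>u v. x \<le> ereal u \<longrightarrow> u \<le> v \<longrightarrow> ereal v \<le> y \<longrightarrow>
                      \<bar>g v - g u\<bar> \<le> of_int K * (v - u))" for x y
  have aff: "P x y" if af: "affine_on M x y g" for x y
    unfolding P_def
  proof (intro allI impI)
    fix u v assume uv: "x \<le> ereal u" "u \<le> v" "ereal v \<le> y"
    obtain m c where m: "m \<in> M" "\<And>t. x \<le> ereal t \<Longrightarrow> ereal t \<le> y \<Longrightarrow> g t = of_int m * t + c"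
      using af by (rule affine_onE) (rule that)
    have "x \<le> ereal v" "ereal u \<le> y" using uv by (meson ereal_less_eq(3) order_trans)+
    hence "g v - g u = of_int m * (v - u)" using m(2) uv by (simp add: algebra_simps)
    moreover have "\<bar>of_int m :: real\<bar> \<le> of_int K" using m(1) M by (auto simp: abs_le_iff) 
    ultimately show "\<bar>g v - g u\<bar> \<le> of_int K * (v - u)"
      using uv by (simp add: abs_mult mult_right_mono)
  qed
  have la: "locally_affine M (ereal s) (ereal t) g"
    by (rule locally_affine_subinterval[OF g st(1,2)])
  have "P (ereal s) (ereal t)"
  proof (rule interval_glue_induct)
    show "ereal s < ereal t" using False st by simp
    fix x y z assume xyz: "ereal s \<le> x" "x < y" "y < z" "z \<le> ereal t" "P x y" "P y z"
    then obtain w where w: "y = ereal w" by (cases y) auto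
    show "P x z" unfolding P_def
    proof (intro allI impI)
      fix u v assume uv: "x \<le> ereal u" "u \<le> v" "ereal v \<le> z"
      consider "v \<le> w" | "w \<le> u" | "u \<le> w" "w \<le> v" by linarith
      thus "\<bar>g v - g u\<bar> \<le> of_int K * (v - u)"
      proof cases
        case 3
        have "\<bar>g v - g w\<bar> \<le> of_int K * (v - w)" "\<bar>g w - g u\<bar> \<le> of_int K * (w - u)"
          using xyz(5,6) 3 uv unfolding P_def w by auto
        thus ?thesis by (simp add: algebra_simps)
      qed (use xyz(5,6) uv w in \<open>auto simp: P_def\<close>)
    qed
  next
    fix x assume "ereal s \<le> x" "x < ereal t"
    thus "\<exists>s>x. s \<le> ereal t \<and> (\<forall>u. x < u \<and> u \<le> s \<longrightarrow> P x u)"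
      using la aff unfolding locally_affine_def by (meson affine_on_subinterval order_refl)
  next
    fix x assume "ereal s < x" "x \<le> ereal t"
    thus "\<exists>y<x. ereal s \<le> y \<and> (\<forall>u. y \<le> u \<and> u < x \<longrightarrow> P u x)"
      using la aff unfolding locally_affine_def by (meson affine_on_subinterval order_refl)
  qed
  thus ?thesis using st by (simp add: P_def)
qed simp

text \<open>Together with the next lemma: on an interval, being locally affine is the same as being affine on
  the pieces of a finite subdivision.\<close>

lemma piecewise_imp_locally_affine:
  assumes "piecewise_affine L G"
  shows "locally_affine UNIV 0 L (\<lambda>t. real_of_ereal (G (ereal t)))"
proof -
  obtain n and p :: "nat \<Rightarrow> ereal" where p: "p 0 = 0" "p n = L" "\<And>i. i < n \<Longrightarrow> p i < p (Suc i)"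
    and aff: "\<forall>i<n. \<exists>m::int. \<exists>c::real. \<forall>t. ereal t \<in> {p i..p (Suc i)} \<longrightarrow> G (ereal t) = ereal (of_int m * t + c)"
    using assms unfolding piecewise_affine_def by blast
  have "0 \<le> p k \<and> locally_affine UNIV 0 (p k) (\<lambda>t. real_of_ereal (G (ereal t)))" if "k \<le> n" for k
    using that
  proof (induction k)
    case 0 thus ?case by (auto simp: p locally_affine_def)
  next
    case (Suc k)
    hence kn: "k < n" by simp
    obtain m :: int and c :: real where
      "\<forall>t. ereal t \<in> {p k..p (Suc k)} \<longrightarrow> G (ereal t) = ereal (of_int m * t + c)"
      using aff kn by blast
    hence "affine_on UNIV (p k) (p (Suc k)) (\<lambda>t. real_of_ereal (G (ereal t)))"
      unfolding affine_on_def by auto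
    hence "locally_affine UNIV (p k) (p (Suc k)) (\<lambda>t. real_of_ereal (G (ereal t)))"
      by (rule affine_imp_locally_affine)
    moreover have "p k \<le> p (Suc k)" using p(3)[OF kn] by simp
    ultimately show ?case using Suc.IH kn locally_affine_glue by (meson less_imp_le order_trans)
  qed
  thus ?thesis using p by auto
qed

lemma locally_imp_piecewise_affine:
  assumes g: "locally_affine UNIV 0 L g" and L: "0 < L"
    and G: "\<And>t. 0 \<le> t \<Longrightarrow> ereal t \<le> L \<Longrightarrow> G (ereal t) = ereal (g t)"
  shows "piecewise_affine L G"
proof -
  define P where "P a b \<longleftrightarrow> (\<exists>n. \<exists>p :: nat \<Rightarrow> ereal. p 0 = a \<and> p n = b \<and> (\<forall>i<n. p i < p (Suc i)) \<and>
        (\<forall>i<n. affine_on UNIV (p i) (p (Suc i)) g))" for a b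
  have aff: "P a b" if "affine_on UNIV a b g" "a < b" for a b
    unfolding P_def
    by (rule exI[of _ 1], rule exI[of _ "\<lambda>i. if i = 0 then a else b"]) (auto simp: that)
  have "P 0 L"
  proof (rule interval_glue_induct[OF L])
    fix x y z assume "P x y" "P y z"
    then obtain n p k q where
      p: "p 0 = x" "p n = y" "\<forall>i<n. p i < p (Suc i)" "\<forall>i<n. affine_on UNIV (p i) (p (Suc i)) g" and
      q: "q 0 = y" "q k = z" "\<forall>i<k. q i < q (Suc i)" "\<forall>i<k. affine_on UNIV (q i) (q (Suc i)) g"
      unfolding P_def by metis
    define r where "r i = (if i \<le> n then p i else q (i - n))" for i
    have r: "r i < r (Suc i) \<and> affine_on UNIV (r i) (r (Suc i)) g" if "i < n + k" for i
    proof (cases "i < n")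
      case True thus ?thesis using p by (auto simp: r_def)
    next
      case False
      hence "r i = q (i - n)" "r (Suc i) = q (Suc (i - n))" "i - n < k"
        using p q that by (auto simp: r_def Suc_diff_le)
      thus ?thesis using q by auto
    qed
    show "P x z" unfolding P_def
      by (rule exI[of _ "n + k"], rule exI[of _ r]) (use r p q in \<open>auto simp: r_def\<close>)
  next
    fix x assume "0 \<le> x" "x < L"
    thus "\<exists>s>x. s \<le> L \<and> (\<forall>u. x < u \<and> u \<le> s \<longrightarrow> P x u)"
      using g aff unfolding locally_affine_def by (meson affine_on_subinterval order_refl)
  next
    fix x assume "0 < x" "x \<le> L"
    thus "\<exists>s<x. 0 \<le> s \<and> (\<forall>u. s \<le> u \<and> u < x \<longrightarrow> P u x)"
      using g aff unfolding locally_affine_def by (meson affine_on_subinterval order_refl)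
  qed
  then obtain n and p :: "nat \<Rightarrow> ereal" where p: "p 0 = 0" "p n = L" "\<forall>i<n. p i < p (Suc i)"
    "\<forall>i<n. affine_on UNIV (p i) (p (Suc i)) g"
    unfolding P_def by blast
  have up: "p i \<le> p j" if "i \<le> j" "j \<le> n" for i j
    using that
  proof (induction rule: dec_induct)
    case (step k)
    hence "p i \<le> p k" "p k < p (Suc k)" using p(3) by auto
    thus ?case by simp
  qed simp
  show ?thesis
    unfolding piecewise_affine_def
  proof (intro exI[of _ n] exI[of _ p] conjI p allI impI)
    fix i assume i: "i < n"
    then obtain m c where m: "\<And>t. p i \<le> ereal t \<Longrightarrow> ereal t \<le> p (Suc i) \<Longrightarrow> g t = of_int m * t + c"
      using p(4) unfolding affine_on_def by blast
    have "0 \<le> p i" "p (Suc i) \<le> L" using up[of 0 i] up[of "Suc i" n] p i by auto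
    hence "G (ereal t) = ereal (of_int m * t + c)" if "ereal t \<in> {p i..p (Suc i)}" for t
      using G[of t] m[of t] that
      by (metis atLeastAtMost_iff ereal_less_eq(3) order_trans zero_ereal_def)
    thus "\<exists>m::int. \<exists>c::real. \<forall>t. ereal t \<in> {p i..p (Suc i)} \<longrightarrow> G (ereal t) = ereal (of_int m * t + c)"
      by blast
  qed
qed

lemma continuous_on_affine_ereal:
  "continuous_on S (\<lambda>x. ereal m * x + ereal c)"
  unfolding continuous_on_def
  by (intro ballI tendsto_add_ereal_general tendsto_cmult_ereal tendsto_const tendsto_ident_at) auto

text \<open>At an endpoint \<open>\<infinity>\<close>, the limit of \<open>m t + c\<close> is \<open>m * \<infinity> + c\<close>, also for
  \<open>m = 0\<close> because \<open>0 * \<infinity> = 0\<close> in the extended reals.\<close>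

lemma locally_affine_continuous_on:
  assumes g: "locally_affine M a b g" and ab: "a < b" "- \<infinity> < a"
    and G: "\<And>t. a \<le> ereal t \<Longrightarrow> ereal t \<le> b \<Longrightarrow> G (ereal t) = ereal (g t)"
    and inf: "b = \<infinity> \<Longrightarrow> \<exists>m c T. (\<forall>t\<ge>T. g t = of_int m * t + c) \<and> G \<infinity> = ereal (of_int m) * \<infinity> + ereal c"
  shows "continuous_on {a..b} G"
proof (rule interval_glue_induct[where P = "\<lambda>x y. continuous_on {x..y} G", OF ab(1)])
  fix x y z assume xyz: "a \<le> x" "x < y" "y < z" "continuous_on {x..y} G" "continuous_on {y..z} G"
  have "continuous_on ({x..y} \<union> {y..z}) G"
    by (rule continuous_on_closed_Un) (use xyz in auto)
  thus "continuous_on {x..z} G"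
    using xyz by (simp add: ivl_disj_un_two_touch less_imp_le)
next
  have aff: "continuous_on {x..y} G" if xy: "affine_on M x y g" "a \<le> x" "x < y" "y \<le> b" for x y
  proof -
    obtain m c where m: "\<And>t. x \<le> ereal t \<Longrightarrow> ereal t \<le> y \<Longrightarrow> g t = of_int m * t + c"
      using xy unfolding affine_on_def by blast
    have "G t = ereal (of_int m) * t + ereal c" if t: "t \<in> {x..y}" for t
    proof (cases t)
      case (real r)
      thus ?thesis using m[of r] G[of r] t xy by auto
    next
      case PInf
      hence "y = \<infinity>" "b = \<infinity>" using t xy by auto
      then obtain m' c' T where T: "\<And>t. t \<ge> T \<Longrightarrow> g t = of_int m' * t + c'"
        "G \<infinity> = ereal (of_int m') * \<infinity> + ereal c'" using inf by blast
      obtain R where R: "x \<le> ereal R"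
        using xy by (metis \<open>y = \<infinity>\<close> ereal_dense2 less_imp_le)
      define w where "w = max T R"
      have w: "x \<le> ereal w" "T \<le> w" by (auto simp: w_def intro: order_trans[OF R])
      have "x \<le> ereal (w + 1)" using w(1) by (meson ereal_less_eq(3) less_add_one less_imp_le order_trans)
      hence "of_int m * w + c = of_int m' * w + c'" "of_int m * (w + 1) + c = of_int m' * (w + 1) + c'"
        using m[of w] m[of "w + 1"] T(1)[of w] T(1)[of "w + 1"] w \<open>y = \<infinity>\<close> by auto
      hence "m = m' \<and> c = c'" using affine_coefficients_unique[of m w c m' c' "w + 1"] by simp
      thus ?thesis using T PInf by simp
    next
      case MInf thus ?thesis using t xy ab by auto
    qed
    thus ?thesis using continuous_on_affine_ereal by (metis (no_types, lifting) continuous_on_cong)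
  qed
  { fix x assume "a \<le> x" "x < b"
    then obtain s where s: "s > x" "s \<le> b" "affine_on M x s g"
      using g unfolding locally_affine_def by meson
    show "\<exists>s>x. s \<le> b \<and> (\<forall>u. x < u \<and> u \<le> s \<longrightarrow> continuous_on {x..u} G)"
      by (rule exI[of _ s]) (use s aff \<open>a \<le> x\<close> affine_on_subinterval in \<open>meson order_refl order_trans\<close>)
  next
    fix x assume "a < x" "x \<le> b"
    then obtain s where s: "s < x" "a \<le> s" "affine_on M s x g"
      using g unfolding locally_affine_def by meson
    show "\<exists>s<x. a \<le> s \<and> (\<forall>u. s \<le> u \<and> u < x \<longrightarrow> continuous_on {u..x} G)"
      by (rule exI[of _ s]) (use s aff \<open>x \<le> b\<close> affine_on_subinterval in \<open>meson order_refl order_trans\<close>) }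
qed

section \<open>Points and continuous functions on a tropical curve\<close>

locale trop =
  fixes \<Gamma> :: "('a, 'e) curve"
  assumes tropical: "tropical_curve \<Gamma>"
begin

abbreviation pt :: "'e \<Rightarrow> real \<Rightarrow> 'a" where
  "pt e t \<equiv> chart \<Gamma> e (ereal t)"

lemma finite_verts: "finite (verts \<Gamma>)" and verts_nonempty: "verts \<Gamma> \<noteq> {}"
  and finite_edges: "finite (edges \<Gamma>)"
  and start_vertex: "e \<in> edges \<Gamma> \<Longrightarrow> chart \<Gamma> e 0 \<in> verts \<Gamma>"
  and end_vertex: "e \<in> edges \<Gamma> \<Longrightarrow> chart \<Gamma> e (len \<Gamma> e) \<in> verts \<Gamma>"
  and graph_connected: "u \<in> verts \<Gamma> \<Longrightarrow> v \<in> verts \<Gamma> \<Longrightarrow> (u, v) \<in> (adjacent \<Gamma>)\<^sup>*"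
  and len_pos: "e \<in> edges \<Gamma> \<Longrightarrow> 0 < len \<Gamma> e"
  and chart_in_points: "e \<in> edges \<Gamma> \<Longrightarrow> t \<in> {0..len \<Gamma> e} \<Longrightarrow> chart \<Gamma> e t \<in> points \<Gamma>"
  and points_eq: "points \<Gamma> = verts \<Gamma> \<union> (\<Union>e\<in>edges \<Gamma>. chart \<Gamma> e ` {0..len \<Gamma> e})"
  and interior_not_vertex: "e \<in> edges \<Gamma> \<Longrightarrow> t \<in> {0<..<len \<Gamma> e} \<Longrightarrow> chart \<Gamma> e t \<notin> verts \<Gamma>"
  and openin_curve: "openin (topo \<Gamma>) U \<longleftrightarrow> U \<subseteq> points \<Gamma> \<and>
        (\<forall>e\<in>edges \<Gamma>. openin (top_of_set {0..len \<Gamma> e}) {t \<in> {0..len \<Gamma> e}. chart \<Gamma> e t \<in> U})"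
  and infinite_end_leaf: "e \<in> edges \<Gamma> \<Longrightarrow> len \<Gamma> e = \<infinity> \<Longrightarrow> leaf_end \<Gamma> (chart \<Gamma> e \<infinity>)"
  and inj_charts: "inj_on (\<lambda>(e, t). chart \<Gamma> e t) (SIGMA e:edges \<Gamma>. {0<..<len \<Gamma> e})"
proof -
  note T = tropical[unfolded tropical_curve_def]
  from T show "finite (verts \<Gamma>)" by (elim conjE)
  from T show "verts \<Gamma> \<noteq> {}" by (elim conjE)
  from T show "finite (edges \<Gamma>)" by (elim conjE)
  from T have 1: "\<forall>e\<in>edges \<Gamma>. chart \<Gamma> e 0 \<in> verts \<Gamma> \<and> chart \<Gamma> e (len \<Gamma> e) \<in> verts \<Gamma>"
    by (elim conjE)
  from 1 show "e \<in> edges \<Gamma> \<Longrightarrow> chart \<Gamma> e 0 \<in> verts \<Gamma>" by blast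
  from 1 show "e \<in> edges \<Gamma> \<Longrightarrow> chart \<Gamma> e (len \<Gamma> e) \<in> verts \<Gamma>" by blast
  from T have 2: "\<forall>u\<in>verts \<Gamma>. \<forall>v\<in>verts \<Gamma>. (u, v) \<in> (adjacent \<Gamma>)\<^sup>*" by (elim conjE)
  thus "u \<in> verts \<Gamma> \<Longrightarrow> v \<in> verts \<Gamma> \<Longrightarrow> (u, v) \<in> (adjacent \<Gamma>)\<^sup>*" by blast
  from T have 3: "len \<Gamma> \<in> edges \<Gamma> \<rightarrow>\<^sub>E {0<..}" by (elim conjE)
  thus "e \<in> edges \<Gamma> \<Longrightarrow> 0 < len \<Gamma> e" by (auto dest: PiE_mem)
  from T have 4: "chart \<Gamma> \<in> (\<Pi>\<^sub>E e\<in>edges \<Gamma>. {0..len \<Gamma> e} \<rightarrow>\<^sub>E points \<Gamma>)" by (elim conjE)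
  show "e \<in> edges \<Gamma> \<Longrightarrow> t \<in> {0..len \<Gamma> e} \<Longrightarrow> chart \<Gamma> e t \<in> points \<Gamma>"
    using PiE_mem[OF PiE_mem[OF 4]] by blast
  from T show "points \<Gamma> = verts \<Gamma> \<union> (\<Union>e\<in>edges \<Gamma>. chart \<Gamma> e ` {0..len \<Gamma> e})" by (elim conjE)
  from T have 5: "\<forall>e\<in>edges \<Gamma>. chart \<Gamma> e ` {0<..<len \<Gamma> e} \<inter> verts \<Gamma> = {}" by (elim conjE)
  thus "e \<in> edges \<Gamma> \<Longrightarrow> t \<in> {0<..<len \<Gamma> e} \<Longrightarrow> chart \<Gamma> e t \<notin> verts \<Gamma>" by blast
  from T have 6: "\<forall>U. openin (topo \<Gamma>) U \<longleftrightarrow> U \<subseteq> points \<Gamma> \<and>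
        (\<forall>e\<in>edges \<Gamma>. openin (top_of_set {0..len \<Gamma> e}) {t \<in> {0..len \<Gamma> e}. chart \<Gamma> e t \<in> U})"
    by (elim conjE)
  thus "openin (topo \<Gamma>) U \<longleftrightarrow> U \<subseteq> points \<Gamma> \<and>
        (\<forall>e\<in>edges \<Gamma>. openin (top_of_set {0..len \<Gamma> e}) {t \<in> {0..len \<Gamma> e}. chart \<Gamma> e t \<in> U})"
    by (rule spec)
  from T have 7: "\<forall>e\<in>edges \<Gamma>. len \<Gamma> e = \<infinity> \<longrightarrow> leaf_end \<Gamma> (chart \<Gamma> e \<infinity>)" by (elim conjE)
  thus "e \<in> edges \<Gamma> \<Longrightarrow> len \<Gamma> e = \<infinity> \<Longrightarrow> leaf_end \<Gamma> (chart \<Gamma> e \<infinity>)" by blast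
  from T show "inj_on (\<lambda>(e, t). chart \<Gamma> e t) (SIGMA e:edges \<Gamma>. {0<..<len \<Gamma> e})" by (elim conjE)
qed

text \<open>An interior point of an edge has no other parameter, not even as an end of an edge, since the ends
  are vertices.\<close>

lemma interior_unique:
  assumes "e \<in> edges \<Gamma>" "t \<in> {0<..<len \<Gamma> e}" "e' \<in> edges \<Gamma>" "t' \<in> {0..len \<Gamma> e'}"
    and eq: "chart \<Gamma> e' t' = chart \<Gamma> e t"
  shows "e' = e \<and> t' = t"
proof -
  have "t' \<noteq> 0" "t' \<noteq> len \<Gamma> e'"
    using interior_not_vertex[OF assms(1,2)] start_vertex[OF assms(3)] end_vertex[OF assms(3)] eq
    by metis+
  hence "(e', t') \<in> (SIGMA e:edges \<Gamma>. {0<..<len \<Gamma> e})" using assms by auto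
  thus ?thesis using inj_onD[OF inj_charts, of "(e', t')" "(e, t)"] assms by auto
qed

text \<open>The end at infinity has valence one, and the edge \<open>e\<close> already accounts for it.\<close>

lemma infinite_end_unique:
  assumes e: "e \<in> edges \<Gamma>" "len \<Gamma> e = \<infinity>" and e': "e' \<in> edges \<Gamma>" "t' \<in> {0..len \<Gamma> e'}"
    and eq: "chart \<Gamma> e' t' = chart \<Gamma> e \<infinity>"
  shows "e' = e \<and> t' = \<infinity>"
proof -
  let ?v = "chart \<Gamma> e \<infinity>"
  let ?A = "{e \<in> edges \<Gamma>. chart \<Gamma> e 0 = ?v}" and ?B = "{e \<in> edges \<Gamma>. chart \<Gamma> e (len \<Gamma> e) = ?v}"
  have v: "?v \<in> verts \<Gamma>" and val: "card ?A + card ?B = 1"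
    using infinite_end_leaf[OF e] by (auto simp: leaf_end_def valence_def)
  have fin: "finite ?A" "finite ?B" using finite_edges by auto
  have eB: "e \<in> ?B" using e by simp
  hence "card ?B > 0" using fin by (auto simp: card_gt_0_iff)
  hence "card ?A = 0" "card ?B = 1" using val by auto
  hence A: "?A = {}" using fin by simp
  obtain b where "?B = {b}" using \<open>card ?B = 1\<close> by (rule card_1_singletonE)
  hence B: "?B = {e}" using eB by (metis singletonD)
  have "t' \<notin> {0<..<len \<Gamma> e'}" using interior_not_vertex[OF e'(1)] v eq by metis
  moreover have "t' \<noteq> 0" using A e' eq by auto
  ultimately have "t' = len \<Gamma> e'" using e' by auto
  thus ?thesis using B e' e eq by auto
qed

lemma chart_finite_iff:
  assumes "e \<in> edges \<Gamma>" "t \<in> {0..len \<Gamma> e}"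
  shows "chart \<Gamma> e t \<in> finite_points \<Gamma> \<longleftrightarrow> t \<noteq> \<infinity>"
  using assms infinite_end_unique[of _ e t] chart_in_points[OF assms]
  unfolding finite_points_def points_at_infinity_def by fastforce

lemma finite_pointI:
  assumes "e \<in> edges \<Gamma>" "0 \<le> t" "ereal t \<le> len \<Gamma> e"
  shows "pt e t \<in> finite_points \<Gamma>"
  using chart_finite_iff[of e "ereal t"] assms by simp

lemma finite_subset_points: "finite_points \<Gamma> \<subseteq> points \<Gamma>"
  by (auto simp: finite_points_def)

lemma vertex_on_edge:
  assumes "edges \<Gamma> \<noteq> {}" "v \<in> verts \<Gamma>"
  obtains e where "e \<in> edges \<Gamma>" "v = chart \<Gamma> e 0 \<or> v = chart \<Gamma> e (len \<Gamma> e)"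
proof -
  obtain e where e: "e \<in> edges \<Gamma>" using assms by auto
  have "(v, chart \<Gamma> e 0) \<in> (adjacent \<Gamma>)\<^sup>*" using graph_connected start_vertex e assms by blast
  thus ?thesis
  proof (cases rule: converse_rtranclE)
    case base thus ?thesis using that e by blast
  next
    case (step y)
    then obtain e' where "e' \<in> edges \<Gamma>" "{v, y} = {chart \<Gamma> e' 0, chart \<Gamma> e' (len \<Gamma> e')}"
      unfolding adjacent_def by auto
    thus ?thesis using that by (metis doubleton_eq_iff)
  qed
qed

text \<open>A vertex lies on no edge only if it is the whole curve: by connectedness an edge leaves every vertex
  as soon as there are other vertices or edges.\<close>

lemma point_cases:
  assumes "x \<in> points \<Gamma>"
  obtains (single) "edges \<Gamma> = {}" "points \<Gamma> = {x}" "finite_points \<Gamma> = {x}"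
  | (fin) e t where "e \<in> edges \<Gamma>" "0 \<le> t" "ereal t \<le> len \<Gamma> e" "x = pt e t"
      "x \<in> finite_points \<Gamma>"
  | (inf) e where "e \<in> edges \<Gamma>" "len \<Gamma> e = \<infinity>" "x = chart \<Gamma> e \<infinity>" "x \<notin> finite_points \<Gamma>"
proof (cases "edges \<Gamma> = {}")
  case True
  have "y = x" if y: "y \<in> verts \<Gamma>" for y
  proof -
    have "x \<in> verts \<Gamma>" using assms True by (simp add: points_eq)
    hence "(y, x) \<in> (adjacent \<Gamma>)\<^sup>*" using graph_connected y by blast
    moreover have "adjacent \<Gamma> = {}" using True by (simp add: adjacent_def)
    ultimately show ?thesis by simp
  qed
  hence "verts \<Gamma> = {x}" using verts_nonempty by blast
  hence "points \<Gamma> = {x}" using True points_eq by simp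
  thus ?thesis using single True by (auto simp: finite_points_def points_at_infinity_def)
next
  case False
  obtain e t where et: "e \<in> edges \<Gamma>" "t \<in> {0..len \<Gamma> e}" "x = chart \<Gamma> e t"
  proof (cases "x \<in> verts \<Gamma>")
    case True
    from vertex_on_edge[OF False True] obtain e
      where e: "e \<in> edges \<Gamma>" "x = chart \<Gamma> e 0 \<or> x = chart \<Gamma> e (len \<Gamma> e)" .
    have "0 \<le> len \<Gamma> e" using len_pos[OF e(1)] by simp
    thus ?thesis using that[of e 0] that[of e "len \<Gamma> e"] e by auto
  next
    case False thus ?thesis using assms that by (auto simp: points_eq)
  qed
  show ?thesis
  proof (cases t)
    case (real r)
    thus ?thesis using fin[of e r] et finite_pointI[of e r] by auto
  next
    case PInf
    thus ?thesis using inf[of e] et chart_finite_iff[of e t] by auto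
  next
    case MInf thus ?thesis using et by auto
  qed
qed

lemma finite_points_nonempty: "finite_points \<Gamma> \<noteq> {}"
proof -
  obtain v where v: "v \<in> points \<Gamma>" using verts_nonempty by (auto simp: points_eq)
  from v show ?thesis
  proof (cases rule: point_cases)
    case (inf e)
    thus ?thesis using finite_pointI[of e 0] by auto
  qed auto
qed

text \<open>The parameters of a finite point. A vertex has one for each end of an edge at it; so these
  parameters, each with its two directions, describe a neighbourhood.\<close>

definition preimages :: "'a \<Rightarrow> ('e \<times> real) set" where
  "preimages x = {(e, s). e \<in> edges \<Gamma> \<and> 0 \<le> s \<and> ereal s \<le> len \<Gamma> e \<and> pt e s = x}"

lemma finite_preimages: "finite (preimages x)"
proof (cases "x \<in> verts \<Gamma>")
  case True
  have "s = 0 \<or> s = real_of_ereal (len \<Gamma> e)" if "(e, s) \<in> preimages x" for e s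
  proof (rule ccontr)
    assume "\<not> ?thesis"
    hence "ereal s \<in> {0<..<len \<Gamma> e}" using that by (cases "len \<Gamma> e") (auto simp: preimages_def)
    thus False using interior_not_vertex[of e "ereal s"] True that by (auto simp: preimages_def)
  qed
  hence "preimages x \<subseteq> (SIGMA e:edges \<Gamma>. {0, real_of_ereal (len \<Gamma> e)})"
    by (auto simp: preimages_def)
  thus ?thesis using finite_edges by (auto intro: finite_subset)
next
  case False
  have inner: "ereal s \<in> {0<..<len \<Gamma> e}" if "(e, s) \<in> preimages x" for e s
  proof -
    have "ereal s \<noteq> 0" "ereal s \<noteq> len \<Gamma> e"
      using that False start_vertex[of e] end_vertex[of e] by (auto simp: preimages_def zero_ereal_def)
    thus ?thesis using that by (auto simp: preimages_def zero_ereal_def)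
  qed
  have "p = q" if "p \<in> preimages x" "q \<in> preimages x" for p q
    using that inner[of "fst p" "snd p"] interior_unique[of "fst p" "ereal (snd p)" "fst q" "ereal (snd q)"]
    by (cases p; cases q) (auto simp: preimages_def)
  hence "preimages x = {} \<or> (\<exists>p. preimages x = {p})" by blast
  thus ?thesis by auto
qed

lemma continuous_map_chart:
  assumes "e \<in> edges \<Gamma>"
  shows "continuous_map (top_of_set {0..len \<Gamma> e}) (topo \<Gamma>) (chart \<Gamma> e)"
  unfolding continuous_map_def using assms openin_curve chart_in_points by auto

text \<open>The curve carries the quotient topology, so continuity may be tested on each edge.\<close>

lemma continuous_map_curve_iff:
  fixes f :: "'a \<Rightarrow> 'b::topological_space"
  shows "continuous_map (topo \<Gamma>) euclidean f \<longleftrightarrow>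
           (\<forall>e\<in>edges \<Gamma>. continuous_on {0..len \<Gamma> e} (\<lambda>t. f (chart \<Gamma> e t)))"
proof -
  have "openin (topo \<Gamma>) {x \<in> points \<Gamma>. f x \<in> U} \<longleftrightarrow>
     (\<forall>e\<in>edges \<Gamma>. openin (top_of_set {0..len \<Gamma> e}) {t \<in> {0..len \<Gamma> e}. f (chart \<Gamma> e t) \<in> U})" for U
  proof -
    have "{t \<in> {0..len \<Gamma> e}. chart \<Gamma> e t \<in> {x \<in> points \<Gamma>. f x \<in> U}} =
          {t \<in> {0..len \<Gamma> e}. f (chart \<Gamma> e t) \<in> U}" if "e \<in> edges \<Gamma>" for e
      using chart_in_points[OF that] by blast
    thus ?thesis unfolding openin_curve by auto
  qed
  hence "continuous_map (topo \<Gamma>) euclidean f \<longleftrightarrow>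
    (\<forall>e\<in>edges \<Gamma>. continuous_map (top_of_set {0..len \<Gamma> e}) euclidean (\<lambda>t. f (chart \<Gamma> e t)))"
    unfolding continuous_map_def by auto
  thus ?thesis by simp
qed

lemma openin_superlevel:
  fixes f :: "'a \<Rightarrow> ereal"
  assumes "continuous_map (topo \<Gamma>) euclidean f"
  shows "openin (topo \<Gamma>) {x \<in> points \<Gamma>. f x > c}" "openin (topo \<Gamma>) {x \<in> points \<Gamma>. f x < c}"
  using openin_continuous_map_preimage[OF assms, of "{c<..}"]
        openin_continuous_map_preimage[OF assms, of "{..<c}"] by auto

lemma compact_curve: "compact_space (topo \<Gamma>)"
proof -
  have "compactin (topo \<Gamma>) (chart \<Gamma> e ` {0..len \<Gamma> e})" if "e \<in> edges \<Gamma>" for e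
    by (rule image_compactin[OF _ continuous_map_chart[OF that]])
       (simp add: compactin_subtopology compact_eq_closed)
  moreover have "compactin (topo \<Gamma>) (verts \<Gamma>)"
    using finite_verts by (simp add: finite_imp_compactin points_eq)
  ultimately show ?thesis
    unfolding compact_space_def
    by (subst points_eq) (intro compactin_Un compactin_Union, use finite_edges in auto)
qed

text \<open>Points are closed, as they have finitely many parameters.\<close>

lemma openin_remove_point: "openin (topo \<Gamma>) (points \<Gamma> - {x})"
  unfolding openin_curve
proof (intro conjI ballI)
  fix e assume e: "e \<in> edges \<Gamma>"
  define F where "F = {t \<in> {0..len \<Gamma> e}. chart \<Gamma> e t = x}"
  have "F \<subseteq> insert \<infinity> ((ereal \<circ> snd) ` preimages x)"
  proof
    fix t assume t: "t \<in> F"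
    show "t \<in> insert \<infinity> ((ereal \<circ> snd) ` preimages x)"
    proof (cases t)
      case (real r)
      hence "(e, r) \<in> preimages x" using t e by (auto simp: F_def preimages_def)
      thus ?thesis using real by force
    qed (use t in \<open>auto simp: F_def\<close>)
  qed
  hence "finite F" using finite_preimages by (auto intro: finite_subset)
  moreover have "{t \<in> {0..len \<Gamma> e}. chart \<Gamma> e t \<in> points \<Gamma> - {x}} = {0..len \<Gamma> e} \<inter> (- F)"
    using chart_in_points[OF e] by (auto simp: F_def)
  ultimately show "openin (top_of_set {0..len \<Gamma> e}) {t \<in> {0..len \<Gamma> e}. chart \<Gamma> e t \<in> points \<Gamma> - {x}}"
    by (metis finite_imp_closed openin_open open_Compl)
qed auto

text \<open>Finite points are dense: an open set containing the end at infinity of an edge contains a ray of the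
  edge.\<close>

lemma openin_meets_finite_points:
  assumes "openin (topo \<Gamma>) U" "U \<noteq> {}"
  obtains x where "x \<in> U" "x \<in> finite_points \<Gamma>"
proof -
  obtain y where y: "y \<in> U" "y \<in> points \<Gamma>" using assms openin_subset by blast
  show ?thesis using y(2)
  proof (cases rule: point_cases)
    case (inf e)
    have "openin (top_of_set {0..len \<Gamma> e}) {t \<in> {0..len \<Gamma> e}. chart \<Gamma> e t \<in> U}"
      using assms(1) inf(1) unfolding openin_curve by blast
    then obtain V where V: "open V" "{t \<in> {0..\<infinity>}. chart \<Gamma> e t \<in> U} = {0..\<infinity>} \<inter> V"
      unfolding openin_open inf(2) by (elim exE conjE) (rule that)
    have "\<infinity> \<in> {t \<in> {0..\<infinity>}. chart \<Gamma> e t \<in> U}" using inf y by simp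
    hence "\<infinity> \<in> V" using V(2) by blast
    then obtain c where "{ereal c<..} \<subseteq> V" using V open_PInfty by blast
    hence "ereal (max 0 c + 1) \<in> {0..\<infinity>} \<inter> V" by auto
    hence "pt e (max 0 c + 1) \<in> U" using V by blast
    thus ?thesis using that finite_pointI[of e "max 0 c + 1"] inf by auto
  qed (use that y in auto)
qed

lemma continuous_eq_on_points:
  fixes f g :: "'a \<Rightarrow> 'b::t2_space"
  assumes "continuous_map (topo \<Gamma>) euclidean f" "continuous_map (topo \<Gamma>) euclidean g"
    and "\<And>x. x \<in> finite_points \<Gamma> \<Longrightarrow> f x = g x" and "x \<in> points \<Gamma>"
  shows "f x = g x"
proof (rule ccontr)
  assume "f x \<noteq> g x"
  then obtain U V where UV: "open U" "open V" "f x \<in> U" "g x \<in> V" "U \<inter> V = {}"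
    using separation_t2 by metis
  define W where "W = {y \<in> points \<Gamma>. f y \<in> U} \<inter> {y \<in> points \<Gamma>. g y \<in> V}"
  have "openin (topo \<Gamma>) W" unfolding W_def
    using openin_continuous_map_preimage[OF assms(1)] openin_continuous_map_preimage[OF assms(2)] UV
    by (intro openin_Int) auto
  moreover have "x \<in> W" using UV assms by (auto simp: W_def)
  ultimately obtain y where "y \<in> W" "y \<in> finite_points \<Gamma>"
    using openin_meets_finite_points by blast
  thus False using UV assms(3) by (auto simp: W_def)
qed

end

section \<open>Rational functions as piecewise linear functions on the finite points\<close>

definition PL :: "int set \<Rightarrow> ('a, 'e) curve \<Rightarrow> ('a \<Rightarrow> real) \<Rightarrow> bool" where
  "PL M \<Gamma> h \<longleftrightarrow> (\<forall>e\<in>edges \<Gamma>. locally_affine M 0 (len \<Gamma> e) (\<lambda>t. h (chart \<Gamma> e (ereal t))))"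

text \<open>The rational function with given values at the finite points; every rational function except
  \<open>-\<infinity>\<close> is of this form with a piecewise linear \<open>h\<close>.\<close>

definition extend :: "('a, 'e) curve \<Rightarrow> ('a \<Rightarrow> real) \<Rightarrow> 'a \<Rightarrow> ereal" where
  "extend \<Gamma> h = continuous_extension \<Gamma> (\<lambda>x. ereal (h x))"

lemma continuous_extension_cong:
  "(\<And>x. x \<in> finite_points \<Gamma> \<Longrightarrow> h x = k x) \<Longrightarrow> continuous_extension \<Gamma> h = continuous_extension \<Gamma> k"
  unfolding continuous_extension_def by simp

lemma extend_cong:
  "(\<And>x. x \<in> finite_points \<Gamma> \<Longrightarrow> h x = k x) \<Longrightarrow> extend \<Gamma> h = extend \<Gamma> k"
  unfolding extend_def by (rule continuous_extension_cong) simp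

lemma PL_add: "PL UNIV \<Gamma> h \<Longrightarrow> PL UNIV \<Gamma> k \<Longrightarrow> PL UNIV \<Gamma> (\<lambda>x. h x + k x)"
  unfolding PL_def by (auto intro: locally_affine_add)

lemma PL_uminus: "PL UNIV \<Gamma> h \<Longrightarrow> PL UNIV \<Gamma> (\<lambda>x. - h x)"
  unfolding PL_def by (auto intro: locally_affine_uminus)

lemma PL_max: "PL M \<Gamma> h \<Longrightarrow> PL M \<Gamma> k \<Longrightarrow> PL M \<Gamma> (\<lambda>x. max (h x) (k x))"
  unfolding PL_def by (auto intro: locally_affine_max)

lemma PL_const: "PL UNIV \<Gamma> (\<lambda>x. c)"
  unfolding PL_def using locally_affine_affine[of 0 UNIV _ _ c] by simp

lemma PL_mono: "PL M \<Gamma> h \<Longrightarrow> M \<subseteq> N \<Longrightarrow> PL N \<Gamma> h"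
  unfolding PL_def by (auto intro: locally_affine_mono)

lemma PL_UNIV: "PL M \<Gamma> h \<Longrightarrow> PL UNIV \<Gamma> h"
  by (rule PL_mono) auto

context trop
begin

lemma PL_cong:
  assumes "\<And>x. x \<in> finite_points \<Gamma> \<Longrightarrow> h x = k x"
  shows "PL M \<Gamma> h \<longleftrightarrow> PL M \<Gamma> k"
  unfolding PL_def
  by (intro ball_cong refl locally_affine_cong) (auto intro!: assms finite_pointI)

lemma PL_eventually_affine:
  assumes "PL M \<Gamma> h" "e \<in> edges \<Gamma>" "len \<Gamma> e = \<infinity>"
  obtains m c T where "m \<in> M" "0 \<le> T"
    "\<And>t. T \<le> t \<Longrightarrow> h (pt e t) = of_int m * t + c"
proof -
  have "locally_affine M 0 \<infinity> (\<lambda>t. h (pt e t))"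
    using assms unfolding PL_def by metis
  then obtain s where s: "s < \<infinity>" "0 \<le> s" "affine_on M s \<infinity> (\<lambda>t. h (pt e t))"
    by (rule locally_affine_leftE) auto
  from s(3) obtain m c where "m \<in> M" "\<And>t. s \<le> ereal t \<Longrightarrow> h (pt e t) = of_int m * t + c"
    by (rule affine_onE) auto
  with s show ?thesis by (intro that[of m "real_of_ereal s" c]; cases s) auto
qed

text \<open>As finite points are dense, a continuous function agreeing with \<open>h\<close> there is the only one.\<close>

lemma continuous_extension_eqI:
  assumes "k \<in> extensional (points \<Gamma>)" "continuous_map (topo \<Gamma>) euclidean k"
    and "\<And>x. x \<in> finite_points \<Gamma> \<Longrightarrow> k x = h x"
  shows "continuous_extension \<Gamma> h = k"
  unfolding continuous_extension_def
proof (rule the_equality)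
  fix k' assume k': "k' \<in> extensional (points \<Gamma>) \<and> continuous_map (topo \<Gamma>) euclidean k' \<and>
             (\<forall>x\<in>finite_points \<Gamma>. k' x = h x)"
  show "k' = k"
  proof (rule extensionalityI[of _ "points \<Gamma>"])
    show "k' x = k x" if "x \<in> points \<Gamma>" for x
      by (rule continuous_eq_on_points[OF _ assms(2) _ that]) (use k' assms(3) in auto)
  qed (use k' assms in auto)
qed (use assms in auto)

text \<open>An edge of infinite length is eventually mapped by \<open>m t + c\<close>; the limit of this function is
  the value at the end, which lies on no other edge.\<close>

lemma extension_exists:
  assumes h: "PL UNIV \<Gamma> h"
  obtains k where "k \<in> extensional (points \<Gamma>)" "continuous_map (topo \<Gamma>) euclidean k"
    "\<And>x. x \<in> finite_points \<Gamma> \<Longrightarrow> k x = ereal (h x)"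
    "\<And>e. e \<in> edges \<Gamma> \<Longrightarrow> len \<Gamma> e = \<infinity> \<Longrightarrow> \<exists>m c T. 
       (\<forall>t\<ge>T. h (pt e t) = of_int m * t + c) \<and> 
       k (chart \<Gamma> e \<infinity>) = ereal (of_int m) * \<infinity> + ereal c"
proof -
  define R where "R e v \<longleftrightarrow> (\<exists>m c T. (\<forall>t\<ge>T. h (pt e t) = of_int m * t + c) \<and> 
       v = ereal (of_int m) * \<infinity> + ereal c)" for e v
  define Q where "Q x v \<longleftrightarrow> (\<exists>e. e \<in> edges \<Gamma> \<and> len \<Gamma> e = \<infinity> \<and> x = chart \<Gamma> e \<infinity> \<and> R e v)" for x v
  \<comment> \<open>At a point at infinity, \<open>Q\<close> relates it to the limit along the edge that it ends;
    the uniqueness of this edge makes the choice harmless.\<close>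
  define k where "k = (\<lambda>x\<in>points \<Gamma>. if x \<in> finite_points \<Gamma> then ereal (h x) else (SOME v. Q x v))"
  have fin: "k x = ereal (h x)" if "x \<in> finite_points \<Gamma>" for x
    using that finite_subset_points by (auto simp: k_def)
  have inf: "R e (k (chart \<Gamma> e \<infinity>))" if e: "e \<in> edges \<Gamma>" "len \<Gamma> e = \<infinity>" for e
  proof -
    obtain m c T where "\<And>t. T \<le> t \<Longrightarrow> h (pt e t) = of_int m * t + c"
      using PL_eventually_affine[OF h e] by metis
    hence "R e (ereal (of_int m) * \<infinity> + ereal c)" unfolding R_def by blast
    hence "Q (chart \<Gamma> e \<infinity>) (ereal (of_int m) * \<infinity> + ereal c)" using e unfolding Q_def by blast
    hence "Q (chart \<Gamma> e \<infinity>) (SOME v. Q (chart \<Gamma> e \<infinity>) v)" by (rule someI)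
    moreover have "k (chart \<Gamma> e \<infinity>) = (SOME v. Q (chart \<Gamma> e \<infinity>) v)"
      using chart_finite_iff[of e \<infinity>] chart_in_points[of e \<infinity>] e by (simp add: k_def)
    ultimately have "Q (chart \<Gamma> e \<infinity>) (k (chart \<Gamma> e \<infinity>))" by simp
    then obtain e' where "e' \<in> edges \<Gamma>" "len \<Gamma> e' = \<infinity>" "chart \<Gamma> e' \<infinity> = chart \<Gamma> e \<infinity>"
      "R e' (k (chart \<Gamma> e \<infinity>))" unfolding Q_def by metis
    moreover from this have "e' = e" using infinite_end_unique[OF e, of e' \<infinity>] by simp
    ultimately show ?thesis by simp
  qed
  show ?thesis
  proof (rule that[of k])
    show "k \<in> extensional (points \<Gamma>)" by (simp add: k_def)
    show "continuous_map (topo \<Gamma>) euclidean k"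
      unfolding continuous_map_curve_iff
    proof
      fix e assume e: "e \<in> edges \<Gamma>"
      show "continuous_on {0..len \<Gamma> e} (\<lambda>t. k (chart \<Gamma> e t))"
      proof (rule locally_affine_continuous_on[of UNIV _ _ "\<lambda>t. h (pt e t)"])
        show "locally_affine UNIV 0 (len \<Gamma> e) (\<lambda>t. h (pt e t))"
          using h e unfolding PL_def by blast
        show "\<exists>m c T. (\<forall>t\<ge>T. h (pt e t) = real_of_int m * t + c) \<and>
                k (chart \<Gamma> e \<infinity>) = ereal (real_of_int m) * \<infinity> + ereal c" if "len \<Gamma> e = \<infinity>"
          using inf[OF e that] unfolding R_def .
      qed (use e len_pos fin finite_pointI in auto)
    qed
    show "\<exists>m c T. (\<forall>t\<ge>T. h (pt e t) = of_int m * t + c) \<and> 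
       k (chart \<Gamma> e \<infinity>) = ereal (of_int m) * \<infinity> + ereal c" if "e \<in> edges \<Gamma>" "len \<Gamma> e = \<infinity>" for e
      using inf[OF that] unfolding R_def .
  qed (rule fin)
qed

lemma extend_eqI:
  assumes "k \<in> extensional (points \<Gamma>)" "continuous_map (topo \<Gamma>) euclidean k"
    and "\<And>x. x \<in> finite_points \<Gamma> \<Longrightarrow> k x = ereal (h x)"
  shows "extend \<Gamma> h = k"
  unfolding extend_def by (rule continuous_extension_eqI[OF assms])

lemma
  assumes "PL UNIV \<Gamma> h"
  shows extend_extensional: "extend \<Gamma> h \<in> extensional (points \<Gamma>)"
    and extend_continuous: "continuous_map (topo \<Gamma>) euclidean (extend \<Gamma> h)"
    and extend_finite: "x \<in> finite_points \<Gamma> \<Longrightarrow> extend \<Gamma> h x = ereal (h x)"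
  using extension_exists[OF assms] extend_eqI by metis+

lemma extend_at_infinity:
  assumes "PL UNIV \<Gamma> h" "e \<in> edges \<Gamma>" "len \<Gamma> e = \<infinity>"
    and aff: "\<And>t. T \<le> t \<Longrightarrow> h (pt e t) = of_int m * t + c"
  shows "extend \<Gamma> h (chart \<Gamma> e \<infinity>) = ereal (of_int m) * \<infinity> + ereal c"
proof -
  obtain k where k: "k \<in> extensional (points \<Gamma>)" "continuous_map (topo \<Gamma>) euclidean k"
    "\<And>x. x \<in> finite_points \<Gamma> \<Longrightarrow> k x = ereal (h x)"
    "\<And>e. e \<in> edges \<Gamma> \<Longrightarrow> len \<Gamma> e = \<infinity> \<Longrightarrow> \<exists>m c T. 
       (\<forall>t\<ge>T. h (pt e t) = of_int m * t + c) \<and> 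
       k (chart \<Gamma> e \<infinity>) = ereal (of_int m) * \<infinity> + ereal c"
    using extension_exists[OF assms(1)] by metis
  obtain m' c' T' where T': "\<And>t. T' \<le> t \<Longrightarrow> h (pt e t) = of_int m' * t + c'"
    "k (chart \<Gamma> e \<infinity>) = ereal (of_int m') * \<infinity> + ereal c'"
    using k(4)[OF assms(2,3)] by blast
  let ?w = "max T T'"
  have "of_int m * ?w + c = of_int m' * ?w + c'"
    "of_int m * (?w + 1) + c = of_int m' * (?w + 1) + c'"
    using aff[of ?w] aff[of "?w + 1"] T'(1)[of ?w] T'(1)[of "?w + 1"] by auto
  hence "m = m' \<and> c = c'"
    using affine_coefficients_unique[of m ?w c m' c' "?w + 1"] by simp
  thus ?thesis using extend_eqI[OF k(1-3)] T' by simp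
qed

lemma extend_eq_iff:
  assumes "PL UNIV \<Gamma> h" "PL UNIV \<Gamma> k"
  shows "extend \<Gamma> h = extend \<Gamma> k \<longleftrightarrow> (\<forall>x\<in>finite_points \<Gamma>. h x = k x)"
  using extend_finite[OF assms(1)] extend_finite[OF assms(2)] extend_cong[of \<Gamma> h k]
  by (metis ereal.inject)

text \<open>Values at infinity are computed by continuity: both sides are continuous and agree at the finite
  points. The function on the left has to be assumed piecewise linear because \<open>a\<close> need not be
  an integer.\<close>

lemma extend_affine_at:
  assumes h: "PL UNIV \<Gamma> h" and k: "PL UNIV \<Gamma> (\<lambda>x. a * h x + b)" and x: "x \<in> points \<Gamma>"
  shows "extend \<Gamma> (\<lambda>x. a * h x + b) x = ereal a * extend \<Gamma> h x + ereal b"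
proof (rule continuous_eq_on_points[OF extend_continuous[OF k] _ _ x])
  show "continuous_map (topo \<Gamma>) euclidean (\<lambda>x. ereal a * extend \<Gamma> h x + ereal b)"
    using extend_continuous[OF h] unfolding continuous_map_curve_iff
    by (auto intro: continuous_on_compose2[OF continuous_on_affine_ereal[of UNIV]])
qed (simp add: extend_finite[OF h] extend_finite[OF k])

lemma extend_max_at:
  assumes h: "PL UNIV \<Gamma> h" and k: "PL UNIV \<Gamma> k" and x: "x \<in> points \<Gamma>"
  shows "extend \<Gamma> (\<lambda>x. max (h x) (k x)) x = max (extend \<Gamma> h x) (extend \<Gamma> k x)"
proof (rule continuous_eq_on_points[OF extend_continuous[OF PL_max[OF h k]] _ _ x])
  show "continuous_map (topo \<Gamma>) euclidean (\<lambda>x. max (extend \<Gamma> h x) (extend \<Gamma> k x))"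
    using extend_continuous[OF h] extend_continuous[OF k] unfolding continuous_map_curve_iff
    by (auto intro: continuous_on_max)
qed (simp add: extend_finite[OF h] extend_finite[OF k] extend_finite[OF PL_max[OF h k]])

lemma continuous_map_restrict_const:
  "continuous_map (topo \<Gamma>) euclidean (\<lambda>x\<in>points \<Gamma>. c)"
  by (rule continuous_map_eq[of _ _ "\<lambda>x. c"]) auto

lemma extend_const: "extend \<Gamma> (\<lambda>x. c) = (\<lambda>x\<in>points \<Gamma>. ereal c)"
  by (rule extend_eqI[OF _ continuous_map_restrict_const]) (use finite_subset_points in auto)

lemma extend_in_rational_functions:
  assumes "PL UNIV \<Gamma> h"
  shows "extend \<Gamma> h \<in> rational_functions \<Gamma>"
proof -
  have "piecewise_affine (len \<Gamma> e) (\<lambda>t. extend \<Gamma> h (chart \<Gamma> e t))" if "e \<in> edges \<Gamma>" for e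
    using assms that len_pos[OF that] extend_finite[OF assms] finite_pointI
    by (intro locally_imp_piecewise_affine[of _ "\<lambda>t. h (pt e t)"]) (auto simp: PL_def)
  thus ?thesis using extend_extensional[OF assms] extend_continuous[OF assms] extend_finite[OF assms]
    unfolding rational_functions_def by simp
qed

lemma extend_not_zero: "PL UNIV \<Gamma> h \<Longrightarrow> extend \<Gamma> h \<noteq> (\<lambda>x\<in>points \<Gamma>. - \<infinity>)"
  using finite_points_nonempty finite_subset_points extend_finite
  by (metis MInfty_neq_ereal(2) ex_in_conv restrict_apply' subsetD)

lemma rational_function_cases:
  assumes "f \<in> rational_functions \<Gamma>"
  obtains "f = (\<lambda>x\<in>points \<Gamma>. - \<infinity>)" | h where "PL UNIV \<Gamma> h" "f = extend \<Gamma> h"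
proof (cases "f = (\<lambda>x\<in>points \<Gamma>. - \<infinity>)")
  case False
  hence f: "f \<in> extensional (points \<Gamma>)" "continuous_map (topo \<Gamma>) euclidean f"
    "\<And>e. e \<in> edges \<Gamma> \<Longrightarrow> piecewise_affine (len \<Gamma> e) (\<lambda>t. f (chart \<Gamma> e t))"
    "\<And>x. x \<in> finite_points \<Gamma> \<Longrightarrow> f x \<noteq> \<infinity> \<and> f x \<noteq> - \<infinity>"
    using assms unfolding rational_functions_def by auto
  let ?h = "\<lambda>x. real_of_ereal (f x)"
  have "PL UNIV \<Gamma> ?h" unfolding PL_def using piecewise_imp_locally_affine[OF f(3)] by simp
  moreover have "extend \<Gamma> ?h = f"
    using extend_eqI[OF f(1,2)] f(4) by (metis ereal_real' abs_ereal.simps(2) abs_ereal.simps(3) ereal_infinity_cases)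
  ultimately show ?thesis using that by metis
qed (use that in simp)

section \<open>The semiring of rational functions\<close>

lemma Rat_zero: "\<zero>\<^bsub>Rat \<Gamma>\<^esub> = (\<lambda>x\<in>points \<Gamma>. - \<infinity>)"
  and Rat_one: "\<one>\<^bsub>Rat \<Gamma>\<^esub> = extend \<Gamma> (\<lambda>x. 0)"
  and Rat_carrier: "carrier (Rat \<Gamma>) = rational_functions \<Gamma>"
  by (simp_all add: Rat_def extend_const zero_ereal_def)

lemma Rat_mult:
  assumes "PL UNIV \<Gamma> h" "PL UNIV \<Gamma> k"
  shows "extend \<Gamma> h \<otimes>\<^bsub>Rat \<Gamma>\<^esub> extend \<Gamma> k = extend \<Gamma> (\<lambda>x. h x + k x)"
  unfolding extend_def[of \<Gamma> "\<lambda>x. h x + k x"]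
  by (simp add: Rat_def, rule continuous_extension_cong)
     (simp add: extend_finite[OF assms(1)] extend_finite[OF assms(2)])

lemma Rat_add:
  assumes "PL UNIV \<Gamma> h" "PL UNIV \<Gamma> k"
  shows "extend \<Gamma> h \<oplus>\<^bsub>Rat \<Gamma>\<^esub> extend \<Gamma> k = extend \<Gamma> (\<lambda>x. max (h x) (k x))"
  unfolding extend_def[of \<Gamma> "\<lambda>x. max (h x) (k x)"]
  by (simp add: Rat_def, rule continuous_extension_cong)
     (simp add: extend_finite[OF assms(1)] extend_finite[OF assms(2)])

lemma rational_function_finite:
  assumes "f \<in> rational_functions \<Gamma>" "x \<in> finite_points \<Gamma>"
  shows "f x \<noteq> \<infinity>"
  using assms(1)
  by (cases rule: rational_function_cases) (use assms(2) finite_subset_points extend_finite in auto)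

lemma rational_function_regular:
  assumes "f \<in> rational_functions \<Gamma>"
  shows "f \<in> extensional (points \<Gamma>)" "continuous_map (topo \<Gamma>) euclidean f"
  using assms by (cases rule: rational_function_cases;
      simp add: continuous_map_restrict_const extend_extensional extend_continuous)+

text \<open>At a finite point no value is \<open>\<infinity>\<close>, so \<open>-\<infinity>\<close> absorbs it in sums; the extension of the
  result is immediate.\<close>

lemma Rat_zero_ops:
  assumes f: "f \<in> rational_functions \<Gamma>"
  shows "\<zero>\<^bsub>Rat \<Gamma>\<^esub> \<otimes>\<^bsub>Rat \<Gamma>\<^esub> f = \<zero>\<^bsub>Rat \<Gamma>\<^esub>" "f \<otimes>\<^bsub>Rat \<Gamma>\<^esub> \<zero>\<^bsub>Rat \<Gamma>\<^esub> = \<zero>\<^bsub>Rat \<Gamma>\<^esub>"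
    "\<zero>\<^bsub>Rat \<Gamma>\<^esub> \<oplus>\<^bsub>Rat \<Gamma>\<^esub> f = f" "f \<oplus>\<^bsub>Rat \<Gamma>\<^esub> \<zero>\<^bsub>Rat \<Gamma>\<^esub> = f"
proof -
  have fin: "x \<in> points \<Gamma>" "f x \<noteq> \<infinity>" if "x \<in> finite_points \<Gamma>" for x
    using that rational_function_finite[OF f] finite_subset_points by auto
  show "\<zero>\<^bsub>Rat \<Gamma>\<^esub> \<otimes>\<^bsub>Rat \<Gamma>\<^esub> f = \<zero>\<^bsub>Rat \<Gamma>\<^esub>" "f \<otimes>\<^bsub>Rat \<Gamma>\<^esub> \<zero>\<^bsub>Rat \<Gamma>\<^esub> = \<zero>\<^bsub>Rat \<Gamma>\<^esub>"
    unfolding Rat_def by (auto intro!: continuous_extension_eqI continuous_map_restrict_const simp: fin)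
  show "\<zero>\<^bsub>Rat \<Gamma>\<^esub> \<oplus>\<^bsub>Rat \<Gamma>\<^esub> f = f" "f \<oplus>\<^bsub>Rat \<Gamma>\<^esub> \<zero>\<^bsub>Rat \<Gamma>\<^esub> = f"
    unfolding Rat_def using rational_function_regular[OF f]
    by (auto intro!: continuous_extension_eqI simp: fin)
qed

lemma Rat_zero_closed: "\<zero>\<^bsub>Rat \<Gamma>\<^esub> \<in> carrier (Rat \<Gamma>)"
  unfolding Rat_carrier Rat_zero rational_functions_def by blast

lemma Rat_one_closed: "\<one>\<^bsub>Rat \<Gamma>\<^esub> \<in> carrier (Rat \<Gamma>)"
  unfolding Rat_carrier Rat_one by (rule extend_in_rational_functions[OF PL_const])

lemma Rat_closed:
  assumes "f \<in> carrier (Rat \<Gamma>)" "g \<in> carrier (Rat \<Gamma>)"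
  shows "f \<otimes>\<^bsub>Rat \<Gamma>\<^esub> g \<in> carrier (Rat \<Gamma>)" "f \<oplus>\<^bsub>Rat \<Gamma>\<^esub> g \<in> carrier (Rat \<Gamma>)"
proof -
  note z = Rat_zero_closed
  have f: "f \<in> rational_functions \<Gamma>" and g: "g \<in> rational_functions \<Gamma>"
    using assms by (simp_all add: Rat_carrier)
  have "f \<otimes>\<^bsub>Rat \<Gamma>\<^esub> g \<in> carrier (Rat \<Gamma>) \<and> f \<oplus>\<^bsub>Rat \<Gamma>\<^esub> g \<in> carrier (Rat \<Gamma>)"
    using f
  proof (cases rule: rational_function_cases)
    case 1
    thus ?thesis using Rat_zero_ops[OF g] z assms by (simp add: Rat_zero)
  next
    case h: (2 h)
    from g show ?thesis
    proof (cases rule: rational_function_cases)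
      case 1
      thus ?thesis using Rat_zero_ops[OF f] z assms by (simp add: Rat_zero)
    next
      case (2 k)
      thus ?thesis using h
        by (simp add: Rat_mult Rat_add Rat_carrier extend_in_rational_functions PL_add PL_max)
    qed
  qed
  thus "f \<otimes>\<^bsub>Rat \<Gamma>\<^esub> g \<in> carrier (Rat \<Gamma>)" "f \<oplus>\<^bsub>Rat \<Gamma>\<^esub> g \<in> carrier (Rat \<Gamma>)" by auto
qed

end

section \<open>The distance\<close>

lemma uniform_small:
  assumes "finite P" "\<And>p. p \<in> P \<Longrightarrow> \<exists>\<epsilon>>0::real. \<forall>\<delta>. 0 < \<delta> \<and> \<delta> \<le> \<epsilon> \<longrightarrow> Q p \<delta>"
  obtains \<epsilon> where "\<epsilon> > 0" "\<And>p. p \<in> P \<Longrightarrow> Q p \<epsilon>"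
proof -
  have "\<exists>\<epsilon>>0. \<forall>\<delta>. 0 < \<delta> \<and> \<delta> \<le> \<epsilon> \<longrightarrow> (\<forall>p\<in>P. Q p \<delta>)"
    using assms
  proof (induction P rule: finite_induct)
    case (insert p P)
    obtain a where a: "a > 0" "\<forall>\<delta>. 0 < \<delta> \<and> \<delta> \<le> a \<longrightarrow> (\<forall>p\<in>P. Q p \<delta>)" using insert by auto
    obtain b where b: "b > 0" "\<forall>\<delta>. 0 < \<delta> \<and> \<delta> \<le> b \<longrightarrow> Q p \<delta>" using insert.prems[of p] by auto
    show ?case by (rule exI[of _ "min a b"]) (use a b in auto)
  qed (auto intro: exI[of _ 1])
  thus ?thesis using that by blast
qed

context trop
begin

text \<open>The real-valued distance of finite points, for which paths exist.\<close>

definition rdist :: "'a \<Rightarrow> 'a \<Rightarrow> real" where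
  "rdist x y = Inf {d. path_length \<Gamma> x y d}"

lemma path_length_nonneg: "path_length \<Gamma> x y d \<Longrightarrow> 0 \<le> d"
  by (induction rule: path_length.induct) auto

lemma reach_along_edge:
  assumes "\<exists>d. path_length \<Gamma> x (pt e s) d" "e \<in> edges \<Gamma>"
    and "0 \<le> s" "ereal s \<le> len \<Gamma> e" "0 \<le> t" "ereal t \<le> len \<Gamma> e"
  shows "\<exists>d. path_length \<Gamma> x (pt e t) d"
  using assms path_length.segment[of \<Gamma> x e s _ t] by auto

text \<open>Walking along a sequence of adjacent vertices, all finite points on the edges at the current vertex
  remain reachable. Formulating it for edges instead of vertices copes with vertices at infinity, which
  themselves cannot be reached: such a vertex lies on one edge only, so the walk has to return.\<close>

lemma reach_incident_edges:
  assumes "(u, v) \<in> (adjacent \<Gamma>)\<^sup>*" and u: "path_length \<Gamma> x u d" "u \<in> finite_points \<Gamma>"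
  shows "\<forall>e\<in>edges \<Gamma>. v = chart \<Gamma> e 0 \<or> v = chart \<Gamma> e (len \<Gamma> e) \<longrightarrow>
           (\<forall>t. 0 \<le> t \<longrightarrow> ereal t \<le> len \<Gamma> e \<longrightarrow> (\<exists>d. path_length \<Gamma> x (pt e t) d))"
  using assms(1)
proof (induction rule: rtrancl_induct)
  case base
  have "\<exists>s. 0 \<le> s \<and> ereal s \<le> len \<Gamma> e \<and> u = pt e s"
    if e: "e \<in> edges \<Gamma>" "u = chart \<Gamma> e 0 \<or> u = chart \<Gamma> e (len \<Gamma> e)" for e
    using e(2)
  proof
    assume "u = chart \<Gamma> e 0"
    thus ?thesis using len_pos[OF e(1)] by (intro exI[of _ 0]) (auto simp: zero_ereal_def less_imp_le)
  next
    assume *: "u = chart \<Gamma> e (len \<Gamma> e)"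
    hence "len \<Gamma> e \<noteq> \<infinity>" using chart_finite_iff[of e "len \<Gamma> e"] len_pos[OF e(1)] u(2) e(1) by auto
    thus ?thesis using * len_pos[OF e(1)]
      by (intro exI[of _ "real_of_ereal (len \<Gamma> e)"]; cases "len \<Gamma> e") auto
  qed
  thus ?case using u(1) reach_along_edge by metis
next
  case (step y z)
  obtain e1 where e1: "e1 \<in> edges \<Gamma>" "{y, z} = {chart \<Gamma> e1 0, chart \<Gamma> e1 (len \<Gamma> e1)}"
    using step.hyps(2) unfolding adjacent_def by auto
  obtain a where a: "a = 0 \<or> a = len \<Gamma> e1" "z = chart \<Gamma> e1 a" using e1(2) by (metis doubleton_eq_iff)
  have y: "y = chart \<Gamma> e1 0 \<or> y = chart \<Gamma> e1 (len \<Gamma> e1)" using e1(2) by (metis doubleton_eq_iff)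
  have a_in: "a \<in> {0..len \<Gamma> e1}" using a len_pos[OF e1(1)] by auto
  have reach1: "\<exists>d. path_length \<Gamma> x (pt e1 t) d" if "0 \<le> t" "ereal t \<le> len \<Gamma> e1" for t
    using step.IH e1(1) y that by blast
  show ?case
  proof (intro ballI impI allI)
    fix e t assume e: "e \<in> edges \<Gamma>" "z = chart \<Gamma> e 0 \<or> z = chart \<Gamma> e (len \<Gamma> e)"
      and t: "0 \<le> t" "ereal t \<le> len \<Gamma> e"
    obtain b where b: "b = 0 \<or> b = len \<Gamma> e" "z = chart \<Gamma> e b" using e(2) by metis
    have b_in: "b \<in> {0..len \<Gamma> e}" using b len_pos[OF e(1)] by auto
    show "\<exists>d. path_length \<Gamma> x (pt e t) d"
    proof (cases "a = \<infinity>")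
      case True
      hence "e = e1" using infinite_end_unique[of e1 e b] a a_in b b_in e(1) e1(1) by auto
      thus ?thesis using reach1 t by simp
    next
      case False
      then obtain r where r: "a = ereal r" using a_in by (cases a) auto
      have "b \<noteq> \<infinity>" using chart_finite_iff[OF e1(1) a_in] chart_finite_iff[OF e(1) b_in] a b False by simp
      then obtain s where s: "b = ereal s" using b_in by (cases b) auto
      have "\<exists>d. path_length \<Gamma> x (pt e s) d"
        using reach1[of r] a_in a(2) b(2) r s by auto
      thus ?thesis using reach_along_edge[OF _ e(1) _ _ t, of x s] b_in s by auto
    qed
  qed
qed

lemma path_exists:
  assumes x: "x \<in> finite_points \<Gamma>" and y: "y \<in> finite_points \<Gamma>"
  shows "\<exists>d. path_length \<Gamma> x y d"
proof -
  have xp: "x \<in> points \<Gamma>" "y \<in> points \<Gamma>" using x y finite_subset_points by auto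
  note triv = path_length.trivial[OF xp(1)]
  from xp(1) show ?thesis
  proof (cases rule: point_cases)
    case single thus ?thesis using triv xp by auto
  next
    case (fin e s)
    have 0: "\<exists>d. path_length \<Gamma> x (chart \<Gamma> e 0) d"
      using reach_along_edge[of x e s 0] triv fin len_pos[of e] by (auto simp: zero_ereal_def less_imp_le)
    have u: "chart \<Gamma> e 0 \<in> finite_points \<Gamma>"
      using finite_pointI[of e 0] fin len_pos[of e] by (simp add: zero_ereal_def)
    from xp(2) show ?thesis
    proof (cases rule: point_cases)
      case (fin e' t)
      have "(chart \<Gamma> e 0, chart \<Gamma> e' 0) \<in> (adjacent \<Gamma>)\<^sup>*"
        using graph_connected start_vertex \<open>e \<in> edges \<Gamma>\<close> fin by blast
      thus ?thesis using reach_incident_edges[of _ _ x] 0 u fin by blast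
    qed (use triv xp y in auto)
  qed (use x in auto)
qed

lemma rdist_le: "path_length \<Gamma> x y d \<Longrightarrow> rdist x y \<le> d"
  unfolding rdist_def by (rule cInf_lower) (auto intro: path_length_nonneg)

lemma rdist_greatest:
  assumes "x \<in> finite_points \<Gamma>" "y \<in> finite_points \<Gamma>" "\<And>d. path_length \<Gamma> x y d \<Longrightarrow> c \<le> d"
  shows "c \<le> rdist x y"
  unfolding rdist_def by (rule cInf_greatest) (use assms path_exists in auto)

lemma rdist_less_path:
  assumes "x \<in> finite_points \<Gamma>" "y \<in> finite_points \<Gamma>" "rdist x y < c"
  obtains d where "path_length \<Gamma> x y d" "d < c"
  using rdist_greatest[OF assms(1,2), of c] assms(3) by (meson not_le)

lemma rdist_nonneg: "x \<in> finite_points \<Gamma> \<Longrightarrow> y \<in> finite_points \<Gamma> \<Longrightarrow> 0 \<le> rdist x y"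
  by (rule rdist_greatest) (auto intro: path_length_nonneg)

lemma rdist_self: assumes "x \<in> finite_points \<Gamma>" shows "rdist x x = 0"
proof -
  have "rdist x x \<le> 0" by (rule rdist_le[OF path_length.trivial]) (use assms finite_subset_points in auto)
  thus ?thesis using rdist_nonneg[OF assms assms] by simp
qed

lemma curve_dist_eq_rdist:
  assumes "x \<in> finite_points \<Gamma>" "y \<in> finite_points \<Gamma>"
  shows "curve_dist \<Gamma> x y = ereal (rdist x y)"
proof -
  have "ereal (Inf {d. path_length \<Gamma> x y d}) = (INF d\<in>{d. path_length \<Gamma> x y d}. ereal d)"
    by (rule ereal_Inf') (use path_exists[OF assms] in \<open>auto intro!: bdd_belowI path_length_nonneg\<close>)
  moreover have "{ereal d |d. path_length \<Gamma> x y d} = ereal ` {d. path_length \<Gamma> x y d}" by auto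
  ultimately show ?thesis unfolding curve_dist_def rdist_def by simp
qed

lemma rdist_segment:
  assumes "x \<in> finite_points \<Gamma>" "e \<in> edges \<Gamma>" "0 \<le> s" "ereal s \<le> len \<Gamma> e" "0 \<le> t" "ereal t \<le> len \<Gamma> e"
  shows "rdist x (pt e t) \<le> rdist x (pt e s) + \<bar>s - t\<bar>"
proof -
  have "rdist x (pt e t) - \<bar>s - t\<bar> \<le> rdist x (pt e s)"
  proof (rule rdist_greatest[OF assms(1)])
    fix d assume "path_length \<Gamma> x (pt e s) d"
    from rdist_le[OF path_length.segment[OF this, of t]] assms
    show "rdist x (pt e t) - \<bar>s - t\<bar> \<le> d" by simp
  qed (use assms finite_pointI in auto)
  thus ?thesis by simp
qed

text \<open>The three ways in which a path of length \<open>d\<close> from \<open>x\<close> can lead to the point with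
  parameter \<open>t\<close> of the edge \<open>e\<close>: it starts on this edge, or it enters it through one of
  its two ends. In each case the rest of the path is at least as long as the segment
  that remains.\<close>

definition enters_edge :: "'a \<Rightarrow> 'e \<Rightarrow> real \<Rightarrow> real \<Rightarrow> bool" where
  "enters_edge x e t d \<longleftrightarrow>
     (\<exists>s\<ge>0. ereal s \<le> len \<Gamma> e \<and> x = pt e s \<and> \<bar>s - t\<bar> \<le> d) \<or>
     (\<exists>d'. path_length \<Gamma> x (chart \<Gamma> e 0) d' \<and> d' + t \<le> d) \<or>
     (\<exists>L d'. len \<Gamma> e = ereal L \<and> path_length \<Gamma> x (chart \<Gamma> e (ereal L)) d' \<and> d' + (L - t) \<le> d)"

lemma enters_edge_move:
  assumes "enters_edge x e s d" shows "enters_edge x e t (d + \<bar>s - t\<bar>)"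
proof -
  have 1: "\<bar>r - s\<bar> \<le> d \<Longrightarrow> \<bar>r - t\<bar> \<le> d + \<bar>s - t\<bar>" for r by linarith
  have 2: "d' + s \<le> d \<Longrightarrow> d' + t \<le> d + \<bar>s - t\<bar>" for d' by linarith
  have 3: "d' + (L - s) \<le> d \<Longrightarrow> d' + (L - t) \<le> d + \<bar>s - t\<bar>" for d' L by linarith
  show ?thesis using assms unfolding enters_edge_def using 1 2 3 by blast
qed

text \<open>By induction along the path. A segment ending in the interior of \<open>e\<close> runs on \<open>e\<close>; if
  the path ends at a vertex, it enters \<open>e\<close> there.\<close>

lemma path_enters_edge:
  assumes "path_length \<Gamma> x y d" "e \<in> edges \<Gamma>" "0 \<le> t" "ereal t \<le> len \<Gamma> e" "y = pt e t"
  shows "enters_edge x e t d"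
  using assms
proof (induction arbitrary: e t rule: path_length.induct)
  case (trivial x)
  thus ?case unfolding enters_edge_def by force
next
  case (segment x e' s d t')
  have path: "path_length \<Gamma> x (pt e t) (d + \<bar>s - t'\<bar>)"
    using path_length.segment[OF segment.hyps] segment.prems by simp
  consider "t = 0" | "ereal t = len \<Gamma> e" | "ereal t \<in> {0<..<len \<Gamma> e}"
    using segment.prems by (auto simp: zero_ereal_def less_le)
  thus ?case
  proof cases
    case 1 thus ?thesis using path unfolding enters_edge_def by (auto simp: zero_ereal_def)
  next
    case 2
    thus ?thesis using path unfolding enters_edge_def
      by (intro disjI2 exI[of _ t] exI[of _ "d + \<bar>s - t'\<bar>"]) auto
  next
    case 3
    hence "e' = e" "t' = t"
      using interior_unique[OF segment.prems(1) 3, of e' "ereal t'"] segment by auto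
    thus ?thesis using enters_edge_move segment by simp
  qed
qed

lemma rdist_ge_enters:
  assumes "x \<in> finite_points \<Gamma>" "e \<in> edges \<Gamma>" "0 \<le> t" "ereal t \<le> len \<Gamma> e"
    and "\<And>d. enters_edge x e t d \<Longrightarrow> c \<le> d"
  shows "c \<le> rdist x (pt e t)"
  by (rule rdist_greatest) (use assms path_enters_edge finite_pointI in auto)

text \<open>On an edge the distance from \<open>x\<close> is the minimum of the lengths of the ways through the
  start (\<open>A + t\<close>), through the end (\<open>B t\<close>) and along the edge (\<open>C t\<close>); each is
  piecewise affine with slopes \<open>\<plusminus>1\<close>.\<close>

lemma rdist_PL:
  assumes x: "x \<in> finite_points \<Gamma>"
  shows "PL {-1, 1} \<Gamma> (rdist x)"
  unfolding PL_def
proof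
  fix e assume e: "e \<in> edges \<Gamma>"
  have L0: "0 < len \<Gamma> e" by (rule len_pos[OF e])
  \<comment> \<open>A way that does not exist is given the length of the way through the start.\<close>
  define A where "A = rdist x (chart \<Gamma> e 0)"
  define L where "L = real_of_ereal (len \<Gamma> e)"
  define B where "B t = (if len \<Gamma> e = \<infinity> then A + t else rdist x (chart \<Gamma> e (ereal L)) + L - t)" for t
  define R where "R = {s. ereal s \<in> {0<..<len \<Gamma> e} \<and> pt e s = x}"
  define s0 where "s0 = (SOME s. s \<in> R)"
  define C where "C t = (if R = {} then A + t else max (s0 - t) (t - s0))" for t
  have L: "len \<Gamma> e = ereal L" if "len \<Gamma> e \<noteq> \<infinity>"
    using L0 that unfolding L_def by (cases "len \<Gamma> e") auto
  have A_def': "A = rdist x (pt e 0)" by (simp add: A_def zero_ereal_def)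
  have R: "s = s0" if "s \<in> R" for s
  proof -
    have "s0 \<in> R" unfolding s0_def using that by (rule someI)
    thus ?thesis using that interior_unique[OF e, of "ereal s" e "ereal s0"] e by (auto simp: R_def)
  qed
  have eq: "rdist x (pt e t) = min (A + t) (min (B t) (C t))"
    if t: "0 \<le> t" "ereal t \<le> len \<Gamma> e" for t
  proof (rule antisym)
    have "rdist x (pt e t) \<le> A + t"
      using rdist_segment[OF x e _ _ t, of 0] L0 t by (simp add: A_def' zero_ereal_def less_imp_le)
    moreover have "rdist x (pt e t) \<le> B t"
    proof (cases "len \<Gamma> e = \<infinity>")
      case False
      from L[OF False] L0 t rdist_segment[OF x e _ _ t, of L] show ?thesis
        by (simp add: B_def less_imp_le)
    qed (use calculation in \<open>simp add: B_def\<close>)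
    moreover have "rdist x (pt e t) \<le> C t"
    proof (cases "R = {}")
      case False
      hence "s0 \<in> R" using R by blast
      hence "rdist x (pt e t) \<le> \<bar>s0 - t\<bar>"
        using rdist_segment[OF x e _ _ t, of s0] rdist_self[OF x] by (auto simp: R_def less_imp_le)
      thus ?thesis using False by (auto simp: C_def)
    qed (use calculation in \<open>simp add: C_def\<close>)
    ultimately show "rdist x (pt e t) \<le> min (A + t) (min (B t) (C t))" by simp
  next
    show "min (A + t) (min (B t) (C t)) \<le> rdist x (pt e t)"
    proof (rule rdist_ge_enters[OF x e t])
      fix d assume "enters_edge x e t d"
      then consider (here) s where "0 \<le> s" "ereal s \<le> len \<Gamma> e" "x = pt e s" "\<bar>s - t\<bar> \<le> d"
        | (start) d' where "path_length \<Gamma> x (chart \<Gamma> e 0) d'" "d' + t \<le> d"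
        | (stop) L' d' where "len \<Gamma> e = ereal L'" "path_length \<Gamma> x (chart \<Gamma> e (ereal L')) d'" "d' + (L' - t) \<le> d"
        unfolding enters_edge_def by blast
      thus "min (A + t) (min (B t) (C t)) \<le> d"
      proof cases
        case here
        consider "s = 0" | "ereal s = len \<Gamma> e" | "s \<in> R"
          using here by (auto simp: R_def zero_ereal_def less_le)
        thus ?thesis
        proof cases
          case 1
          hence "A = 0" using here rdist_self[OF x] by (simp add: A_def')
          thus ?thesis using 1 here t by auto
        next
          case 2
          hence "s = L" "len \<Gamma> e \<noteq> \<infinity>" unfolding L_def by (metis real_of_ereal.simps(1), auto)
          hence "B t = s - t" using here rdist_self[OF x] by (simp add: B_def)
          thus ?thesis using here by auto
        next
          case 3
          hence "C t = \<bar>s - t\<bar>" using R[OF 3] by (auto simp: C_def)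
          thus ?thesis using here by auto
        qed
      next
        case start
        hence "A \<le> d'" using rdist_le by (simp add: A_def)
        thus ?thesis using start by auto
      next
        case stop
        hence "B t \<le> d" using rdist_le[OF stop(2)] L by (simp add: B_def L_def)
        thus ?thesis by auto
      qed
    qed
  qed
  have up: "locally_affine {-1, 1} 0 (len \<Gamma> e) (\<lambda>t. c + t)" for c
    using locally_affine_affine[of 1 "{-1, 1}" 0 "len \<Gamma> e" c] by (simp add: add.commute)
  have down: "locally_affine {-1, 1} 0 (len \<Gamma> e) (\<lambda>t. c - t)" for c
    using locally_affine_affine[of "-1" "{-1, 1}" 0 "len \<Gamma> e" c] by simp
  have "locally_affine {-1, 1} 0 (len \<Gamma> e) B"
    unfolding B_def using up[of A] down by (cases "len \<Gamma> e = \<infinity>") simp_all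
  moreover have "locally_affine {-1, 1} 0 (len \<Gamma> e) C"
    unfolding C_def using up[of A] locally_affine_max[OF down[of s0] up[of "- s0"]]
    by (cases "R = {}") simp_all
  ultimately have "locally_affine {-1, 1} 0 (len \<Gamma> e) (\<lambda>t. min (A + t) (min (B t) (C t)))"
    by (intro locally_affine_min up) auto
  thus "locally_affine {-1, 1} 0 (len \<Gamma> e) (\<lambda>t. rdist x (pt e t))"
    by (subst locally_affine_cong[OF eq]) auto
qed

text \<open>An edge of infinite length can be entered through its start only, which is a detour.\<close>

lemma rdist_on_infinite_edge:
  assumes e: "e \<in> edges \<Gamma>" "len \<Gamma> e = \<infinity>" and "0 < T" "T \<le> t"
  shows "rdist (chart \<Gamma> e (ereal T)) (pt e t) = t - T"
proof (rule antisym)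
  let ?z = "chart \<Gamma> e (ereal T)"
  have z: "?z \<in> finite_points \<Gamma>" using finite_pointI[of e T] assms by auto
  show "rdist ?z (pt e t) \<le> t - T"
    using rdist_segment[OF z e(1), of T t] rdist_self[OF z] assms by simp
  show "t - T \<le> rdist ?z (pt e t)"
  proof (rule rdist_ge_enters[OF z e(1)])
    fix d assume "enters_edge ?z e t d"
    moreover have "s = T" if "?z = pt e s" "0 \<le> s" for s
      using interior_unique[OF e(1), of "ereal T" e "ereal s"] e that assms by auto
    ultimately show "t - T \<le> d"
      unfolding enters_edge_def using assms path_length_nonneg by fastforce
  qed (use assms in auto)
qed

text \<open>Eventually the slope is \<open>1\<close> or \<open>-1\<close>; it is not \<open>-1\<close>, as distances are
  nonnegative.\<close>

lemma extend_rdist_infinity: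
  assumes x: "x \<in> finite_points \<Gamma>" and y: "y \<in> points \<Gamma>" "y \<notin> finite_points \<Gamma>"
  shows "extend \<Gamma> (rdist x) y = \<infinity>"
  using y(1)
proof (cases rule: point_cases)
  case (inf e)
  note PL = rdist_PL[OF x]
  obtain m c T where m: "m \<in> {-1, 1}" "0 \<le> T"
    "\<And>t. T \<le> t \<Longrightarrow> rdist x (pt e t) = of_int m * t + c"
    by (rule PL_eventually_affine[OF PL inf(1,2)], rule that)
  have "m \<noteq> -1"
  proof
    assume "m = -1"
    moreover have "0 \<le> rdist x (chart \<Gamma> e (ereal (max T (c + 1))))"
      by (rule rdist_nonneg[OF x finite_pointI]) (use inf m in auto)
    ultimately show False using m(3)[of "max T (c + 1)"] by simp
  qed
  hence "m = 1" using m by auto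
  thus ?thesis using extend_at_infinity[OF PL_UNIV[OF PL] inf(1,2) m(3)] inf by simp
qed (use y in auto)

lemma PL_Lipschitz:
  assumes h: "PL M \<Gamma> h" and M: "M \<subseteq> {-K..K}" and path: "path_length \<Gamma> x y d"
  shows "\<bar>h y - h x\<bar> \<le> of_int K * d"
  using path
proof (induction rule: path_length.induct)
  case (segment x e s d t)
  have la: "locally_affine M 0 (len \<Gamma> e) (\<lambda>t. h (pt e t))"
    using h segment.hyps(2) unfolding PL_def by blast
  have "\<bar>h (pt e t) - h (pt e s)\<bar> \<le> of_int K * \<bar>s - t\<bar>"
  proof (cases "s \<le> t")
    case True
    thus ?thesis using locally_affine_Lipschitz[OF la M, of s t] segment.hyps by auto
  next
    case False
    thus ?thesis using locally_affine_Lipschitz[OF la M, of t s] segment.hyps by (auto simp: abs_minus_commute)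
  qed
  thus ?case using segment.IH by (simp add: algebra_simps)
qed simp

text \<open>If \<open>\<delta>\<close> does not exceed the distance, along any edge at \<open>x\<close>, to an end other than
  \<open>x\<close>, then a path shorter than \<open>\<delta>\<close> stays on the edges at \<open>x\<close>, and whenever it changes the edge it does so at \<open>x\<close>.\<close>

lemma short_path:
  assumes \<delta>: "\<And>e s. (e, s) \<in> preimages x \<Longrightarrow>
      (s \<noteq> 0 \<longrightarrow> \<delta> \<le> s) \<and> (\<forall>L. len \<Gamma> e = ereal L \<longrightarrow> s \<noteq> L \<longrightarrow> \<delta> \<le> L - s)"
    and "path_length \<Gamma> x y d"
  shows "\<delta> \<le> d \<or> y = x \<or> (\<exists>e s t. (e, s) \<in> preimages x \<and> (e, t) \<in> preimages y \<and> \<bar>s - t\<bar> \<le> d)"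
  using assms(2,1)
proof (induction rule: path_length.induct)
  case (segment x e' s' d t')
  have e'p: "(e', s') \<in> preimages (pt e' s')" "(e', t') \<in> preimages (pt e' t')"
    using segment.hyps by (auto simp: preimages_def zero_ereal_def)
  have d0: "0 \<le> d" using path_length_nonneg segment.hyps(1) .
  have at_start: ?case if "pt e' s' = x"
    using that e'p d0 by fastforce
  have "\<delta> \<le> d \<or> pt e' s' = x \<or>
    (\<exists>e s t. (e, s) \<in> preimages x \<and> (e, t) \<in> preimages (pt e' s') \<and> \<bar>s - t\<bar> \<le> d)"
    using segment.IH segment.prems by blast
  then consider "\<delta> \<le> d" | "pt e' s' = x"
    | e s t where "(e, s) \<in> preimages x" "(e, t) \<in> preimages (pt e' s')" "\<bar>s - t\<bar> \<le> d" "d < \<delta>"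
    using not_le by blast
  thus ?case
  proof cases
    case 1 thus ?thesis by linarith
  next
    case 2 thus ?thesis by (rule at_start)
  next
    case 3
    have t: "e \<in> edges \<Gamma>" "0 \<le> t" "ereal t \<le> len \<Gamma> e" "pt e' s' = pt e t"
      using 3 by (auto simp: preimages_def)
    consider "t = 0" | "ereal t = len \<Gamma> e" | "ereal t \<in> {0<..<len \<Gamma> e}"
      using t by (auto simp: zero_ereal_def less_le)
    thus ?thesis
    proof cases
      case 1
      hence "s = t" using segment.prems[OF 3(1)] 3 by force
      thus ?thesis using at_start 3 t by (simp add: preimages_def)
    next
      case 2
      hence "s = t" using segment.prems[OF 3(1)] 3 by force
      thus ?thesis using at_start 3 t by (simp add: preimages_def)
    next
      case inner: 3
      hence "e' = e" "s' = t"
        using interior_unique[OF t(1) inner, of e' "ereal s'"] t segment.hyps by auto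
      thus ?thesis using 3 e'p
        by (intro disjI2 exI[of _ e] exI[of _ s] exI[of _ t']) auto
    qed
  qed
qed auto

text \<open>By the previous lemma, the distance from \<open>x\<close> to a near point is the least difference of
  parameters on a common edge. This is a minimum over a finite set, so it is attained.\<close>

lemma rdist_local:
  assumes x: "x \<in> finite_points \<Gamma>"
  obtains \<delta> where "\<delta> > 0" "\<And>y. y \<in> finite_points \<Gamma> \<Longrightarrow> rdist x y < \<delta> \<Longrightarrow> y \<noteq> x \<Longrightarrow>
     \<exists>e s t. (e, s) \<in> preimages x \<and> (e, t) \<in> preimages y \<and> rdist x y = \<bar>s - t\<bar>"
proof -
  define Q where "Q p \<delta> \<longleftrightarrow> (snd p \<noteq> 0 \<longrightarrow> \<delta> \<le> snd p) \<and>
      (\<forall>L. len \<Gamma> (fst p) = ereal L \<longrightarrow> snd p \<noteq> L \<longrightarrow> \<delta> \<le> L - snd p)" for p \<delta>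
  have Q: "\<exists>\<epsilon>>0. \<forall>\<delta>. 0 < \<delta> \<and> \<delta> \<le> \<epsilon> \<longrightarrow> Q p \<delta>" if "p \<in> preimages x" for p
  proof -
    obtain e s where p: "p = (e, s)" "0 \<le> s" "ereal s \<le> len \<Gamma> e"
      using \<open>p \<in> preimages x\<close> by (auto simp: preimages_def)
    define a where "a = (if s = 0 then 1 else s)"
    define b where "b = (if len \<Gamma> e = \<infinity> \<or> ereal s = len \<Gamma> e then 1 else real_of_ereal (len \<Gamma> e) - s)"
    have "0 < a" using p by (auto simp: a_def)
    moreover have "0 < b" using p by (cases "len \<Gamma> e") (auto simp: b_def)
    ultimately show ?thesis using p
      by (intro exI[of _ "min a b"]) (auto simp: Q_def a_def b_def)
  qed
  obtain \<delta> where \<delta>: "\<delta> > 0" "\<And>p. p \<in> preimages x \<Longrightarrow> Q p \<delta>"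
    by (rule uniform_small[of "preimages x" Q, OF finite_preimages], erule Q, rule that)
  show ?thesis
  proof (rule that[OF \<delta>(1)])
    fix y assume y: "y \<in> finite_points \<Gamma>" "rdist x y < \<delta>" "y \<noteq> x"
    define D where "D = {\<bar>s - t\<bar> |e s t. (e, s) \<in> preimages x \<and> (e, t) \<in> preimages y}"
    have short: "\<delta> \<le> d \<or> (\<exists>r\<in>D. r \<le> d)" if "path_length \<Gamma> x y d" for d
    proof -
      have "(s \<noteq> 0 \<longrightarrow> \<delta> \<le> s) \<and> (\<forall>L. len \<Gamma> e = ereal L \<longrightarrow> s \<noteq> L \<longrightarrow> \<delta> \<le> L - s)"
        if "(e, s) \<in> preimages x" for e s
        using \<delta>(2)[OF that] by (simp add: Q_def)
      from short_path[OF this that] y(3)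
      consider "\<delta> \<le> d" | e s t where "(e, s) \<in> preimages x" "(e, t) \<in> preimages y" "\<bar>s - t\<bar> \<le> d"
        by blast
      thus ?thesis unfolding D_def by cases blast+
    qed
    have "D \<subseteq> (\<lambda>(p, q). \<bar>snd p - snd q\<bar>) ` (preimages x \<times> preimages y)"
      unfolding D_def by force
    hence fin: "finite D" using finite_preimages by (meson finite_SigmaI finite_imageI finite_subset)
    obtain d where "path_length \<Gamma> x y d" "d < \<delta>" using rdist_less_path[OF x y(1,2)] .
    hence ne: "D \<noteq> {}" using short by force
    have "min \<delta> (Min D) \<le> rdist x y"
    proof (rule rdist_greatest[OF x y(1)])
      fix d assume "path_length \<Gamma> x y d"
      from short[OF this] show "min \<delta> (Min D) \<le> d"
        using fin by (auto simp: min_le_iff_disj intro: order_trans[OF Min_le])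
    qed
    hence "Min D \<le> rdist x y" using y(2) by auto
    moreover have "rdist x y \<le> r" if rD: "r \<in> D" for r
    proof -
      obtain e s t where est: "r = \<bar>s - t\<bar>" "(e, s) \<in> preimages x" "(e, t) \<in> preimages y"
        using rD unfolding D_def by blast
      thus ?thesis using rdist_segment[OF x, of e s t] rdist_self[OF x] by (auto simp: preimages_def)
    qed
    moreover have "Min D \<in> D" using fin ne by simp
    ultimately have "rdist x y \<in> D" by (metis antisym)
    thus "\<exists>e s t. (e, s) \<in> preimages x \<and> (e, t) \<in> preimages y \<and> rdist x y = \<bar>s - t\<bar>"
      unfolding D_def by blast
  qed
qed

text \<open>What holds along all directions at \<open>x\<close> holds on a ball around \<open>x\<close>, as there are
  finitely many directions.\<close>

lemma ball_local:
  assumes x: "x \<in> finite_points \<Gamma>"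
    and refl: "\<And>e s. (e, s) \<in> preimages x \<Longrightarrow> P e s s"
    and right: "\<And>e s. (e, s) \<in> preimages x \<Longrightarrow> ereal s < len \<Gamma> e \<Longrightarrow>
      \<exists>w>ereal s. \<forall>t. s \<le> t \<longrightarrow> ereal t \<le> w \<longrightarrow> P e s t"
    and left: "\<And>e s. (e, s) \<in> preimages x \<Longrightarrow> 0 < ereal s \<Longrightarrow>
      \<exists>w<ereal s. \<forall>t. w \<le> ereal t \<longrightarrow> t \<le> s \<longrightarrow> P e s t"
  obtains \<epsilon> where "\<epsilon> > 0" "\<And>y. y \<in> finite_points \<Gamma> \<Longrightarrow> rdist x y < \<epsilon> \<Longrightarrow> y \<noteq> x \<Longrightarrow>
     \<exists>e s t. (e, s) \<in> preimages x \<and> (e, t) \<in> preimages y \<and> rdist x y = \<bar>s - t\<bar> \<and> P e s t"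
proof -
  define Q where "Q p \<eta> \<longleftrightarrow> (\<forall>t. 0 \<le> t \<longrightarrow> ereal t \<le> len \<Gamma> (fst p) \<longrightarrow> \<bar>snd p - t\<bar> < \<eta> \<longrightarrow> P (fst p) (snd p) t)"
    for p \<eta>
  have Q: "\<exists>\<epsilon>>0. \<forall>\<delta>. 0 < \<delta> \<and> \<delta> \<le> \<epsilon> \<longrightarrow> Q p \<delta>" if "p \<in> preimages x" for p
  proof -
    obtain e s where p: "p = (e, s)" by (cases p)
    hence es: "(e, s) \<in> preimages x" "0 \<le> s" "ereal s \<le> len \<Gamma> e" using \<open>p \<in> preimages x\<close> by (auto simp: preimages_def)
    have "\<exists>v>s. \<forall>t. s \<le> t \<longrightarrow> t < v \<longrightarrow> ereal t \<le> len \<Gamma> e \<longrightarrow> P e s t"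
    proof (cases "ereal s = len \<Gamma> e")
      case True
      hence "t = s" if "s \<le> t" "ereal t \<le> len \<Gamma> e" for t using that by (metis antisym ereal_less_eq(3))
      thus ?thesis using refl[OF es(1)] by (metis less_add_one)
    next
      case False
      hence "ereal s < len \<Gamma> e" using es(3) by simp
      then obtain w where w: "ereal s < w" "\<forall>t. s \<le> t \<longrightarrow> ereal t \<le> w \<longrightarrow> P e s t"
        using right[OF es(1)] by blast
      obtain v where v: "ereal s < ereal v" "ereal v < w" using ereal_dense2[OF w(1)] by blast
      have "ereal t \<le> w" if "t < v" for t
        using order_less_trans[of "ereal t" "ereal v" w] that v(2) by simp
      thus ?thesis using w(2) v(1) by (intro exI[of _ v]) auto
    qed
    then obtain v1 where v1: "v1 > s" "\<And>t. s \<le> t \<Longrightarrow> t < v1 \<Longrightarrow> ereal t \<le> len \<Gamma> e \<Longrightarrow> P e s t" by blast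
    have "\<exists>v<s. \<forall>t. 0 \<le> t \<longrightarrow> v < t \<longrightarrow> t \<le> s \<longrightarrow> P e s t"
    proof (cases "s = 0")
      case True
      thus ?thesis using refl[OF es(1)] by (intro exI[of _ "-1"]) auto
    next
      case False
      hence "0 < ereal s" using es(2) by simp
      then obtain w where w: "w < ereal s" "\<forall>t. w \<le> ereal t \<longrightarrow> t \<le> s \<longrightarrow> P e s t"
        using left[OF es(1)] by blast
      obtain v where v: "w < ereal v" "ereal v < ereal s" using ereal_dense2[OF w(1)] by blast
      have "w \<le> ereal t" if "v < t" for t
        using order_less_trans[of w "ereal v" "ereal t"] that v(1) by simp
      thus ?thesis using w(2) v(2) by (intro exI[of _ v]) auto
    qed
    then obtain v2 where v2: "v2 < s" "\<And>t. 0 \<le> t \<Longrightarrow> v2 < t \<Longrightarrow> t \<le> s \<Longrightarrow> P e s t" by blast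
    show ?thesis
    proof (intro exI[of _ "min (v1 - s) (s - v2)"] conjI allI impI)
      fix \<delta> assume \<delta>: "0 < \<delta> \<and> \<delta> \<le> min (v1 - s) (s - v2)"
      show "Q p \<delta>" unfolding Q_def p fst_conv snd_conv
      proof (intro allI impI)
        fix t assume "0 \<le> t" "ereal t \<le> len \<Gamma> e" "\<bar>s - t\<bar> < \<delta>"
        thus "P e s t" using v1(2)[of t] v2(2)[of t] \<delta> by (cases "s \<le> t") auto
      qed
    qed (use v1(1) v2(1) in auto)
  qed
  obtain \<epsilon> where \<epsilon>: "\<epsilon> > 0" "\<And>p. p \<in> preimages x \<Longrightarrow> Q p \<epsilon>"
    by (rule uniform_small[of "preimages x" Q, OF finite_preimages], erule Q, rule that)
  obtain \<delta> where \<delta>: "\<delta> > 0" "\<And>y. y \<in> finite_points \<Gamma> \<Longrightarrow> rdist x y < \<delta> \<Longrightarrow> y \<noteq> x \<Longrightarrow>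
     \<exists>e s t. (e, s) \<in> preimages x \<and> (e, t) \<in> preimages y \<and> rdist x y = \<bar>s - t\<bar>"
    using rdist_local[OF x] by blast
  show ?thesis
  proof (rule that[of "min \<epsilon> \<delta>"])
    fix y assume y: "y \<in> finite_points \<Gamma>" "rdist x y < min \<epsilon> \<delta>" "y \<noteq> x"
    obtain e s t where est: "(e, s) \<in> preimages x" "(e, t) \<in> preimages y" "rdist x y = \<bar>s - t\<bar>"
      using \<delta>(2)[OF y(1) _ y(3)] y(2) by auto
    have "P e s t" using \<epsilon>(2)[OF est(1)] est y(2) unfolding Q_def by (auto simp: preimages_def)
    thus "\<exists>e s t. (e, s) \<in> preimages x \<and> (e, t) \<in> preimages y \<and> rdist x y = \<bar>s - t\<bar> \<and> P e s t"
      using est by blast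
  qed (use \<epsilon> \<delta> in auto)
qed

end

section \<open>Topology, distance and rational functions\<close>

text \<open>A quotient with integer values is continuous on a connected set, hence constant.\<close>

lemma integer_multiple_constant:
  fixes g p :: "real \<Rightarrow> real"
  assumes "connected S" "continuous_on S g" "continuous_on S p" "\<And>t. t \<in> S \<Longrightarrow> p t \<noteq> 0"
    and mult: "\<And>t. t \<in> S \<Longrightarrow> \<exists>m::int. g t = b + of_int m * p t"
  obtains m :: int where "\<And>t. t \<in> S \<Longrightarrow> g t = b + of_int m * p t"
proof -
  let ?q = "\<lambda>t. (g t - b) / p t"
  have int: "\<exists>m::int. ?q t = of_int m" if "t \<in> S" for t
    using mult[OF that] assms(4)[OF that] by (auto simp: field_simps)
  have "?q constant_on S"
  proof (rule continuous_discrete_range_constant[OF assms(1)])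
    show "continuous_on S ?q" by (intro continuous_intros assms(2,3)) (use assms(4) in auto)
    fix x assume x: "x \<in> S"
    have "1 \<le> norm (?q y - ?q x)" if y: "y \<in> S" "?q y \<noteq> ?q x" for y
    proof -
      obtain m n :: int where mn: "?q y = of_int m" "?q x = of_int n" using int[OF x] int[OF y(1)] by blast
      hence "m \<noteq> n" using y by auto
      hence "1 \<le> \<bar>m - n\<bar>" by linarith
      hence "1 \<le> \<bar>real_of_int m - of_int n\<bar>" by (metis of_int_1_le_iff of_int_abs of_int_diff)
      thus ?thesis using mn by simp
    qed
    thus "\<exists>e>0. \<forall>y. y \<in> S \<and> ?q y \<noteq> ?q x \<longrightarrow> e \<le> norm (?q y - ?q x)" by (intro exI[of _ 1]) auto
  qed
  then obtain a where a: "\<And>t. t \<in> S \<Longrightarrow> ?q t = a" unfolding constant_on_def by blast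
  show ?thesis
  proof (cases "S = {}")
    case True thus ?thesis using that by blast
  next
    case False
    then obtain m :: int where "a = of_int m" using int a by fastforce
    thus ?thesis using that[of m] a assms(4) by (metis add.commute diff_add_cancel nonzero_eq_divide_eq)
  qed
qed

text \<open>The zeros of \<open>D\<close> are kept at the ends of the interval: there, the quotient of the previous
  lemma is not defined, and continuity of \<open>g\<close> has to be used instead.\<close>

lemma integer_multiple_affine:
  fixes x y :: ereal
  assumes xy: "x < y" and cont: "continuous_on {t. x \<le> ereal t \<and> ereal t \<le> y} g"
    and D: "\<And>t. x \<le> ereal t \<Longrightarrow> ereal t \<le> y \<Longrightarrow> D t = of_int \<sigma> * t + c"
    and nz: "\<And>t. x < ereal t \<Longrightarrow> ereal t < y \<Longrightarrow> D t \<noteq> 0"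
    and mult: "\<And>t. x < ereal t \<Longrightarrow> ereal t < y \<Longrightarrow> \<exists>m::int. g t = b + of_int m * D t"
  shows "affine_on UNIV x y g"
proof -
  define S where "S = {t. x < ereal t \<and> ereal t < y}"
  have "is_interval S" unfolding is_interval_1 S_def
    by (auto intro: less_le_trans le_less_trans simp del: less_ereal.simps ereal_less_eq simp flip: ereal_less_eq(3))
  moreover have D': "D t = of_int \<sigma> * t + c" if "t \<in> S" for t using D[of t] that by (simp add: S_def less_imp_le)
  moreover have "continuous_on S g" by (rule continuous_on_subset[OF cont]) (auto simp: S_def less_imp_le)
  ultimately obtain n :: int where n: "\<And>t. t \<in> S \<Longrightarrow> g t = b + of_int n * (of_int \<sigma> * t + c)"
    using integer_multiple_constant[of S g "\<lambda>t. of_int \<sigma> * t + c" b] nz mult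
    by (force simp: S_def is_interval_connected intro!: continuous_intros)
  have "g t = of_int (n * \<sigma>) * t + (b + of_int n * c)" if t: "x \<le> ereal t" "ereal t \<le> y" for t
  proof -
    have ends: "g t - b - of_int n * (of_int \<sigma> * t + c) = 0"
      if pq: "p < q" "x \<le> ereal p" "ereal q \<le> y" "{p<..<q} \<subseteq> S" "t \<in> {p..q}" for p q
    proof (rule continuous_constant_on_closure[of "{p<..<q}" "\<lambda>t. g t - b - of_int n * (of_int \<sigma> * t + c)" 0 t])
      have "{p..q} \<subseteq> {t. x \<le> ereal t \<and> ereal t \<le> y}"
      proof
        fix u assume "u \<in> {p..q}"
        hence "ereal p \<le> ereal u" "ereal u \<le> ereal q" by auto
        from order_trans[OF pq(2) this(1)] order_trans[OF this(2) pq(3)]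
        show "u \<in> {t. x \<le> ereal t \<and> ereal t \<le> y}" by simp
      qed
      hence "continuous_on {p..q} g" by (rule continuous_on_subset[OF cont])
      thus "continuous_on (closure {p<..<q}) (\<lambda>t. g t - b - of_int n * (of_int \<sigma> * t + c))"
        using pq(1) by (auto intro!: continuous_intros simp: closure_greaterThanLessThan)
    qed (use pq n in \<open>auto simp: closure_greaterThanLessThan\<close>)
    consider "t \<in> S" | "ereal t = x" | "ereal t = y" using t by (auto simp: S_def less_le)
    hence "g t = b + of_int n * (of_int \<sigma> * t + c)"
    proof cases
      case 1 thus ?thesis by (rule n)
    next
      case 2
      obtain q where q: "ereal t < ereal q" "ereal q < y" using ereal_dense2 xy 2 by metis
      have "{t<..<q} \<subseteq> S"
      proof
        fix u assume "u \<in> {t<..<q}"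
        hence "x < ereal u" "ereal u < ereal q" by (auto simp flip: 2)
        thus "u \<in> S" using less_trans[OF _ q(2)] by (simp add: S_def)
      qed
      moreover have "t < q" using q(1) by simp
      ultimately show ?thesis using ends[of t q] q(2) 2 by (simp add: less_imp_le)
    next
      case 3
      obtain p where p: "x < ereal p" "ereal p < ereal t" using ereal_dense2 xy 3 by metis
      have "{p<..<t} \<subseteq> S"
      proof
        fix u assume "u \<in> {p<..<t}"
        hence "ereal p < ereal u" "ereal u < y" by (auto simp flip: 3)
        thus "u \<in> S" using less_trans[OF p(1)] by (simp add: S_def)
      qed
      moreover have "p < t" using p(2) by simp
      ultimately show ?thesis using ends[of p t] p(1) 3 by (simp add: less_imp_le)
    qed
    thus ?thesis by (simp add: algebra_simps)
  qed
  thus ?thesis unfolding affine_on_def by blast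
qed

context trop
begin

lemma openin_near:
  assumes U: "openin (topo \<Gamma>) U" and e: "e \<in> edges \<Gamma>" and t: "t \<in> {0..len \<Gamma> e}" "chart \<Gamma> e t \<in> U"
  shows "t < len \<Gamma> e \<Longrightarrow> \<exists>s>t. s \<le> len \<Gamma> e \<and> chart \<Gamma> e ` {t..s} \<subseteq> U"
    and "0 < t \<Longrightarrow> \<exists>s<t. 0 \<le> s \<and> chart \<Gamma> e ` {s..t} \<subseteq> U"
proof -
  have "openin (top_of_set {0..len \<Gamma> e}) {t \<in> {0..len \<Gamma> e}. chart \<Gamma> e t \<in> U}"
    using U e unfolding openin_curve by blast
  then obtain V where V: "open V" "{t \<in> {0..len \<Gamma> e}. chart \<Gamma> e t \<in> U} = {0..len \<Gamma> e} \<inter> V"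
    unfolding openin_open by (elim exE conjE) (rule that)
  have tV: "t \<in> V" using V(2) t by blast
  have in_U: "chart \<Gamma> e u \<in> U" if "u \<in> {0..len \<Gamma> e}" "u \<in> V" for u using V(2) that by blast
  show "\<exists>s>t. s \<le> len \<Gamma> e \<and> chart \<Gamma> e ` {t..s} \<subseteq> U" if t_less: "t < len \<Gamma> e"
  proof -
    obtain b where b: "t < b" "{t..<b} \<subseteq> V" using open_right[OF V(1) tV \<open>t < len \<Gamma> e\<close>] by blast
    obtain s where s: "t < s" "s < min b (len \<Gamma> e)" using dense[of t "min b (len \<Gamma> e)"] b t_less by auto
    show ?thesis
      by (rule exI[of _ s]) (use s b(2) t in \<open>auto intro!: in_U simp: subset_iff intro: order_trans less_imp_le\<close>)
  qed
  show "\<exists>s<t. 0 \<le> s \<and> chart \<Gamma> e ` {s..t} \<subseteq> U" if t_pos: "0 < t"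
  proof -
    obtain b where b: "b < t" "{b<..t} \<subseteq> V" using open_left[OF V(1) tV \<open>0 < t\<close>] by blast
    obtain s where s: "max b 0 < s" "s < t" using dense[of "max b 0" t] b t_pos by auto
    show ?thesis
      by (rule exI[of _ s]) (use s b(2) t in \<open>auto intro!: in_U simp: subset_iff intro: order_trans less_imp_le\<close>)
  qed
qed

text \<open>At a finite point, minus the distance from it exceeds \<open>-\<epsilon>\<close> exactly on a ball. At a point at
  infinity, the function that is \<open>t - T\<close> on the ray of parameters \<open>t > T\<close> and zero
  elsewhere is positive exactly on this ray.\<close>

lemma separating_function:
  assumes U: "openin (topo \<Gamma>) U" and x: "x \<in> U"
  obtains h c where "PL UNIV \<Gamma> h" "ereal c < extend \<Gamma> h x"
    "\<And>y. y \<in> points \<Gamma> \<Longrightarrow> ereal c < extend \<Gamma> h y \<Longrightarrow> y \<in> U"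
proof (cases "x \<in> finite_points \<Gamma>")
  case True
  have es: "e \<in> edges \<Gamma>" "ereal s \<in> {0..len \<Gamma> e}" "chart \<Gamma> e (ereal s) \<in> U" if "(e, s) \<in> preimages x" for e s
    using that x by (auto simp: preimages_def)
  obtain \<epsilon> where \<epsilon>: "\<epsilon> > 0" and near: "\<And>y. y \<in> finite_points \<Gamma> \<Longrightarrow> rdist x y < \<epsilon> \<Longrightarrow> y \<noteq> x \<Longrightarrow>
     \<exists>e s t. (e, s) \<in> preimages x \<and> (e, t) \<in> preimages y \<and> rdist x y = \<bar>s - t\<bar> \<and> pt e t \<in> U"
  proof (rule ball_local[OF True, where P = "\<lambda>e s t. pt e t \<in> U"])
    fix e s assume *: "(e, s) \<in> preimages x"
    show "pt e s \<in> U" by (rule es(3)[OF *])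
    show "\<exists>w>ereal s. \<forall>t. s \<le> t \<longrightarrow> ereal t \<le> w \<longrightarrow> pt e t \<in> U" if "ereal s < len \<Gamma> e"
      using openin_near(1)[OF U es[OF *] that] by (fastforce simp: image_subset_iff)
    show "\<exists>w<ereal s. \<forall>t. w \<le> ereal t \<longrightarrow> t \<le> s \<longrightarrow> pt e t \<in> U" if "0 < ereal s"
      using openin_near(2)[OF U es[OF *] that] by (fastforce simp: image_subset_iff)
  qed (rule that)
  let ?h = "\<lambda>y. - 1 * rdist x y + 0"
  note d = PL_UNIV[OF rdist_PL[OF True]]
  have h: "PL UNIV \<Gamma> ?h" using PL_uminus[OF d] by simp
  note ext = extend_affine_at[OF d h]
  have xp: "x \<in> points \<Gamma>" using True finite_subset_points by blast
  show ?thesis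
  proof (rule that[OF h])
    show "ereal (- \<epsilon>) < extend \<Gamma> ?h x"
      using extend_finite[OF h True] rdist_self[OF True] \<epsilon> by simp
    fix y assume y: "y \<in> points \<Gamma>" "ereal (- \<epsilon>) < extend \<Gamma> ?h y"
    show "y \<in> U"
    proof (cases "y \<in> finite_points \<Gamma>")
      case fin: True
      hence "rdist x y < \<epsilon>" using y extend_finite[OF h fin] by simp
      thus ?thesis using near[OF fin] x by (cases "y = x") (auto simp: preimages_def)
    next
      case False
      hence "extend \<Gamma> ?h y = - \<infinity>" using ext[OF y(1)] extend_rdist_infinity[OF True y(1)] by simp
      thus ?thesis using y by simp
    qed
  qed
next
  case False
  have "x \<in> points \<Gamma>" using openin_subset[OF U] x by blast
  then obtain e where e: "e \<in> edges \<Gamma>" "len \<Gamma> e = \<infinity>" "x = chart \<Gamma> e \<infinity>"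
    by (cases rule: point_cases) (use False in auto)
  have "\<exists>s<\<infinity>. 0 \<le> s \<and> chart \<Gamma> e ` {s..\<infinity>} \<subseteq> U"
    using openin_near(2)[OF U e(1), of \<infinity>] x e by simp
  then obtain s where s: "s < \<infinity>" "0 \<le> s" "chart \<Gamma> e ` {s..\<infinity>} \<subseteq> U" by blast
  define T where "T = real_of_ereal s"
  have T: "0 \<le> T" "\<And>t. ereal T < t \<Longrightarrow> chart \<Gamma> e t \<in> U"
    using s by (cases s; force simp: T_def)+
  define Q where "Q y t \<longleftrightarrow> T < t \<and> y = pt e t" for y t
  define h where "h y = (if \<exists>t. Q y t then (THE t. Q y t) - T else 0)" for y
  have uniq: "e' = e \<and> t' = t" if "Q (pt e' t') t" "e' \<in> edges \<Gamma>" "0 \<le> t'" "ereal t' \<le> len \<Gamma> e'"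
    for e' t' t
    using interior_unique[OF e(1), of "ereal t" e' "ereal t'"] that e T(1) by (auto simp: Q_def)
  have h_e: "h (pt e t) = max (t - T) 0" if t: "0 \<le> t" for t
  proof (cases "T < t")
    case True
    hence Q: "Q (pt e t) t" by (simp add: Q_def)
    moreover have "(THE u. Q (pt e t) u) = t"
      by (rule the_equality) (use Q uniq[of e t] t e in auto)
    ultimately show ?thesis using True unfolding h_def by auto
  next
    case False
    hence "\<not> Q (pt e t) u" for u using uniq[of e t u] t e by (auto simp: Q_def)
    thus ?thesis using False by (simp add: h_def)
  qed
  have h_other: "h (pt e' t) = 0" if "e' \<in> edges \<Gamma>" "e' \<noteq> e" "0 \<le> t" "ereal t \<le> len \<Gamma> e'" for e' t
    using uniq[of e' t] that unfolding h_def by auto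
  have h: "PL UNIV \<Gamma> h"
    unfolding PL_def
  proof
    fix e' assume e': "e' \<in> edges \<Gamma>"
    show "locally_affine UNIV 0 (len \<Gamma> e') (\<lambda>t. h (pt e' t))"
    proof (cases "e' = e")
      case True
      have "locally_affine UNIV 0 (len \<Gamma> e') (\<lambda>t. max (t - T) 0)"
        using locally_affine_max[OF locally_affine_affine[of 1 UNIV _ _ "-T"] locally_affine_affine[of 0 UNIV _ _ 0]]
        by simp
      thus ?thesis
        using True h_e locally_affine_cong[of 0 "len \<Gamma> e'" "\<lambda>t. h (pt e' t)" "\<lambda>t. max (t - T) 0" UNIV]
        by simp
    next
      case False
      have "locally_affine UNIV 0 (len \<Gamma> e') (\<lambda>t. 0)"
        using locally_affine_affine[of 0 UNIV 0 "len \<Gamma> e'" 0] by simp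
      thus ?thesis
        using h_other[OF e' False] locally_affine_cong[of 0 "len \<Gamma> e'" "\<lambda>t. h (pt e' t)" "\<lambda>t. 0" UNIV]
        by simp
    qed
  qed
  show ?thesis
  proof (rule that[OF h])
    have "h (pt e t) = of_int 1 * t + (- T)" if "T \<le> t" for t
      using h_e[of t] T that by simp
    thus "ereal 0 < extend \<Gamma> h x" using extend_at_infinity[OF h e(1,2), of T 1 "- T"] e(3) by simp
    fix y assume y: "y \<in> points \<Gamma>" "ereal 0 < extend \<Gamma> h y"
    from y(1) show "y \<in> U"
    proof (cases rule: point_cases)
      case single
      thus ?thesis using e(1) by simp
    next
      case (fin e' t)
      hence "h y > 0" using extend_finite[OF h] y(2) by simp
      hence "\<exists>u. Q y u" by (cases "\<exists>u. Q y u") (simp_all add: h_def)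
      then obtain u where "Q y u" ..
      thus ?thesis using T by (simp add: Q_def)
    next
      case (inf e')
      show ?thesis
      proof (cases "e' = e")
        case True thus ?thesis using inf e x by simp
      next
        case False
        have "extend \<Gamma> h y = ereal (of_int 0) * \<infinity> + ereal 0"
          unfolding inf(3)
          by (rule extend_at_infinity[OF h inf(1,2), of 0]) (use h_other[OF inf(1) False] inf(2) in simp)
        thus ?thesis using y by simp
      qed
    qed
  qed
qed

lemma points_separated:
  assumes "x \<in> points \<Gamma>" "y \<in> points \<Gamma>" "x \<noteq> y"
  obtains h c where "PL UNIV \<Gamma> h" "extend \<Gamma> h y \<le> ereal c" "ereal c < extend \<Gamma> h x"
proof -
  obtain h c where "PL UNIV \<Gamma> h" "ereal c < extend \<Gamma> h x"
    "\<And>z. z \<in> points \<Gamma> \<Longrightarrow> ereal c < extend \<Gamma> h z \<Longrightarrow> z \<in> points \<Gamma> - {y}"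
    using separating_function[OF openin_remove_point[of y], of x] assms by blast
  thus ?thesis using that assms(2) by (metis DiffD2 not_le singletonI)
qed

lemma Hausdorff_curve: "Hausdorff_space (topo \<Gamma>)"
  unfolding Hausdorff_space_def
proof (intro allI impI)
  fix x y assume xy: "x \<in> points \<Gamma> \<and> y \<in> points \<Gamma> \<and> x \<noteq> y"
  then obtain h c where h: "PL UNIV \<Gamma> h" "extend \<Gamma> h y \<le> ereal c" "ereal c < extend \<Gamma> h x"
    using points_separated by metis
  obtain b where b: "ereal c < b" "b < extend \<Gamma> h x" using h(3) dense by blast
  note cont = openin_superlevel[OF extend_continuous[OF h(1)]]
  show "\<exists>U V. openin (topo \<Gamma>) U \<and> openin (topo \<Gamma>) V \<and> x \<in> U \<and> y \<in> V \<and> disjnt U V"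
    by (intro exI[of _ "{x \<in> points \<Gamma>. b < extend \<Gamma> h x}"] exI[of _ "{x \<in> points \<Gamma>. extend \<Gamma> h x < b}"])
       (use b h xy cont in \<open>auto simp: disjnt_def\<close>)
qed

text \<open>A description of the integer slopes in terms of topology and distance, not mentioning edges. At a
  finite point one may take \<open>z\<close> to be this point; at a point at infinity, \<open>z\<close> is a
  finite point on the same edge.\<close>

definition locally_integral :: "('a \<Rightarrow> real) \<Rightarrow> bool" where
  "locally_integral h \<longleftrightarrow> (\<forall>x\<in>points \<Gamma>. \<exists>U z. openin (topo \<Gamma>) U \<and> x \<in> U \<and> z \<in> finite_points \<Gamma> \<and>
      (\<forall>y\<in>U \<inter> finite_points \<Gamma>. \<exists>m::int. h y = h z + of_int m * rdist z y))"

lemma PL_imp_locally_integral: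
  assumes h: "PL UNIV \<Gamma> h"
  shows "locally_integral h"
  unfolding locally_integral_def
proof
  fix x assume x: "x \<in> points \<Gamma>"
  show "\<exists>U z. openin (topo \<Gamma>) U \<and> x \<in> U \<and> z \<in> finite_points \<Gamma> \<and>
      (\<forall>y\<in>U \<inter> finite_points \<Gamma>. \<exists>m::int. h y = h z + of_int m * rdist z y)"
  proof (cases "x \<in> finite_points \<Gamma>")
    case True
    define P where "P e s t \<longleftrightarrow> (\<exists>m::int. h (pt e t) = h (pt e s) + of_int m * \<bar>s - t\<bar>)"
      for e s t
    have P: "P e s t"
      if aff: "affine_on UNIV u v (\<lambda>t. h (pt e t))" and uv: "u \<le> ereal s" "ereal s \<le> v" "u \<le> ereal t" "ereal t \<le> v" for e s t u v
    proof -
      obtain m c where m: "\<And>t. u \<le> ereal t \<Longrightarrow> ereal t \<le> v \<Longrightarrow> h (pt e t) = of_int m * t + c"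
        by (rule affine_onE[OF aff]) blast
      have "h (pt e t) = h (pt e s) + of_int (if s \<le> t then m else - m) * \<bar>s - t\<bar>"
        using m uv by (simp add: algebra_simps)
      thus ?thesis unfolding P_def by blast
    qed
    obtain \<epsilon> where \<epsilon>: "\<epsilon> > 0" and near: "\<And>y. y \<in> finite_points \<Gamma> \<Longrightarrow> rdist x y < \<epsilon> \<Longrightarrow> y \<noteq> x \<Longrightarrow>
       \<exists>e s t. (e, s) \<in> preimages x \<and> (e, t) \<in> preimages y \<and> rdist x y = \<bar>s - t\<bar> \<and> P e s t"
    proof (rule ball_local[OF True, of P])
      fix e s assume *: "(e, s) \<in> preimages x"
      have es: "0 \<le> ereal s" "ereal s \<le> len \<Gamma> e" and la: "locally_affine UNIV 0 (len \<Gamma> e) (\<lambda>t. h (pt e t))"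
        using * h by (auto simp: preimages_def PL_def)
      show "P e s s" by (simp add: P_def)
      show "\<exists>w>ereal s. \<forall>t. s \<le> t \<longrightarrow> ereal t \<le> w \<longrightarrow> P e s t" if "ereal s < len \<Gamma> e"
        by (rule locally_affine_rightE[OF la es(1) that]) (use P in \<open>force intro: less_imp_le\<close>)
      show "\<exists>w<ereal s. \<forall>t. w \<le> ereal t \<longrightarrow> t \<le> s \<longrightarrow> P e s t" if "0 < ereal s"
        by (rule locally_affine_leftE[OF la that es(2)]) (use P in \<open>force intro: less_imp_le\<close>)
    qed (rule that)
    note d = PL_UNIV[OF rdist_PL[OF True]]
    show ?thesis
    proof (intro exI[of _ "{y \<in> points \<Gamma>. extend \<Gamma> (rdist x) y < ereal \<epsilon>}"] exI[of _ x] conjI ballI True)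
      show "openin (topo \<Gamma>) {y \<in> points \<Gamma>. extend \<Gamma> (rdist x) y < ereal \<epsilon>}"
        by (rule openin_superlevel(2)[OF extend_continuous[OF d]])
      show "x \<in> {y \<in> points \<Gamma>. extend \<Gamma> (rdist x) y < ereal \<epsilon>}"
        using x extend_finite[OF d True] rdist_self[OF True] \<epsilon> by simp
      fix y assume "y \<in> {y \<in> points \<Gamma>. extend \<Gamma> (rdist x) y < ereal \<epsilon>} \<inter> finite_points \<Gamma>"
      hence y: "y \<in> finite_points \<Gamma>" "rdist x y < \<epsilon>" using extend_finite[OF d] by auto
      show "\<exists>m::int. h y = h x + of_int m * rdist x y"
        using near[OF y] by (cases "y = x") (auto simp: preimages_def P_def intro: exI[of _ 0])
    qed
  next
    case False
    obtain e where e: "e \<in> edges \<Gamma>" "len \<Gamma> e = \<infinity>" "x = chart \<Gamma> e \<infinity>"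
      using x by (cases rule: point_cases) (use False in auto)
    obtain m c T where T: "0 \<le> T" "\<And>t. T \<le> t \<Longrightarrow> h (pt e t) = of_int m * t + c"
      by (rule PL_eventually_affine[OF h e(1,2)], rule that)
    define z where "z = pt e (T + 1)"
    have z: "z \<in> finite_points \<Gamma>" unfolding z_def by (rule finite_pointI) (use e T in auto)
    define U where "U = chart \<Gamma> e ` {ereal (T + 1)<..}"
    have mem: "e' = e \<and> ereal (T + 1) < t" if "e' \<in> edges \<Gamma>" "t \<in> {0..len \<Gamma> e'}" "chart \<Gamma> e' t \<in> U" for e' t
    proof -
      obtain u where u: "ereal (T + 1) < u" "chart \<Gamma> e' t = chart \<Gamma> e u" using \<open>chart \<Gamma> e' t \<in> U\<close> by (auto simp: U_def)
      show ?thesis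
      proof (cases "u = \<infinity>")
        case True
        thus ?thesis using infinite_end_unique[OF e(1,2) that(1,2)] u by auto
      next
        case False
        hence "u \<in> {0<..<len \<Gamma> e}"
          using u(1) T(1) e(2) by (cases u) auto
        thus ?thesis using interior_unique[OF e(1) _ that(1,2), of u] u by auto
      qed
    qed
    have U_open: "openin (topo \<Gamma>) U"
      unfolding openin_curve
    proof (intro conjI ballI)
      show "U \<subseteq> points \<Gamma>"
      proof
        fix y assume "y \<in> U"
        then obtain u where u: "ereal (T + 1) < u" "y = chart \<Gamma> e u" by (auto simp: U_def)
        hence "0 \<le> u" using T(1) by (cases u) auto
        thus "y \<in> points \<Gamma>" using chart_in_points[OF e(1), of u] u e by simp
      qed
      fix e' assume e': "e' \<in> edges \<Gamma>"
      have "{t \<in> {0..len \<Gamma> e'}. chart \<Gamma> e' t \<in> U} = (if e' = e then {0..len \<Gamma> e'} \<inter> {ereal (T + 1)<..} else {})"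
        using mem[OF e'] by (auto simp: U_def)
      thus "openin (top_of_set {0..len \<Gamma> e'}) {t \<in> {0..len \<Gamma> e'}. chart \<Gamma> e' t \<in> U}"
        by (simp add: openin_open_Int)
    qed
    show ?thesis
    proof (intro exI[of _ U] exI[of _ z] conjI ballI U_open z)
      show "x \<in> U" using e by (auto simp: U_def)
      fix y assume "y \<in> U \<inter> finite_points \<Gamma>"
      then obtain u where u: "ereal (T + 1) < u" "y = chart \<Gamma> e u" "y \<in> finite_points \<Gamma>" by (auto simp: U_def)
      have "u \<noteq> \<infinity>" using u chart_finite_iff[of e \<infinity>] e by auto
      then obtain t where t: "u = ereal t" "T + 1 < t" using u by (cases u) auto
      have "rdist z y = t - (T + 1)"
        unfolding z_def u t using rdist_on_infinite_edge[OF e(1,2), of "T + 1" t] t T by simp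
      moreover have "h y = h z + of_int m * (t - (T + 1))"
        using T(2)[of t] T(2)[of "T + 1"] t u by (simp add: z_def algebra_simps)
      ultimately have "h y = h z + of_int m * rdist z y" by simp
      thus "\<exists>m::int. h y = h z + of_int m * rdist z y" by blast
    qed
  qed
qed

text \<open>Shrink a one-sided interval at \<open>t\<close> until it lies in the neighbourhood \<open>U\<close>, the distance
  \<open>\<sigma> t + c\<close> from \<open>z\<close> is affine on it, and this distance has no zero in its interior; the
  only possible zero is \<open>\<zeta> = - c \<sigma>\<close>, as \<open>\<sigma> = \<plusminus>1\<close>.\<close>

lemma locally_integral_imp_PL:
  assumes k: "continuous_map (topo \<Gamma>) euclidean k" "\<And>x. x \<in> finite_points \<Gamma> \<Longrightarrow> k x = ereal (h x)"
    and loc: "locally_integral h"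
  shows "PL UNIV \<Gamma> h"
  unfolding PL_def
proof
  fix e assume e: "e \<in> edges \<Gamma>"
  let ?g = "\<lambda>t. h (pt e t)"
  have cont: "continuous_on {t. 0 \<le> t \<and> ereal t \<le> len \<Gamma> e} ?g"
  proof -
    have "continuous_on {0..len \<Gamma> e} (\<lambda>t. k (chart \<Gamma> e t))"
      using k(1) e unfolding continuous_map_curve_iff by blast
    hence "continuous_on {t. 0 \<le> t \<and> ereal t \<le> len \<Gamma> e} (\<lambda>t. k (pt e t))"
      by (rule continuous_on_compose2) (auto intro!: continuous_intros)
    hence "continuous_on {t. 0 \<le> t \<and> ereal t \<le> len \<Gamma> e} (\<lambda>t. real_of_ereal (k (pt e t)))"
      by (rule continuous_on_compose2[OF continuous_on_real]) (auto simp: k(2) finite_pointI e)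
    thus ?thesis
      by (rule continuous_on_eq) (auto simp: k(2) finite_pointI e)
  qed
  have local: "\<exists>U z. openin (topo \<Gamma>) U \<and> chart \<Gamma> e t \<in> U \<and> z \<in> finite_points \<Gamma> \<and>
      (\<forall>y\<in>U \<inter> finite_points \<Gamma>. \<exists>m::int. h y = h z + of_int m * rdist z y)" if "t \<in> {0..len \<Gamma> e}" for t
    using loc chart_in_points[OF e that] unfolding locally_integral_def by blast
  have affine: "affine_on UNIV x y ?g"
    if xy: "0 \<le> x" "x < y" "y \<le> len \<Gamma> e"
      and z: "\<forall>y\<in>U \<inter> finite_points \<Gamma>. \<exists>m::int. h y = h z + of_int m * rdist z y" "chart \<Gamma> e ` {x..y} \<subseteq> U"
      and D: "\<And>t. x \<le> ereal t \<Longrightarrow> ereal t \<le> y \<Longrightarrow> rdist z (pt e t) = of_int \<sigma> * t + c" "\<sigma> \<in> {-1, 1}"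
      and \<zeta>: "\<not> (x < ereal (- c * of_int \<sigma>) \<and> ereal (- c * of_int \<sigma>) < y)"
    for x y U z \<sigma> c
  proof (rule integer_multiple_affine[OF xy(2) _ D(1)])
    show "continuous_on {t. x \<le> ereal t \<and> ereal t \<le> y} ?g"
    proof (rule continuous_on_subset[OF cont], rule subsetI)
      fix t assume "t \<in> {t. x \<le> ereal t \<and> ereal t \<le> y}"
      hence t: "x \<le> ereal t" "ereal t \<le> y" by auto
      have "0 \<le> ereal t" "ereal t \<le> len \<Gamma> e"
        using order_trans[OF xy(1) t(1)] order_trans[OF t(2) xy(3)] by auto
      thus "t \<in> {t. 0 \<le> t \<and> ereal t \<le> len \<Gamma> e}" by simp
    qed
    fix t assume t: "x < ereal t" "ereal t < y"
    have "rdist z (pt e t) = of_int \<sigma> * t + c" using D(1)[of t] t by (simp add: less_imp_le)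
    moreover have "t \<noteq> - c * of_int \<sigma>" using \<zeta> t by auto
    ultimately show "rdist z (pt e t) \<noteq> 0" using D(2) by auto
    have "0 \<le> ereal t" "ereal t \<le> len \<Gamma> e" using t xy by (meson less_imp_le order_trans)+
    hence "pt e t \<in> finite_points \<Gamma>" using finite_pointI[OF e] by simp
    moreover have "pt e t \<in> U" using z(2) t by (auto simp: image_subset_iff less_imp_le)
    ultimately show "\<exists>m::int. ?g t = h z + of_int m * rdist z (pt e t)" using z(1) by blast
  qed
  have dist: "locally_affine {-1, 1} 0 (len \<Gamma> e) (\<lambda>t. rdist z (pt e t))" if "z \<in> finite_points \<Gamma>" for z
    using rdist_PL[OF that] e unfolding PL_def by blast
  show "locally_affine UNIV 0 (len \<Gamma> e) ?g"
    unfolding locally_affine_def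
  proof (intro conjI allI impI)
    fix t assume t: "0 \<le> t \<and> t < len \<Gamma> e"
    hence t_in: "t \<in> {0..len \<Gamma> e}" by (simp add: less_imp_le)
    obtain U z where Uz: "openin (topo \<Gamma>) U" "chart \<Gamma> e t \<in> U" "z \<in> finite_points \<Gamma>"
      "\<forall>y\<in>U \<inter> finite_points \<Gamma>. \<exists>m::int. h y = h z + of_int m * rdist z y"
      using local[OF t_in] by blast
    obtain w where w: "t < w" "w \<le> len \<Gamma> e" "affine_on {-1, 1} t w (\<lambda>t. rdist z (pt e t))"
      using locally_affine_rightE[OF dist[OF Uz(3)]] t by blast
    obtain \<sigma> c where \<sigma>: "\<sigma> \<in> {-1, 1}"
      "\<And>u. t \<le> ereal u \<Longrightarrow> ereal u \<le> w \<Longrightarrow> rdist z (pt e u) = of_int \<sigma> * u + c"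
      by (rule affine_onE[OF w(3)], rule that)
    obtain v where v: "t < v" "v \<le> len \<Gamma> e" "chart \<Gamma> e ` {t..v} \<subseteq> U"
      using openin_near(1)[OF Uz(1) e t_in Uz(2)] t by blast
    define \<zeta> where "\<zeta> = ereal (- c * of_int \<sigma>)"
    define b where "b = min (min v w) (if t < \<zeta> then \<zeta> else v)"
    have b: "t < b" "b \<le> v" "b \<le> w" "\<not> (t < \<zeta> \<and> \<zeta> < b)" using v w by (auto simp: b_def min_le_iff_disj)
    have "affine_on UNIV t b ?g"
      by (rule affine[OF _ b(1) _ Uz(4) _ \<sigma>(2,1)])
         (use t b v w in \<open>auto simp: \<zeta>_def image_subset_iff intro: order_trans\<close>)
    thus "\<exists>b>t. b \<le> len \<Gamma> e \<and> affine_on UNIV t b ?g" using b w by (meson order_trans)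
  next
    fix t assume t: "0 < t \<and> t \<le> len \<Gamma> e"
    hence t_in: "t \<in> {0..len \<Gamma> e}" by (simp add: less_imp_le)
    obtain U z where Uz: "openin (topo \<Gamma>) U" "chart \<Gamma> e t \<in> U" "z \<in> finite_points \<Gamma>"
      "\<forall>y\<in>U \<inter> finite_points \<Gamma>. \<exists>m::int. h y = h z + of_int m * rdist z y"
      using local[OF t_in] by blast
    obtain w where w: "w < t" "0 \<le> w" "affine_on {-1, 1} w t (\<lambda>t. rdist z (pt e t))"
      using locally_affine_leftE[OF dist[OF Uz(3)]] t by blast
    obtain \<sigma> c where \<sigma>: "\<sigma> \<in> {-1, 1}"
      "\<And>u. w \<le> ereal u \<Longrightarrow> ereal u \<le> t \<Longrightarrow> rdist z (pt e u) = of_int \<sigma> * u + c"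
      by (rule affine_onE[OF w(3)], rule that)
    obtain v where v: "v < t" "0 \<le> v" "chart \<Gamma> e ` {v..t} \<subseteq> U"
      using openin_near(2)[OF Uz(1) e t_in Uz(2)] t by blast
    define \<zeta> where "\<zeta> = ereal (- c * of_int \<sigma>)"
    define b where "b = max (max v w) (if \<zeta> < t then \<zeta> else v)"
    have b: "b < t" "v \<le> b" "w \<le> b" "\<not> (b < \<zeta> \<and> \<zeta> < t)" using v w by (auto simp: b_def le_max_iff_disj)
    have "affine_on UNIV b t ?g"
      by (rule affine[OF _ b(1) _ Uz(4) _ \<sigma>(2,1)])
         (use t b v w in \<open>auto simp: \<zeta>_def image_subset_iff intro: order_trans\<close>)
    thus "\<exists>b<t. 0 \<le> b \<and> affine_on UNIV b t ?g" using b w by (meson order_trans)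
  qed
qed

end

section \<open>Slopes\<close>

lemma piece_with_excluded_slope:
  assumes "locally_affine UNIV a b g" "\<not> locally_affine M a b g"
  obtains x y m c where "a \<le> x" "x < y" "y \<le> b" "m \<notin> M"
    "\<And>t. x \<le> ereal t \<Longrightarrow> ereal t \<le> y \<Longrightarrow> g t = of_int m * t + c"
proof (rule ccontr)
  note found = that
  assume none: "\<not> thesis"
  have "affine_on M x y g" if xy: "a \<le> x" "x < y" "y \<le> b" and aff: "affine_on UNIV x y g" for x y
  proof -
    obtain m c where m: "\<And>t. x \<le> ereal t \<Longrightarrow> ereal t \<le> y \<Longrightarrow> g t = of_int m * t + c"
      by (rule affine_onE[OF aff]) blast
    have "m \<in> M"
    proof (rule ccontr)
      assume "m \<notin> M"
      from found[OF xy this m] show False using none by blast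
    qed
    thus ?thesis using m unfolding affine_on_def by blast
  qed
  hence "locally_affine M a b g"
    using assms(1) unfolding locally_affine_def by (meson less_imp_le order_trans order_refl)
  thus False using assms(2) by contradiction
qed

text \<open>The slope of a nontrivial piece may be read off near its left end.\<close>

lemma locally_affine_slope:
  assumes g: "locally_affine M a b g" and xy: "a \<le> x" "x < y" "y \<le> b"
    and m: "\<And>t. x \<le> ereal t \<Longrightarrow> ereal t \<le> y \<Longrightarrow> g t = m * t + c"
  shows "\<exists>k\<in>M. m = of_int k"
proof -
  have "x < b" using xy by simp
  then obtain s where s: "x < s" "affine_on M x s g" using locally_affine_rightE[OF g xy(1)] by blast
  obtain k d where k: "k \<in> M" "\<And>t. x \<le> ereal t \<Longrightarrow> ereal t \<le> s \<Longrightarrow> g t = of_int k * t + d"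
    by (rule affine_onE[OF s(2)], rule that)
  have "x < min y s" using xy s by simp
  then obtain u v where uv: "x < ereal u" "u < v" "ereal v < min y s" by (rule two_reals_between)
  have "ereal u < ereal v" using uv by simp
  moreover have "ereal v < y" "ereal v < s" using uv by simp_all
  ultimately have le: "x \<le> ereal u" "x \<le> ereal v" "ereal u \<le> y" "ereal v \<le> y" "ereal u \<le> s" "ereal v \<le> s"
    using uv(1) by (meson less_imp_le order_less_trans)+
  have "m = of_int k \<and> c = d"
    by (rule affine_coefficients_unique[of _ u _ _ _ v]) (use le m k(2) uv in \<open>auto simp flip: m\<close>)
  thus ?thesis using k(1) by blast
qed

text \<open>On a common piece, either the slopes of \<open>g\<close> and of \<open>n k + c\<close> differ and the functions
  coincide at one point at most, or the slope of \<open>g\<close> is a multiple of \<open>n\<close>; lying in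
  \<open>{-1, 0, 1}\<close>, it is then zero.\<close>

lemma finite_values_of_coincidence:
  fixes n :: nat
  assumes g: "locally_affine {-1, 0, 1} a b g" and k: "locally_affine UNIV a b k" and "a < b" "2 \<le> n"
  shows "finite (g ` {t. a \<le> ereal t \<and> ereal t \<le> b \<and> g t = of_nat n * k t + c})"
proof -
  define P where "P x y = finite (g ` {t. x \<le> ereal t \<and> ereal t \<le> y \<and> g t = of_nat n * k t + c})" for x y
  have aff: "P x y" if gk: "affine_on {-1, 0, 1} x y g" "affine_on UNIV x y k" for x y
  proof -
    obtain m d where m: "m \<in> {-1, 0, 1}" "\<And>t. x \<le> ereal t \<Longrightarrow> ereal t \<le> y \<Longrightarrow> g t = of_int m * t + d"
      by (rule affine_onE[OF gk(1)], rule that)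
    obtain j f where j: "\<And>t. x \<le> ereal t \<Longrightarrow> ereal t \<le> y \<Longrightarrow> k t = of_int j * t + f"
      by (rule affine_onE[OF gk(2)]) blast
    show ?thesis
    proof (cases "m = 0")
      case True
      hence "g ` {t. x \<le> ereal t \<and> ereal t \<le> y \<and> g t = of_nat n * k t + c} \<subseteq> {d}" using m by auto
      thus ?thesis unfolding P_def by (rule finite_subset) simp
    next
      case False
      have "m \<noteq> int n * j"
      proof
        assume "m = int n * j"
        hence "int n dvd m" by simp
        hence "int n dvd 1" using m(1) False by (auto dest: dvd_minus_iff[THEN iffD1])
        thus False using \<open>2 \<le> n\<close> by simp
      qed
      hence ne: "real_of_int m \<noteq> of_nat n * of_int j" by (metis of_int_eq_iff of_int_mult of_int_of_nat_eq)
      have "{t. x \<le> ereal t \<and> ereal t \<le> y \<and> g t = of_nat n * k t + c}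
          \<subseteq> {(of_nat n * f + c - d) / (of_int m - of_nat n * of_int j)}"
      proof
        fix t assume "t \<in> {t. x \<le> ereal t \<and> ereal t \<le> y \<and> g t = of_nat n * k t + c}"
        hence "of_int m * t + d = of_nat n * (of_int j * t + f) + c" using m j by auto
        hence "t * (of_int m - of_nat n * of_int j) = of_nat n * f + c - d" by (simp add: algebra_simps)
        thus "t \<in> {(of_nat n * f + c - d) / (of_int m - of_nat n * of_int j)}"
          using ne by (simp add: eq_divide_eq)
      qed
      thus ?thesis unfolding P_def by (intro finite_imageI) (rule finite_subset, auto)
    qed
  qed
  have "P a b"
  proof (rule interval_glue_induct[OF \<open>a < b\<close>])
    fix x y z assume "P x y" "P y z"
    moreover have "g ` {t. x \<le> ereal t \<and> ereal t \<le> z \<and> g t = of_nat n * k t + c} \<subseteq>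
       g ` {t. x \<le> ereal t \<and> ereal t \<le> y \<and> g t = of_nat n * k t + c} \<union>
       g ` {t. y \<le> ereal t \<and> ereal t \<le> z \<and> g t = of_nat n * k t + c}"
      using linear by auto
    ultimately show "P x z" unfolding P_def by (meson finite_UnI finite_subset)
  next
    fix t assume t: "a \<le> t" "t < b"
    obtain s1 where s1: "t < s1" "s1 \<le> b" "affine_on {-1, 0, 1} t s1 g" using locally_affine_rightE[OF g t] .
    obtain s2 where s2: "t < s2" "s2 \<le> b" "affine_on UNIV t s2 k" using locally_affine_rightE[OF k t] .
    show "\<exists>s>t. s \<le> b \<and> (\<forall>u. t < u \<and> u \<le> s \<longrightarrow> P t u)"
      by (rule exI[of _ "min s1 s2"])
         (use s1 s2 in \<open>auto intro!: aff intro: affine_on_subinterval min.coboundedI1\<close>)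
  next
    fix t assume t: "a < t" "t \<le> b"
    obtain s1 where s1: "s1 < t" "a \<le> s1" "affine_on {-1, 0, 1} s1 t g" using locally_affine_leftE[OF g t] .
    obtain s2 where s2: "s2 < t" "a \<le> s2" "affine_on UNIV s2 t k" using locally_affine_leftE[OF k t] .
    show "\<exists>s<t. a \<le> s \<and> (\<forall>u. s \<le> u \<and> u < t \<longrightarrow> P u t)"
      by (rule exI[of _ "max s1 s2"])
         (use s1 s2 in \<open>auto intro!: aff intro: affine_on_subinterval max.coboundedI1\<close>)
  qed
  thus ?thesis unfolding P_def .
qed

context trop
begin

text \<open>A nonzero slope \<open>m\<close> is not divisible by \<open>\<bar>m\<bar> + 1\<close>. So all slopes are zero; as
  the curve is connected, \<open>h\<close> is constant.\<close>

lemma constant_if_divisible: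
  assumes h: "PL UNIV \<Gamma> h"
    and div: "\<And>n::nat. 0 < n \<Longrightarrow> \<exists>k. PL UNIV \<Gamma> k \<and> (\<forall>x\<in>finite_points \<Gamma>. h x = of_nat n * k x)"
    and x: "x \<in> finite_points \<Gamma>" and y: "y \<in> finite_points \<Gamma>"
  shows "h x = h y"
proof -
  have "PL {0} \<Gamma> h"
    unfolding PL_def
  proof (intro ballI, rule ccontr)
    fix e assume e: "e \<in> edges \<Gamma>" and bad: "\<not> locally_affine {0} 0 (len \<Gamma> e) (\<lambda>t. h (pt e t))"
    have "locally_affine UNIV 0 (len \<Gamma> e) (\<lambda>t. h (pt e t))"
      using h e unfolding PL_def by blast
    from piece_with_excluded_slope[OF this bad] obtain u v m c where
      uv: "0 \<le> u" "u < v" "v \<le> len \<Gamma> e" and "m \<noteq> 0"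
      and m: "\<And>t. u \<le> ereal t \<Longrightarrow> ereal t \<le> v \<Longrightarrow> h (pt e t) = of_int m * t + c"
      by (metis singletonI)
    define n where "n = nat \<bar>m\<bar> + 1"
    obtain k where k: "PL UNIV \<Gamma> k" "\<And>x. x \<in> finite_points \<Gamma> \<Longrightarrow> h x = of_nat n * k x"
      using div[of n] by (auto simp: n_def)
    have "k (pt e t) = of_int m / of_nat n * t + c / of_nat n" if t: "u \<le> ereal t" "ereal t \<le> v" for t
    proof -
      have "0 \<le> ereal t" "ereal t \<le> len \<Gamma> e" using t uv by (meson order_trans)+
      hence "pt e t \<in> finite_points \<Gamma>" using finite_pointI[OF e] by simp
      moreover have "0 < real n" by (simp add: n_def)
      ultimately show ?thesis using k(2) m[OF t] by (simp add: field_simps)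
    qed
    moreover have "locally_affine UNIV 0 (len \<Gamma> e) (\<lambda>t. k (pt e t))"
      using k(1) e unfolding PL_def by blast
    ultimately obtain j :: int where "real_of_int m / of_nat n = of_int j"
      using locally_affine_slope[OF _ uv] by blast
    hence "real_of_int m = of_int (j * int n)" by (simp add: n_def field_simps)
    hence "m = j * int n" by (rule of_int_eq_iff[THEN iffD1])
    hence "int n dvd m" by simp
    hence "int n \<le> \<bar>m\<bar>" using dvd_imp_le_int[of m "int n"] \<open>m \<noteq> 0\<close> by simp
    thus False by (simp add: n_def)
  qed
  moreover obtain d where "path_length \<Gamma> x y d" using path_exists[OF x y] by blast
  ultimately show ?thesis using PL_Lipschitz[of "{0}" h 0 x y d] by simp
qed

text \<open>Some slope has absolute value at least two, expressed in terms that semiring isomorphisms respect: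
  points, values, integer multiples and constants. Requiring infinitely many values on \<open>S\<close>
  excludes that \<open>h\<close> is constant there, as well as coincidences at isolated points.\<close>

definition somewhere_divisible :: "('a \<Rightarrow> real) \<Rightarrow> bool" where
  "somewhere_divisible h \<longleftrightarrow> (\<exists>S n k c. S \<subseteq> finite_points \<Gamma> \<and> infinite (h ` S) \<and> (2::nat) \<le> n \<and>
      PL UNIV \<Gamma> k \<and> (\<forall>x\<in>S. h x = of_nat n * k x + c))"

lemma unit_slopes_imp_not_divisible:
  assumes h: "PL {-1, 0, 1} \<Gamma> h"
  shows "\<not> somewhere_divisible h"
proof
  assume "somewhere_divisible h"
  then obtain S n k c where S: "S \<subseteq> finite_points \<Gamma>" "infinite (h ` S)" "(2::nat) \<le> n"
    and k: "PL UNIV \<Gamma> k" "\<And>x. x \<in> S \<Longrightarrow> h x = of_nat n * k x + c"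
    unfolding somewhere_divisible_def by blast
  define V where "V e = (\<lambda>t. h (pt e t)) ` {t. 0 \<le> ereal t \<and> ereal t \<le> len \<Gamma> e \<and>
      h (pt e t) = of_nat n * k (pt e t) + c}" for e
  have fin: "finite (V e)" if "e \<in> edges \<Gamma>" for e
    unfolding V_def
    by (rule finite_values_of_coincidence) (use h k(1) that len_pos S(3) in \<open>auto simp: PL_def\<close>)
  show False
  proof (cases "edges \<Gamma> = {}")
    case True
    obtain x where "x \<in> points \<Gamma>" using finite_points_nonempty finite_subset_points by blast
    hence "finite_points \<Gamma> = {x}" by (cases rule: point_cases) (use True in auto)
    hence "finite S" using S(1) by (metis finite.emptyI finite.insertI finite_subset)
    thus False using S(2) by simp
  next
    case False
    have "h ` S \<subseteq> (\<Union>e\<in>edges \<Gamma>. V e)"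
    proof
      fix v assume "v \<in> h ` S"
      then obtain x where x: "x \<in> S" "v = h x" by blast
      hence xp: "x \<in> points \<Gamma>" "x \<in> finite_points \<Gamma>" using S(1) finite_subset_points by auto
      from xp(1) show "v \<in> (\<Union>e\<in>edges \<Gamma>. V e)"
      proof (cases rule: point_cases)
        case (fin e t)
        hence "v \<in> V e" unfolding V_def using x k(2)[OF x(1)] by auto
        thus ?thesis using fin by blast
      qed (use False xp in auto)
    qed
    moreover have "finite (\<Union>e\<in>edges \<Gamma>. V e)" using fin finite_edges by blast
    ultimately show False using S(2) finite_subset by blast
  qed
qed

text \<open>Where \<open>h\<close> has the slope \<open>m\<close> and the distance from a point \<open>z\<close> has the slope
  \<open>\<sigma> = \<plusminus>1\<close>, the function \<open>h\<close> is \<open>m \<sigma>\<close> times this distance, up to a constant;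
  so if \<open>\<bar>m\<bar> \<ge> 2\<close>, divisibility holds with \<open>n = \<bar>m\<bar>\<close>.\<close>

lemma not_divisible_imp_unit_slopes:
  assumes h: "PL UNIV \<Gamma> h" and nd: "\<not> somewhere_divisible h"
  shows "PL {-1, 0, 1} \<Gamma> h"
  unfolding PL_def
proof (intro ballI, rule ccontr)
  fix e assume e: "e \<in> edges \<Gamma>" and bad: "\<not> locally_affine {-1, 0, 1} 0 (len \<Gamma> e) (\<lambda>t. h (pt e t))"
  have "locally_affine UNIV 0 (len \<Gamma> e) (\<lambda>t. h (pt e t))"
    using h e unfolding PL_def by blast
  from piece_with_excluded_slope[OF this bad] obtain u v m c where
    uv: "0 \<le> u" "u < v" "v \<le> len \<Gamma> e" and m1: "m \<notin> {-1, 0, 1}"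
    and m: "\<And>t. u \<le> ereal t \<Longrightarrow> ereal t \<le> v \<Longrightarrow> h (pt e t) = of_int m * t + c"
    by blast
  obtain s where s: "u = ereal s" using uv by (cases u) auto
  define z where "z = pt e s"
  have z: "z \<in> finite_points \<Gamma>" unfolding z_def by (rule finite_pointI) (use e uv s in auto)
  have "locally_affine {-1, 1} 0 (len \<Gamma> e) (\<lambda>t. rdist z (pt e t))"
    using rdist_PL[OF z] e unfolding PL_def by blast
  moreover have "u < len \<Gamma> e" using uv by simp
  ultimately obtain w where w: "u < w" "affine_on {-1, 1} u w (\<lambda>t. rdist z (pt e t))"
    using locally_affine_rightE uv(1) by metis
  obtain \<sigma> d where \<sigma>: "\<sigma> \<in> {-1, 1}"
    "\<And>t. u \<le> ereal t \<Longrightarrow> ereal t \<le> w \<Longrightarrow> rdist z (pt e t) = of_int \<sigma> * t + d"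
    by (rule affine_onE[OF w(2)], rule that)
  have "u < min v w" using uv w by simp
  then obtain p q where pq: "u < ereal p" "p < q" "ereal q < min v w" by (rule two_reals_between)
  have in_uvw: "u \<le> ereal t" "ereal t \<le> v" "ereal t \<le> w" if "t \<in> {p..q}" for t
  proof -
    have "ereal p \<le> ereal t" "ereal t \<le> ereal q" using that by auto
    thus "u \<le> ereal t" "ereal t \<le> v" "ereal t \<le> w" using pq by (auto simp del: ereal_less_eq intro: order_trans less_imp_le)
  qed
  define S where "S = (\<lambda>t. pt e t) ` {p..q}"
  \<comment> \<open>The multiplier \<open>\<bar>m\<bar>\<close> has to be positive, so \<open>k\<close> takes over the sign.\<close>
  define k where "k x = of_int (sgn (m * \<sigma>)) * rdist z x" for x
  have "somewhere_divisible h"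
    unfolding somewhere_divisible_def
  proof (intro exI[of _ S] exI[of _ "nat \<bar>m\<bar>"] exI[of _ k] exI[of _ "c - of_int (m * \<sigma>) * d"] conjI ballI)
    show "S \<subseteq> finite_points \<Gamma>"
    proof
      fix x assume "x \<in> S"
      then obtain t where t: "t \<in> {p..q}" "x = pt e t" by (auto simp: S_def)
      have "0 \<le> ereal t" "ereal t \<le> len \<Gamma> e" using in_uvw[OF t(1)] uv by (meson order_trans)+
      thus "x \<in> finite_points \<Gamma>" using t finite_pointI[OF e, of t] by simp
    qed
    have "h ` S = (\<lambda>t. of_int m * t + c) ` {p..q}"
      unfolding S_def image_image by (rule image_cong) (use m in_uvw in auto)
    moreover have "inj_on (\<lambda>t. of_int m * t + c) {p..q}" using m1 by (auto simp: inj_on_def)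
    ultimately show "infinite (h ` S)" using pq(2) finite_imageD infinite_Icc by metis
    show "2 \<le> nat \<bar>m\<bar>" using m1 by auto
    show "PL UNIV \<Gamma> k"
    proof (cases "m * \<sigma> > 0")
      case True
      thus ?thesis using PL_UNIV[OF rdist_PL[OF z]] by (simp add: k_def[abs_def])
    next
      case False
      hence "m * \<sigma> < 0" using m1 \<sigma>(1) by auto
      thus ?thesis using PL_uminus[OF PL_UNIV[OF rdist_PL[OF z]]] by (simp add: k_def[abs_def])
    qed
    fix x assume "x \<in> S"
    then obtain t where t: "t \<in> {p..q}" "x = pt e t" by (auto simp: S_def)
    have "real (nat \<bar>m\<bar>) * of_int (sgn (m * \<sigma>)) = of_int (m * \<sigma>)"
      using \<sigma>(1) by (cases "m > 0") (auto simp: sgn_if)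
    hence "of_nat (nat \<bar>m\<bar>) * k x = of_int (m * \<sigma>) * rdist z x" by (simp add: k_def)
    also have "rdist z x = of_int \<sigma> * t + d" using \<sigma>(2) in_uvw[OF t(1)] t(2) by simp
    finally have "of_nat (nat \<bar>m\<bar>) * k x = of_int (m * \<sigma>) * (of_int \<sigma> * t + d)" .
    moreover have "h x = of_int m * t + c" using m in_uvw[OF t(1)] t(2) by simp
    ultimately show "h x = of_nat (nat \<bar>m\<bar>) * k x + (c - of_int (m * \<sigma>) * d)"
      using \<sigma>(1) by (auto simp: algebra_simps)
  qed
  thus False using nd by contradiction
qed

end

section \<open>The groupoid of semirings\<close>

lemma semiring_isosD:
  assumes "\<psi> \<in> semiring_isos R S"
  shows "\<psi> \<in> extensional (carrier R)" "\<psi> \<zero>\<^bsub>R\<^esub> = \<zero>\<^bsub>S\<^esub>" "\<psi> \<one>\<^bsub>R\<^esub> = \<one>\<^bsub>S\<^esub>"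
    "bij_betw \<psi> (carrier R) (carrier S)"
    "f \<in> carrier R \<Longrightarrow> \<psi> f \<in> carrier S"
    "f \<in> carrier R \<Longrightarrow> g \<in> carrier R \<Longrightarrow> \<psi> (f \<otimes>\<^bsub>R\<^esub> g) = \<psi> f \<otimes>\<^bsub>S\<^esub> \<psi> g"
    "f \<in> carrier R \<Longrightarrow> g \<in> carrier R \<Longrightarrow> \<psi> (f \<oplus>\<^bsub>R\<^esub> g) = \<psi> f \<oplus>\<^bsub>S\<^esub> \<psi> g"
  using assms unfolding semiring_isos_def ring_hom_def by (auto simp: Pi_iff)

lemma semiring_isosI:
  assumes "\<psi> \<in> extensional (carrier R)" "\<psi> \<zero>\<^bsub>R\<^esub> = \<zero>\<^bsub>S\<^esub>" "\<psi> \<one>\<^bsub>R\<^esub> = \<one>\<^bsub>S\<^esub>"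
    "bij_betw \<psi> (carrier R) (carrier S)"
    "\<And>f g. f \<in> carrier R \<Longrightarrow> g \<in> carrier R \<Longrightarrow> \<psi> (f \<otimes>\<^bsub>R\<^esub> g) = \<psi> f \<otimes>\<^bsub>S\<^esub> \<psi> g"
    "\<And>f g. f \<in> carrier R \<Longrightarrow> g \<in> carrier R \<Longrightarrow> \<psi> (f \<oplus>\<^bsub>R\<^esub> g) = \<psi> f \<oplus>\<^bsub>S\<^esub> \<psi> g"
  shows "\<psi> \<in> semiring_isos R S"
  using assms unfolding semiring_isos_def ring_hom_def by (auto simp: Pi_iff bij_betw_def)

text \<open>Homomorphisms are maps on the carrier only, so composites and inverses respect an operation only if
  its results stay in the carrier.\<close>

definition ops_closed :: "'s ring \<Rightarrow> bool" where
  "ops_closed R \<longleftrightarrow> \<zero>\<^bsub>R\<^esub> \<in> carrier R \<and> \<one>\<^bsub>R\<^esub> \<in> carrier R \<and>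
     (\<forall>f\<in>carrier R. \<forall>g\<in>carrier R. f \<otimes>\<^bsub>R\<^esub> g \<in> carrier R \<and> f \<oplus>\<^bsub>R\<^esub> g \<in> carrier R)"

lemma semiring_isos_inverse:
  assumes \<psi>: "\<psi> \<in> semiring_isos R S" and R: "ops_closed R" and S: "ops_closed S"
  shows "restrict (inv_into (carrier R) \<psi>) (carrier S) \<in> semiring_isos S R"
proof -
  note D = semiring_isosD[OF \<psi>]
  let ?\<chi> = "restrict (inv_into (carrier R) \<psi>) (carrier S)"
  have \<chi>: "?\<chi> (\<psi> f) = f" if "f \<in> carrier R" for f
    using that D(4,5) by (simp add: bij_betw_def)
  have surj: "\<exists>f\<in>carrier R. u = \<psi> f" if "u \<in> carrier S" for u
    using that D(4) by (auto simp: bij_betw_def)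
  show ?thesis
  proof (rule semiring_isosI)
    show "bij_betw ?\<chi> (carrier S) (carrier R)"
      using bij_betw_inv_into[OF D(4)] by (simp cong: bij_betw_cong)
    show "?\<chi> \<zero>\<^bsub>S\<^esub> = \<zero>\<^bsub>R\<^esub>" using \<chi>[of "\<zero>\<^bsub>R\<^esub>"] D(2) R by (simp add: ops_closed_def)
    show "?\<chi> \<one>\<^bsub>S\<^esub> = \<one>\<^bsub>R\<^esub>" using \<chi>[of "\<one>\<^bsub>R\<^esub>"] D(3) R by (simp add: ops_closed_def)
    fix u v assume "u \<in> carrier S" "v \<in> carrier S"
    then obtain f g where fg: "f \<in> carrier R" "u = \<psi> f" "g \<in> carrier R" "v = \<psi> g" using surj by metis
    have cl: "f \<otimes>\<^bsub>R\<^esub> g \<in> carrier R" "f \<oplus>\<^bsub>R\<^esub> g \<in> carrier R" using R fg by (auto simp: ops_closed_def)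
    show "?\<chi> (u \<otimes>\<^bsub>S\<^esub> v) = ?\<chi> u \<otimes>\<^bsub>R\<^esub> ?\<chi> v"
      using \<chi>[OF cl(1)] \<chi>[OF fg(1)] \<chi>[OF fg(3)] D(6)[OF fg(1,3)] fg by metis
    show "?\<chi> (u \<oplus>\<^bsub>S\<^esub> v) = ?\<chi> u \<oplus>\<^bsub>R\<^esub> ?\<chi> v"
      using \<chi>[OF cl(2)] \<chi>[OF fg(1)] \<chi>[OF fg(3)] D(7)[OF fg(1,3)] fg by metis
  qed simp
qed

lemma semiring_isos_identity: "restrict (\<lambda>f. f) (carrier R) \<in> semiring_isos R R" if "ops_closed R"
  by (rule semiring_isosI) (use that in \<open>auto simp: ops_closed_def bij_betw_def inj_on_def\<close>)

lemma semiring_isos_compose: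
  assumes R: "ops_closed R" and \<psi>: "\<psi> \<in> semiring_isos R S" and \<xi>: "\<xi> \<in> semiring_isos S T"
  shows "compose (carrier R) \<xi> \<psi> \<in> semiring_isos R T"
proof (rule semiring_isosI)
  note D = semiring_isosD[OF \<psi>] and E = semiring_isosD[OF \<xi>]
  have "bij_betw (\<xi> \<circ> \<psi>) (carrier R) (carrier T)" by (rule bij_betw_trans[OF D(4) E(4)])
  thus "bij_betw (compose (carrier R) \<xi> \<psi>) (carrier R) (carrier T)"
    by (rule bij_betw_cong[THEN iffD1, rotated]) (simp add: compose_eq)
  show "compose (carrier R) \<xi> \<psi> \<zero>\<^bsub>R\<^esub> = \<zero>\<^bsub>T\<^esub>" "compose (carrier R) \<xi> \<psi> \<one>\<^bsub>R\<^esub> = \<one>\<^bsub>T\<^esub>"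
    using R D(2,3) E(2,3) by (simp_all add: ops_closed_def compose_eq)
  fix f g assume fg: "f \<in> carrier R" "g \<in> carrier R"
  hence cl: "f \<otimes>\<^bsub>R\<^esub> g \<in> carrier R" "f \<oplus>\<^bsub>R\<^esub> g \<in> carrier R" using R by (auto simp: ops_closed_def)
  show "compose (carrier R) \<xi> \<psi> (f \<otimes>\<^bsub>R\<^esub> g) = compose (carrier R) \<xi> \<psi> f \<otimes>\<^bsub>T\<^esub> compose (carrier R) \<xi> \<psi> g"
    "compose (carrier R) \<xi> \<psi> (f \<oplus>\<^bsub>R\<^esub> g) = compose (carrier R) \<xi> \<psi> f \<oplus>\<^bsub>T\<^esub> compose (carrier R) \<xi> \<psi> g"
    using fg cl D(5-7) E(6,7) by (simp_all add: compose_eq)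
qed (simp add: compose_def)

lemma (in trop) Rat_ops_closed: "ops_closed (Rat \<Gamma>)"
  unfolding ops_closed_def using Rat_closed Rat_zero_closed Rat_one_closed by blast

section \<open>Semiring isomorphisms come from expansive maps\<close>

lemma ereal_minus_one_times: "ereal (- 1) * a = - a"
  by (cases a) auto

lemma ereal_mult_less_cancel:
  assumes "0 < r" "ereal r * a < ereal r * b" shows "a < b"
  using assms by (cases a; cases b) auto

lemma ereal_times_inverse: "0 < r \<Longrightarrow> ereal (1 / r) * (ereal r * a) = a" "0 < r \<Longrightarrow> ereal r * (ereal (1 / r) * a) = a"
  by (cases a; simp)+

text \<open>Additivity gives \<open>A k = k A 1\<close> for integers \<open>k\<close>. Comparing \<open>n x\<close> with the integers
  next to it bounds the error at \<open>x\<close> by \<open>A 1 / n\<close>.\<close>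

lemma monotone_additive_linear:
  fixes A :: "real \<Rightarrow> real"
  assumes add: "\<And>x y. A (x + y) = A x + A y" and mono: "\<And>x y. x \<le> y \<Longrightarrow> A x \<le> A y"
  shows "A x = A 1 * x"
proof -
  have A0: "A 0 = 0" using add[of 0 0] by simp
  have nat: "A (of_nat n * x) = of_nat n * A x" for n :: nat and x
    by (induction n) (simp_all add: A0 add algebra_simps)
  have A_neg: "A (- x) = - A x" for x using add[of x "- x"] A0 by simp
  have int: "A (of_int k * x) = of_int k * A x" for k :: int and x
  proof (cases k)
    case (nonneg n) thus ?thesis using nat[of n x] by simp
  next
    case (neg n)
    have k: "real_of_int k = - of_nat (Suc n)" using neg by simp
    have "A (- (of_nat (Suc n) * x)) = - (of_nat (Suc n) * A x)" unfolding A_neg nat ..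
    thus ?thesis unfolding k by (simp only: mult_minus_left)
  qed
  have A1: "0 \<le> A 1" using mono[of 0 1] A0 by simp
  have bound: "of_nat n * \<bar>A x - A 1 * x\<bar> \<le> A 1" for n :: nat
  proof -
    define k where "k = \<lfloor>of_nat n * x\<rfloor>"
    have k: "of_int k \<le> of_nat n * x" "of_nat n * x \<le> of_int k + 1" unfolding k_def by linarith+
    have "of_int k * A 1 \<le> of_nat n * A x"
      using mono[OF k(1)] int[of k 1] nat[of n x] by simp
    moreover have "of_nat n * A x \<le> of_int k * A 1 + A 1"
      using mono[OF k(2)] int[of k 1] nat[of n x] add[of "of_int k" 1] by simp
    moreover have "A 1 * of_int k \<le> A 1 * (of_nat n * x)" "A 1 * (of_nat n * x) \<le> A 1 * (of_int k + 1)"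
      using k A1 by (auto intro: mult_left_mono)
    ultimately have "\<bar>of_nat n * (A x - A 1 * x)\<bar> \<le> A 1" by (simp add: algebra_simps abs_le_iff)
    thus ?thesis by (simp add: abs_mult)
  qed
  show ?thesis
  proof (rule ccontr)
    assume "A x \<noteq> A 1 * x"
    hence pos: "0 < \<bar>A x - A 1 * x\<bar>" by simp
    from reals_Archimedean3[OF this] obtain n :: nat where "A 1 < of_nat n * \<bar>A x - A 1 * x\<bar>" by blast
    thus False using bound[of n] by simp
  qed
qed

locale rat_iso = A: trop \<Gamma>1 + B: trop \<Gamma>2
  for \<Gamma>1 :: "('a, 'e) curve" and \<Gamma>2 :: "('a, 'e) curve" +
  fixes \<psi> :: "('a \<Rightarrow> ereal) \<Rightarrow> 'a \<Rightarrow> ereal"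
  assumes iso: "\<psi> \<in> semiring_isos (Rat \<Gamma>1) (Rat \<Gamma>2)"
begin

text \<open>The map that \<open>\<psi>\<close> induces on real functions, where the semiring operations are pointwise.\<close>

definition Psi :: "('a \<Rightarrow> real) \<Rightarrow> 'a \<Rightarrow> real" where
  "Psi h x = real_of_ereal (\<psi> (extend \<Gamma>1 h) x)"

lemma extend_carrier: "PL UNIV \<Gamma>1 h \<Longrightarrow> extend \<Gamma>1 h \<in> carrier (Rat \<Gamma>1)"
  by (simp add: A.Rat_carrier A.extend_in_rational_functions)

lemma
  assumes h: "PL UNIV \<Gamma>1 h"
  shows Psi_PL: "PL UNIV \<Gamma>2 (Psi h)" and extend_Psi: "extend \<Gamma>2 (Psi h) = \<psi> (extend \<Gamma>1 h)"
proof -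
  have "\<psi> (extend \<Gamma>1 h) \<in> rational_functions \<Gamma>2"
    using semiring_isosD(5)[OF iso extend_carrier[OF h]] by (simp add: B.Rat_carrier)
  then obtain k where k: "PL UNIV \<Gamma>2 k" "\<psi> (extend \<Gamma>1 h) = extend \<Gamma>2 k"
  proof (cases rule: B.rational_function_cases)
    case 1
    hence "\<psi> (extend \<Gamma>1 h) = \<psi> \<zero>\<^bsub>Rat \<Gamma>1\<^esub>" using semiring_isosD(2)[OF iso] by (simp add: B.Rat_zero)
    hence "extend \<Gamma>1 h = \<zero>\<^bsub>Rat \<Gamma>1\<^esub>"
      using semiring_isosD(4)[OF iso] extend_carrier[OF h] A.Rat_ops_closed
      by (auto simp: bij_betw_def ops_closed_def dest: inj_onD)
    thus thesis using A.extend_not_zero[OF h] by (simp add: A.Rat_zero)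
  qed
  have eq: "Psi h x = k x" if "x \<in> finite_points \<Gamma>2" for x
    using that k B.extend_finite by (simp add: Psi_def)
  show "PL UNIV \<Gamma>2 (Psi h)" using B.PL_cong[OF eq] k by simp
  show "extend \<Gamma>2 (Psi h) = \<psi> (extend \<Gamma>1 h)" using extend_cong[OF eq] k by simp
qed

lemma Psi_cong:
  assumes "\<And>x. x \<in> finite_points \<Gamma>1 \<Longrightarrow> h x = k x" shows "Psi h = Psi k"
  unfolding Psi_def using extend_cong[of \<Gamma>1 h k] assms by metis

lemma Psi_add:
  assumes h: "PL UNIV \<Gamma>1 h" and k: "PL UNIV \<Gamma>1 k" and x: "x \<in> finite_points \<Gamma>2"
  shows "Psi (\<lambda>x. h x + k x) x = Psi h x + Psi k x"
proof -
  note hk = PL_add[OF h k]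
  have "extend \<Gamma>2 (Psi (\<lambda>x. h x + k x)) = extend \<Gamma>2 (\<lambda>x. Psi h x + Psi k x)"
    using semiring_isosD(6)[OF iso extend_carrier[OF h] extend_carrier[OF k]]
    by (simp add: extend_Psi h k hk A.Rat_mult Psi_PL flip: B.Rat_mult)
  thus ?thesis using B.extend_eq_iff[OF Psi_PL[OF hk] PL_add[OF Psi_PL[OF h] Psi_PL[OF k]]] x by blast
qed

lemma Psi_max:
  assumes h: "PL UNIV \<Gamma>1 h" and k: "PL UNIV \<Gamma>1 k" and x: "x \<in> finite_points \<Gamma>2"
  shows "Psi (\<lambda>x. max (h x) (k x)) x = max (Psi h x) (Psi k x)"
proof -
  note hk = PL_max[OF h k]
  have "extend \<Gamma>2 (Psi (\<lambda>x. max (h x) (k x))) = extend \<Gamma>2 (\<lambda>x. max (Psi h x) (Psi k x))"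
    using semiring_isosD(7)[OF iso extend_carrier[OF h] extend_carrier[OF k]]
    by (simp add: extend_Psi h k hk A.Rat_add Psi_PL flip: B.Rat_add)
  thus ?thesis using B.extend_eq_iff[OF Psi_PL[OF hk] PL_max[OF Psi_PL[OF h] Psi_PL[OF k]]] x by blast
qed

lemma Psi_mono:
  assumes h: "PL UNIV \<Gamma>1 h" and k: "PL UNIV \<Gamma>1 k" and x: "x \<in> finite_points \<Gamma>2"
    and le: "\<And>x. x \<in> finite_points \<Gamma>1 \<Longrightarrow> h x \<le> k x"
  shows "Psi h x \<le> Psi k x"
proof -
  have "Psi (\<lambda>x. max (h x) (k x)) = Psi k" by (rule Psi_cong) (use le in \<open>simp add: max_absorb2\<close>)
  thus ?thesis using Psi_max[OF h k x] by simp
qed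

lemma Psi_zero: "x \<in> finite_points \<Gamma>2 \<Longrightarrow> Psi (\<lambda>x. 0) x = 0"
  using Psi_add[OF PL_const[of _ 0] PL_const[of _ 0]] by simp

lemma Psi_uminus:
  assumes h: "PL UNIV \<Gamma>1 h" and x: "x \<in> finite_points \<Gamma>2"
  shows "Psi (\<lambda>x. - h x) x = - Psi h x"
  using Psi_add[OF h PL_uminus[OF h] x] Psi_zero[OF x] by simp

lemma Psi_inj:
  assumes h: "PL UNIV \<Gamma>1 h" and k: "PL UNIV \<Gamma>1 k"
    and eq: "\<And>x. x \<in> finite_points \<Gamma>2 \<Longrightarrow> Psi h x = Psi k x" and x: "x \<in> finite_points \<Gamma>1"
  shows "h x = k x"
proof -
  have "\<psi> (extend \<Gamma>1 h) = \<psi> (extend \<Gamma>1 k)"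
    using extend_cong[of \<Gamma>2 "Psi h" "Psi k"] eq by (simp add: extend_Psi h k)
  hence "extend \<Gamma>1 h = extend \<Gamma>1 k"
    using semiring_isosD(4)[OF iso] extend_carrier[OF h] extend_carrier[OF k]
    by (auto simp: bij_betw_def dest: inj_onD)
  thus ?thesis using A.extend_eq_iff[OF h k] x by blast
qed

lemma Psi_const_multiple:
  assumes "x \<in> finite_points \<Gamma>2"
  shows "Psi (\<lambda>x. of_nat n * c) x = of_nat n * Psi (\<lambda>x. c) x"
proof (induction n)
  case 0 thus ?case using Psi_zero[OF assms] by simp
next
  case (Suc n)
  have "Psi (\<lambda>x. of_nat n * c + c) x = Psi (\<lambda>x. of_nat n * c) x + Psi (\<lambda>x. c) x"
    by (rule Psi_add[OF PL_const PL_const assms])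
  thus ?case using Suc by (simp add: algebra_simps)
qed

text \<open>Constants turn out to be mapped to constants, so the point chosen here does not matter.\<close>

definition factor :: real where
  "factor = Psi (\<lambda>x. 1) (SOME x. x \<in> finite_points \<Gamma>2)"

text \<open>A constant is divisible by every \<open>n\<close>; hence so is its image.\<close>

lemma Psi_const_constant:
  assumes "x \<in> finite_points \<Gamma>2" "y \<in> finite_points \<Gamma>2"
  shows "Psi (\<lambda>x. c) x = Psi (\<lambda>x. c) y"
proof (rule B.constant_if_divisible[OF Psi_PL[OF PL_const] _ assms])
  fix n :: nat assume "0 < n"
  hence "(\<lambda>x. c) = (\<lambda>x::'a. of_nat n * (c / of_nat n))" by simp
  thus "\<exists>k. PL UNIV \<Gamma>2 k \<and> (\<forall>x\<in>finite_points \<Gamma>2. Psi (\<lambda>x. c) x = of_nat n * k x)"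
    using Psi_const_multiple[of _ n "c / of_nat n"] Psi_PL[OF PL_const, of "c / of_nat n"] by metis
qed

lemma Psi_const:
  assumes x: "x \<in> finite_points \<Gamma>2"
  shows "Psi (\<lambda>x. c) x = factor * c"
proof -
  have "Psi (\<lambda>x. c) x = Psi (\<lambda>x. 1) x * c"
  proof (rule monotone_additive_linear[of "\<lambda>c. Psi (\<lambda>x. c) x"])
    show "Psi (\<lambda>x. a + b) x = Psi (\<lambda>x. a) x + Psi (\<lambda>x. b) x" for a b
      by (rule Psi_add[OF PL_const PL_const x])
    show "Psi (\<lambda>x. a) x \<le> Psi (\<lambda>x. b) x" if "a \<le> b" for a b
      by (rule Psi_mono[OF PL_const PL_const x that])
  qed
  moreover have "(SOME x. x \<in> finite_points \<Gamma>2) \<in> finite_points \<Gamma>2" using x by (rule someI)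
  ultimately show ?thesis using Psi_const_constant[OF x, of _ 1] unfolding factor_def by metis
qed

lemma factor_pos: "0 < factor"
proof -
  obtain x where x: "x \<in> finite_points \<Gamma>2" using B.finite_points_nonempty by blast
  have "0 \<le> factor"
    using Psi_mono[OF PL_const PL_const x, of 0 1] Psi_zero[OF x] Psi_const[OF x, of 1] by simp
  moreover have "factor \<noteq> 0"
  proof
    assume "factor = 0"
    hence "Psi (\<lambda>x. 1) y = Psi (\<lambda>x. 0) y" if "y \<in> finite_points \<Gamma>2" for y
      using Psi_const[OF that] by simp
    from Psi_inj[OF PL_const PL_const this] show False using A.finite_points_nonempty by fastforce
  qed
  ultimately show ?thesis by simp
qed

lemma extend_Psi_shift:
  assumes h: "PL UNIV \<Gamma>1 h" and y: "y \<in> points \<Gamma>2"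
  shows "extend \<Gamma>2 (Psi (\<lambda>x. h x + c)) y = extend \<Gamma>2 (Psi h) y + ereal (factor * c)"
proof -
  have "extend \<Gamma>2 (Psi (\<lambda>x. h x + c)) = extend \<Gamma>2 (\<lambda>x. 1 * Psi h x + factor * c)"
    by (rule extend_cong) (simp add: Psi_add[OF h PL_const] Psi_const)
  thus ?thesis
    using B.extend_affine_at[OF Psi_PL[OF h] _ y, of 1 "factor * c"] PL_add[OF Psi_PL[OF h] PL_const] by simp
qed

lemma extend_Psi_uminus:
  assumes h: "PL UNIV \<Gamma>1 h" and y: "y \<in> points \<Gamma>2"
  shows "extend \<Gamma>2 (Psi (\<lambda>x. - h x)) y = - extend \<Gamma>2 (Psi h) y"
proof -
  have "extend \<Gamma>2 (Psi (\<lambda>x. - h x)) = extend \<Gamma>2 (\<lambda>x. (-1) * Psi h x + 0)"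
    by (rule extend_cong) (simp add: Psi_uminus[OF h])
  thus ?thesis
    using B.extend_affine_at[OF Psi_PL[OF h] _ y, of "-1" 0] PL_uminus[OF Psi_PL[OF h]]
    by (simp add: ereal_minus_one_times)
qed

text \<open>A real number strictly between the two unequal values, subtracted from \<open>h\<close> or from
  \<open>-h\<close>, gives functions of different signs.\<close>

lemma separating_sign:
  assumes h: "PL UNIV \<Gamma>1 h" and x: "x \<in> points \<Gamma>1" and y: "y \<in> points \<Gamma>2"
    and ne: "extend \<Gamma>2 (Psi h) y \<noteq> ereal factor * extend \<Gamma>1 h x"
  shows "\<exists>g. PL UNIV \<Gamma>1 g \<and> 0 < extend \<Gamma>1 g x \<and> extend \<Gamma>2 (Psi g) y < 0"
proof -
  have shift: "\<exists>g. PL UNIV \<Gamma>1 g \<and> 0 < extend \<Gamma>1 g x \<and> extend \<Gamma>2 (Psi g) y < 0"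
    if h: "PL UNIV \<Gamma>1 h" and lt: "extend \<Gamma>2 (Psi h) y < ereal factor * extend \<Gamma>1 h x" for h
  proof -
    obtain d where d: "extend \<Gamma>2 (Psi h) y < ereal d" "ereal d < ereal factor * extend \<Gamma>1 h x"
      using ereal_dense2[OF lt] by blast
    define c where "c = d / factor"
    have c: "d = factor * c" using factor_pos by (simp add: c_def)
    have "ereal factor * ereal c < ereal factor * extend \<Gamma>1 h x" using d(2) c by simp
    hence "ereal c < extend \<Gamma>1 h x" by (rule ereal_mult_less_cancel[OF factor_pos])
    hence 1: "0 < ereal 1 * extend \<Gamma>1 h x + ereal (- c)" by (cases "extend \<Gamma>1 h x") auto
    have g: "PL UNIV \<Gamma>1 (\<lambda>x. 1 * h x + (- c))" using PL_add[OF h PL_const[of _ "- c"]] by simp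
    have "extend \<Gamma>2 (Psi (\<lambda>x. h x + (- c))) y = extend \<Gamma>2 (Psi h) y + ereal (factor * (- c))"
      by (rule extend_Psi_shift[OF h y])
    also have "\<dots> < 0" using d(1) c by (cases "extend \<Gamma>2 (Psi h) y") auto
    finally have 2: "extend \<Gamma>2 (Psi (\<lambda>x. 1 * h x + (- c))) y < 0" by simp
    show ?thesis
      using 1 2 g A.extend_affine_at[OF h g x] by (intro exI[of _ "\<lambda>x. 1 * h x + (- c)"]) metis
  qed
  show ?thesis
  proof (cases "extend \<Gamma>2 (Psi h) y < ereal factor * extend \<Gamma>1 h x")
    case True thus ?thesis by (rule shift[OF h])
  next
    case False
    hence gt: "ereal factor * extend \<Gamma>1 h x < extend \<Gamma>2 (Psi h) y" using ne by simp
    have m: "PL UNIV \<Gamma>1 (\<lambda>x. (-1) * h x + 0)" using PL_uminus[OF h] by simp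
    have "extend \<Gamma>1 (\<lambda>x. - h x) x = - extend \<Gamma>1 h x"
      using A.extend_affine_at[OF h m x] by (simp add: ereal_minus_one_times)
    hence "extend \<Gamma>2 (Psi (\<lambda>x. - h x)) y < ereal factor * extend \<Gamma>1 (\<lambda>x. - h x) x"
      using gt extend_Psi_uminus[OF h y] by (simp add: ereal_minus_less_minus)
    thus ?thesis by (rule shift[OF PL_uminus[OF h]])
  qed
qed

text \<open>If no \<open>x\<close> works, every \<open>x\<close> has a function \<open>g\<close> that is positive at \<open>x\<close>
  while its image is negative at \<open>y\<close>. By compactness finitely many of the sets where these
  functions are positive cover the curve. The maximum of the functions is positive everywhere, so its
  image is nonnegative; but the image is the maximum of the images, which is negative at \<open>y\<close>.\<close>

lemma evaluation_point_exists:
  assumes y: "y \<in> points \<Gamma>2"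
  shows "\<exists>x\<in>points \<Gamma>1. \<forall>h. PL UNIV \<Gamma>1 h \<longrightarrow> extend \<Gamma>2 (Psi h) y = ereal factor * extend \<Gamma>1 h x"
proof (rule ccontr)
  assume "\<not> ?thesis"
  hence no: "\<exists>g. PL UNIV \<Gamma>1 g \<and> 0 < extend \<Gamma>1 g x \<and> extend \<Gamma>2 (Psi g) y < 0" if "x \<in> points \<Gamma>1" for x
    using separating_sign[OF _ that y] that by metis
  define pos where "pos g = {x \<in> points \<Gamma>1. 0 < extend \<Gamma>1 g x}" for g
  define G where "G = {g. PL UNIV \<Gamma>1 g \<and> extend \<Gamma>2 (Psi g) y < 0}"
  have "\<forall>U\<in>pos ` G. openin (topo \<Gamma>1) U"
    unfolding pos_def G_def using A.openin_superlevel(1)[OF A.extend_continuous] by auto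
  moreover have "points \<Gamma>1 \<subseteq> \<Union> (pos ` G)" using no by (auto simp: pos_def G_def)
  ultimately obtain \<F> where \<F>: "finite \<F>" "\<F> \<subseteq> pos ` G" "points \<Gamma>1 \<subseteq> \<Union> \<F>"
    using A.compact_curve unfolding compact_space_alt by metis
  then obtain H where H: "finite H" "H \<subseteq> G" "\<F> = pos ` H" using finite_subset_image by metis
  have "\<exists>g\<in>G. \<forall>x\<in>\<Union> (pos ` H). 0 < extend \<Gamma>1 g x"
    using H(1,2)
  proof (induction H rule: finite_induct)
    case empty
    have "Psi (\<lambda>x. - 1) x = - factor" if "x \<in> finite_points \<Gamma>2" for x using Psi_const[OF that] by simp
    hence "extend \<Gamma>2 (Psi (\<lambda>x. - 1)) = extend \<Gamma>2 (\<lambda>x. - factor)" by (rule extend_cong)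
    hence "(\<lambda>x. - 1) \<in> G" using y factor_pos PL_const by (simp add: G_def B.extend_const)
    thus ?case by auto
  next
    case (insert k H)
    then obtain g where g: "g \<in> G" "\<forall>x\<in>\<Union> (pos ` H). 0 < extend \<Gamma>1 g x" by auto
    have PL: "PL UNIV \<Gamma>1 g" "PL UNIV \<Gamma>1 k" using g insert by (auto simp: G_def)
    have "extend \<Gamma>2 (Psi (\<lambda>x. max (g x) (k x))) = extend \<Gamma>2 (\<lambda>x. max (Psi g x) (Psi k x))"
      by (rule extend_cong) (rule Psi_max[OF PL])
    hence "extend \<Gamma>2 (Psi (\<lambda>x. max (g x) (k x))) y < 0"
      using g insert B.extend_max_at[OF Psi_PL Psi_PL y, OF PL] by (simp add: G_def)
    hence "(\<lambda>x. max (g x) (k x)) \<in> G" using PL_max[OF PL] by (simp add: G_def)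
    moreover have "0 < extend \<Gamma>1 (\<lambda>x. max (g x) (k x)) x" if "x \<in> \<Union> (pos ` insert k H)" for x
    proof -
      have "x \<in> points \<Gamma>1" "0 < extend \<Gamma>1 g x \<or> 0 < extend \<Gamma>1 k x"
        using that g(2) by (auto simp: pos_def)
      thus ?thesis using A.extend_max_at[OF PL] by (simp add: less_max_iff_disj)
    qed
    ultimately show ?case by blast
  qed
  then obtain g where g: "PL UNIV \<Gamma>1 g" "extend \<Gamma>2 (Psi g) y < 0" "\<And>x. x \<in> points \<Gamma>1 \<Longrightarrow> 0 < extend \<Gamma>1 g x"
    using \<F>(3) H(3) by (auto simp: G_def)
  have "0 \<le> g x" if "x \<in> finite_points \<Gamma>1" for x
    using g(3)[of x] A.extend_finite[OF g(1) that] that A.finite_subset_points by auto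
  hence "max (Psi g x) 0 = Psi g x" if "x \<in> finite_points \<Gamma>2" for x
    using Psi_mono[OF PL_const g(1) that, of 0] Psi_zero[OF that] by simp
  hence "extend \<Gamma>2 (\<lambda>x. max (Psi g x) 0) = extend \<Gamma>2 (Psi g)" by (rule extend_cong)
  hence "extend \<Gamma>2 (Psi g) y = max (extend \<Gamma>2 (Psi g) y) 0"
    using B.extend_max_at[OF Psi_PL[OF g(1)] PL_const[of _ 0] y] y by (simp add: B.extend_const zero_ereal_def)
  thus False using g(2) by (simp add: max_def split: if_splits)
qed

definition evaluation_point :: "'a \<Rightarrow> 'a" where
  "evaluation_point y = (SOME x. x \<in> points \<Gamma>1 \<and>
     (\<forall>h. PL UNIV \<Gamma>1 h \<longrightarrow> extend \<Gamma>2 (Psi h) y = ereal factor * extend \<Gamma>1 h x))"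

lemma
  assumes "y \<in> points \<Gamma>2"
  shows evaluation_point_in: "evaluation_point y \<in> points \<Gamma>1"
    and evaluation_point: "PL UNIV \<Gamma>1 h \<Longrightarrow> extend \<Gamma>2 (Psi h) y = ereal factor * extend \<Gamma>1 h (evaluation_point y)"
  using someI_ex[of "\<lambda>x. x \<in> points \<Gamma>1 \<and>
     (\<forall>h. PL UNIV \<Gamma>1 h \<longrightarrow> extend \<Gamma>2 (Psi h) y = ereal factor * extend \<Gamma>1 h x)"]
    evaluation_point_exists[OF assms] unfolding evaluation_point_def by blast+

text \<open>At a point at infinity, the distance from a finite point is infinite; its image is finite at
  \<open>y\<close>.\<close>

lemma evaluation_point_finite:
  assumes y: "y \<in> finite_points \<Gamma>2" shows "evaluation_point y \<in> finite_points \<Gamma>1"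
proof (rule ccontr)
  assume inf: "evaluation_point y \<notin> finite_points \<Gamma>1"
  have yp: "y \<in> points \<Gamma>2" using y B.finite_subset_points by blast
  obtain z where z: "z \<in> finite_points \<Gamma>1" using A.finite_points_nonempty by blast
  note PL = PL_UNIV[OF A.rdist_PL[OF z]]
  have "ereal (Psi (A.rdist z) y) = ereal factor * \<infinity>"
    using evaluation_point[OF yp PL] A.extend_rdist_infinity[OF z evaluation_point_in[OF yp] inf]
      B.extend_finite[OF Psi_PL[OF PL] y] by simp
  thus False using factor_pos by simp
qed

lemma evaluation_point_real:
  assumes y: "y \<in> finite_points \<Gamma>2" and h: "PL UNIV \<Gamma>1 h"
  shows "Psi h y = factor * h (evaluation_point y)"
  using evaluation_point[OF _ h, of y] y B.finite_subset_points A.extend_finite[OF h evaluation_point_finite[OF y]]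
    B.extend_finite[OF Psi_PL[OF h] y] by auto

lemma extend_eq_imp_eq:
  assumes "x \<in> points \<Gamma>1" "x' \<in> points \<Gamma>1" "\<And>h. PL UNIV \<Gamma>1 h \<Longrightarrow> extend \<Gamma>1 h x = extend \<Gamma>1 h x'"
  shows "x = x'"
  using A.points_separated[OF assms(1,2)] assms(3) by (metis not_le)

end

context rat_iso
begin

definition psi_inverse :: "('a \<Rightarrow> ereal) \<Rightarrow> 'a \<Rightarrow> ereal" where
  "psi_inverse = restrict (inv_into (carrier (Rat \<Gamma>1)) \<psi>) (carrier (Rat \<Gamma>2))"

lemma inverse_rat_iso: "rat_iso \<Gamma>2 \<Gamma>1 psi_inverse"
  by unfold_locales (simp add: psi_inverse_def semiring_isos_inverse[OF iso A.Rat_ops_closed B.Rat_ops_closed])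

lemma psi_inverse_left: "f \<in> carrier (Rat \<Gamma>1) \<Longrightarrow> psi_inverse (\<psi> f) = f"
  using semiring_isosD(4,5)[OF iso] by (simp add: psi_inverse_def bij_betw_def)

lemma psi_inverse_right: "f \<in> carrier (Rat \<Gamma>2) \<Longrightarrow> \<psi> (psi_inverse f) = f"
  using semiring_isosD(4)[OF iso] by (simp add: psi_inverse_def bij_betw_inv_into_right)

lemma Psi_surj:
  assumes k: "PL UNIV \<Gamma>2 k"
  obtains h where "PL UNIV \<Gamma>1 h" "\<And>y. y \<in> finite_points \<Gamma>2 \<Longrightarrow> Psi h y = k y"
proof -
  interpret I: rat_iso \<Gamma>2 \<Gamma>1 psi_inverse by (rule inverse_rat_iso)
  have "extend \<Gamma>2 (Psi (I.Psi k)) = extend \<Gamma>2 k"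
    using extend_Psi[OF I.Psi_PL[OF k]] I.extend_Psi[OF k] psi_inverse_right[OF I.extend_carrier[OF k]] by simp
  hence "\<forall>y\<in>finite_points \<Gamma>2. Psi (I.Psi k) y = k y"
    using B.extend_eq_iff[OF Psi_PL[OF I.Psi_PL[OF k]] k] by blast
  thus ?thesis using that[OF I.Psi_PL[OF k]] by blast
qed

text \<open>By surjectivity of \<open>\<psi>\<close> a divisibility relation between images comes from one between
  their preimages, at the evaluation points.\<close>

lemma Psi_unit_slopes:
  assumes h: "PL {-1, 0, 1} \<Gamma>1 h"
  shows "PL {-1, 0, 1} \<Gamma>2 (Psi h)"
proof (rule B.not_divisible_imp_unit_slopes[OF Psi_PL[OF PL_UNIV[OF h]]], rule notI)
  assume "B.somewhere_divisible (Psi h)"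
  then obtain S n k c where S: "S \<subseteq> finite_points \<Gamma>2" "infinite (Psi h ` S)" "(2::nat) \<le> n"
    and k: "PL UNIV \<Gamma>2 k" "\<And>x. x \<in> S \<Longrightarrow> Psi h x = of_nat n * k x + c"
    unfolding B.somewhere_divisible_def by blast
  obtain k' where k': "PL UNIV \<Gamma>1 k'" "\<And>y. y \<in> finite_points \<Gamma>2 \<Longrightarrow> Psi k' y = k y" by (rule Psi_surj[OF k(1)], rule that)
  note pos = factor_pos
  have eval: "Psi h y = factor * h (evaluation_point y)" "k y = factor * k' (evaluation_point y)" if "y \<in> S" for y
    using that S(1) evaluation_point_real[OF _ PL_UNIV[OF h]] evaluation_point_real[OF _ k'(1)] k'(2) by auto
  have "A.somewhere_divisible h"
    unfolding A.somewhere_divisible_def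
  proof (intro exI[of _ "evaluation_point ` S"] exI[of _ n] exI[of _ k'] exI[of _ "c / factor"] conjI ballI S(3) k'(1))
    show "evaluation_point ` S \<subseteq> finite_points \<Gamma>1" using S(1) evaluation_point_finite by blast
    have "Psi h ` S = (\<lambda>v. factor * v) ` (h ` evaluation_point ` S)"
      unfolding image_image by (rule image_cong[OF refl]) (rule eval(1))
    thus "infinite (h ` evaluation_point ` S)" using S(2) by (metis finite_imageI)
    fix x assume "x \<in> evaluation_point ` S"
    then obtain y where y: "y \<in> S" "x = evaluation_point y" by blast
    have "factor * h x = factor * (of_nat n * k' x + c / factor)"
      using k(2)[OF y(1)] eval[OF y(1)] y(2) pos by (simp add: algebra_simps)
    thus "h x = of_nat n * k' x + c / factor" using pos by simp
  qed
  thus False using A.unit_slopes_imp_not_divisible[OF h] by contradiction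
qed

text \<open>The image of the distance from the evaluation point of \<open>u\<close> has slopes in
  \<open>{-1, 0, 1}\<close>, so between \<open>u\<close> and \<open>v\<close> it does not grow by more than the length of
  a path.\<close>

lemma evaluation_point_contracts:
  assumes u: "u \<in> finite_points \<Gamma>2" and v: "v \<in> finite_points \<Gamma>2"
  shows "factor * A.rdist (evaluation_point u) (evaluation_point v) \<le> B.rdist u v"
proof (rule B.rdist_greatest[OF u v])
  fix d assume d: "path_length \<Gamma>2 u v d"
  let ?x = "evaluation_point u"
  have x: "?x \<in> finite_points \<Gamma>1" by (rule evaluation_point_finite[OF u])
  note PL = A.rdist_PL[OF x]
  have unit: "PL {-1, 0, 1} \<Gamma>2 (Psi (A.rdist ?x))" by (rule Psi_unit_slopes[OF PL_mono[OF PL]]) auto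
  have "\<bar>Psi (A.rdist ?x) v - Psi (A.rdist ?x) u\<bar> \<le> of_int 1 * d"
    by (rule B.PL_Lipschitz[OF unit _ d]) auto
  thus "factor * A.rdist ?x (evaluation_point v) \<le> d"
    using evaluation_point_real[OF u PL_UNIV[OF PL]] evaluation_point_real[OF v PL_UNIV[OF PL]]
      A.rdist_self[OF x] by simp
qed

text \<open>The expansive map \<open>\<phi>\<close> assigns evaluation points with respect to the inverse of \<open>\<psi>\<close>;
  it is inverse to the assignment \<open>\<theta>\<close> of evaluation points with respect to \<open>\<psi>\<close> because
  functions separate points. Both contract the distance up to the factors \<open>r\<close> and \<open>1 / r\<close>,
  so neither inequality is strict.\<close>

lemma induced_by_expansive_map:
  obtains r \<phi> where "0 < r" "\<phi> \<in> extensional (points \<Gamma>1)" "expansive_map r \<Gamma>1 \<Gamma>2 \<phi>"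
    "\<And>f x. f \<in> carrier (Rat \<Gamma>1) \<Longrightarrow> x \<in> points \<Gamma>1 \<Longrightarrow> \<psi> f (\<phi> x) = ereal r * f x"
proof -
  interpret I: rat_iso \<Gamma>2 \<Gamma>1 psi_inverse by (rule inverse_rat_iso)
  let ?r = "factor" and ?\<theta> = "evaluation_point" and ?\<phi> = "I.evaluation_point"
  note pos = factor_pos
  have left_inverse: "extend \<Gamma>1 (I.Psi (Psi h)) = extend \<Gamma>1 h" if "PL UNIV \<Gamma>1 h" for h
    using I.extend_Psi[OF Psi_PL[OF that]] extend_Psi[OF that] psi_inverse_left[OF extend_carrier[OF that]] by simp
  have right_inverse: "extend \<Gamma>2 (Psi (I.Psi k)) = extend \<Gamma>2 k" if "PL UNIV \<Gamma>2 k" for k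
    using extend_Psi[OF I.Psi_PL[OF that]] I.extend_Psi[OF that] psi_inverse_right[OF I.extend_carrier[OF that]] by simp
  have r': "I.factor = 1 / ?r"
  proof -
    obtain x where x: "x \<in> finite_points \<Gamma>1" using A.finite_points_nonempty by blast
    have "I.Psi (Psi (\<lambda>x. 1)) = I.Psi (\<lambda>x. ?r)" by (rule I.Psi_cong) (simp add: Psi_const)
    moreover have "I.Psi (Psi (\<lambda>x. 1)) x = 1"
      using left_inverse[OF PL_const] A.extend_eq_iff[OF I.Psi_PL[OF Psi_PL[OF PL_const]] PL_const] x by blast
    ultimately have "I.factor * ?r = 1" using I.Psi_const[OF x] by simp
    thus ?thesis using pos by (simp add: field_simps)
  qed
  have \<theta>\<phi>: "?\<theta> (?\<phi> x) = x" if x: "x \<in> points \<Gamma>1" for x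
  proof (rule extend_eq_imp_eq)
    fix h assume h: "PL UNIV \<Gamma>1 h"
    have "extend \<Gamma>1 h x = ereal (1 / ?r) * extend \<Gamma>2 (Psi h) (?\<phi> x)"
      using I.evaluation_point[OF x Psi_PL[OF h]] left_inverse[OF h] r' by simp
    also have "\<dots> = ereal (1 / ?r) * (ereal ?r * extend \<Gamma>1 h (?\<theta> (?\<phi> x)))"
      using evaluation_point[OF I.evaluation_point_in[OF x] h] by simp
    finally show "extend \<Gamma>1 h (?\<theta> (?\<phi> x)) = extend \<Gamma>1 h x" using pos by (simp add: ereal_times_inverse)
  qed (use x I.evaluation_point_in evaluation_point_in in auto)
  have \<phi>\<theta>: "?\<phi> (?\<theta> y) = y" if y: "y \<in> points \<Gamma>2" for y
  proof (rule I.extend_eq_imp_eq)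
    fix k assume k: "PL UNIV \<Gamma>2 k"
    have "extend \<Gamma>2 k y = ereal ?r * extend \<Gamma>1 (I.Psi k) (?\<theta> y)"
      using evaluation_point[OF y I.Psi_PL[OF k]] right_inverse[OF k] by simp
    also have "\<dots> = ereal ?r * (ereal (1 / ?r) * extend \<Gamma>2 k (?\<phi> (?\<theta> y)))"
      using I.evaluation_point[OF evaluation_point_in[OF y] k] r' by simp
    finally show "extend \<Gamma>2 k (?\<phi> (?\<theta> y)) = extend \<Gamma>2 k y" using pos by (simp add: ereal_times_inverse)
  qed (use y I.evaluation_point_in evaluation_point_in in auto)
  have eval: "extend \<Gamma>2 (Psi h) (?\<phi> x) = ereal ?r * extend \<Gamma>1 h x" if "PL UNIV \<Gamma>1 h" "x \<in> points \<Gamma>1" for h x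
    using evaluation_point[OF I.evaluation_point_in[OF that(2)] that(1)] \<theta>\<phi>[OF that(2)] by simp
  define \<phi> where "\<phi> = restrict ?\<phi> (points \<Gamma>1)"
  have \<phi>: "\<phi> x = ?\<phi> x" if "x \<in> points \<Gamma>1" for x using that by (simp add: \<phi>_def)
  have fin: "x \<in> points \<Gamma>1" if "x \<in> finite_points \<Gamma>1" for x using that A.finite_subset_points by blast
  have cont: "continuous_map (topo \<Gamma>1) (topo \<Gamma>2) \<phi>"
    unfolding continuous_map_def
  proof (intro conjI allI impI)
    show "\<phi> \<in> points \<Gamma>1 \<rightarrow> points \<Gamma>2" using I.evaluation_point_in \<phi> by auto
    fix U assume U: "openin (topo \<Gamma>2) U"
    \<comment> \<open>The topology is generated by the superlevel sets of functions, whose preimages under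
      \<open>\<phi>\<close> are superlevel sets of the images of these functions.\<close>
    show "openin (topo \<Gamma>1) {x \<in> points \<Gamma>1. \<phi> x \<in> U}"
    proof (subst openin_subopen, intro ballI)
      fix x assume x: "x \<in> {x \<in> points \<Gamma>1. \<phi> x \<in> U}"
      hence xU: "x \<in> points \<Gamma>1" "?\<phi> x \<in> U" using \<phi> by auto
      obtain k c where k: "PL UNIV \<Gamma>2 k" "ereal c < extend \<Gamma>2 k (?\<phi> x)"
        "\<And>y. y \<in> points \<Gamma>2 \<Longrightarrow> ereal c < extend \<Gamma>2 k y \<Longrightarrow> y \<in> U"
        using B.separating_function[OF U xU(2)] by blast
      have pull: "extend \<Gamma>1 (I.Psi k) z = ereal (1 / ?r) * extend \<Gamma>2 k (?\<phi> z)" if "z \<in> points \<Gamma>1" for z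
        using I.evaluation_point[OF that k(1)] r' by simp
      have gt: "ereal (c / ?r) < extend \<Gamma>1 (I.Psi k) z \<longleftrightarrow> ereal c < extend \<Gamma>2 k (?\<phi> z)" if "z \<in> points \<Gamma>1" for z
        unfolding pull[OF that] using pos
        by (cases "extend \<Gamma>2 k (?\<phi> z)") (auto simp: field_simps)
      show "\<exists>T. openin (topo \<Gamma>1) T \<and> x \<in> T \<and> T \<subseteq> {x \<in> points \<Gamma>1. \<phi> x \<in> U}"
      proof (intro exI[of _ "{z \<in> points \<Gamma>1. ereal (c / ?r) < extend \<Gamma>1 (I.Psi k) z}"] conjI)
        show "openin (topo \<Gamma>1) {z \<in> points \<Gamma>1. ereal (c / ?r) < extend \<Gamma>1 (I.Psi k) z}"
          by (rule A.openin_superlevel(1)[OF A.extend_continuous[OF I.Psi_PL[OF k(1)]]])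
        show "x \<in> {z \<in> points \<Gamma>1. ereal (c / ?r) < extend \<Gamma>1 (I.Psi k) z}" using gt xU k by blast
        show "{z \<in> points \<Gamma>1. ereal (c / ?r) < extend \<Gamma>1 (I.Psi k) z} \<subseteq> {x \<in> points \<Gamma>1. \<phi> x \<in> U}"
          using gt k(3) I.evaluation_point_in \<phi> by auto
      qed
    qed
  qed
  have exp: "expansive_map ?r \<Gamma>1 \<Gamma>2 \<phi>"
    unfolding expansive_map_def
  proof (intro conjI ballI cont)
    show "bij_betw \<phi> (points \<Gamma>1) (points \<Gamma>2)"
      by (rule bij_betw_byWitness[of _ ?\<theta>]) (use \<theta>\<phi> \<phi>\<theta> \<phi> evaluation_point_in I.evaluation_point_in in auto)
    show "bij_betw \<phi> (finite_points \<Gamma>1) (finite_points \<Gamma>2)"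
      by (rule bij_betw_byWitness[of _ ?\<theta>])
         (use \<theta>\<phi> \<phi>\<theta> \<phi> fin B.finite_subset_points evaluation_point_finite I.evaluation_point_finite in auto)
    fix x y assume xy: "x \<in> finite_points \<Gamma>1" "y \<in> finite_points \<Gamma>1"
    have \<phi>xy: "?\<phi> x \<in> finite_points \<Gamma>2" "?\<phi> y \<in> finite_points \<Gamma>2" using xy I.evaluation_point_finite by auto
    have "?r * A.rdist x y \<le> B.rdist (?\<phi> x) (?\<phi> y)"
      using evaluation_point_contracts[OF \<phi>xy] \<theta>\<phi> xy fin by simp
    moreover have "B.rdist (?\<phi> x) (?\<phi> y) \<le> ?r * A.rdist x y"
      using I.evaluation_point_contracts[OF xy] r' pos by (simp add: field_simps)
    ultimately have "?r * A.rdist x y = B.rdist (?\<phi> x) (?\<phi> y)" by simp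
    thus "ereal ?r * curve_dist \<Gamma>1 x y = curve_dist \<Gamma>2 (\<phi> x) (\<phi> y)"
      using A.curve_dist_eq_rdist[OF xy] B.curve_dist_eq_rdist[OF \<phi>xy] \<phi> fin xy by simp
  qed
  show ?thesis
  proof (rule that[OF pos _ exp])
    show "\<phi> \<in> extensional (points \<Gamma>1)" by (simp add: \<phi>_def)
    fix f x assume f: "f \<in> carrier (Rat \<Gamma>1)" and x: "x \<in> points \<Gamma>1"
    from f have "f \<in> rational_functions \<Gamma>1" by (simp add: A.Rat_carrier)
    thus "\<psi> f (\<phi> x) = ereal ?r * f x"
    proof (cases rule: A.rational_function_cases)
      case 1
      hence "\<psi> f = (\<lambda>x\<in>points \<Gamma>2. - \<infinity>)" using semiring_isosD(2)[OF iso] by (simp add: A.Rat_zero B.Rat_zero)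
      thus ?thesis using 1 x \<phi> I.evaluation_point_in[OF x] pos by simp
    next
      case (2 h)
      thus ?thesis using eval[OF 2(1) x] extend_Psi[OF 2(1)] \<phi>[OF x] by simp
    qed
  qed
qed

end

section \<open>Expansive maps induce semiring isomorphisms\<close>

locale expansive = A: trop \<Gamma>1 + B: trop \<Gamma>2
  for \<Gamma>1 :: "('a, 'e) curve" and \<Gamma>2 :: "('a, 'e) curve" +
  fixes r :: real and \<phi> :: "'a \<Rightarrow> 'a"
  assumes factor_pos: "0 < r" and expansive: "expansive_map r \<Gamma>1 \<Gamma>2 \<phi>"
begin

definition inv_map :: "'a \<Rightarrow> 'a" where
  "inv_map = restrict (inv_into (points \<Gamma>1) \<phi>) (points \<Gamma>2)"

lemma continuous: "continuous_map (topo \<Gamma>1) (topo \<Gamma>2) \<phi>"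
  and bij: "bij_betw \<phi> (points \<Gamma>1) (points \<Gamma>2)"
  and bij_finite: "bij_betw \<phi> (finite_points \<Gamma>1) (finite_points \<Gamma>2)"
  using expansive unfolding expansive_map_def by auto

lemma in_points: "x \<in> points \<Gamma>1 \<Longrightarrow> \<phi> x \<in> points \<Gamma>2"
  and in_finite_points: "x \<in> finite_points \<Gamma>1 \<Longrightarrow> \<phi> x \<in> finite_points \<Gamma>2"
  using bij bij_finite by (auto simp: bij_betw_def)

lemma inverse_left: "x \<in> points \<Gamma>1 \<Longrightarrow> inv_map (\<phi> x) = x"
  and inverse_right: "y \<in> points \<Gamma>2 \<Longrightarrow> \<phi> (inv_map y) = y"
  and inverse_in_points: "y \<in> points \<Gamma>2 \<Longrightarrow> inv_map y \<in> points \<Gamma>1"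
  using bij in_points by (auto simp: inv_map_def bij_betw_inv_into_left bij_betw_inv_into_right)
    (metis bij_betw_def inv_into_into)

lemma inverse_in_finite_points:
  assumes "y \<in> finite_points \<Gamma>2" shows "inv_map y \<in> finite_points \<Gamma>1"
proof -
  obtain x where "x \<in> finite_points \<Gamma>1" "y = \<phi> x" using assms bij_finite by (auto simp: bij_betw_def)
  thus ?thesis using inverse_left A.finite_subset_points by auto
qed

lemma rdist_image:
  assumes "x \<in> finite_points \<Gamma>1" "y \<in> finite_points \<Gamma>1"
  shows "B.rdist (\<phi> x) (\<phi> y) = r * A.rdist x y"
proof -
  have "ereal r * curve_dist \<Gamma>1 x y = curve_dist \<Gamma>2 (\<phi> x) (\<phi> y)"
    using expansive assms unfolding expansive_map_def by blast
  thus ?thesis using assms by (simp add: A.curve_dist_eq_rdist B.curve_dist_eq_rdist in_finite_points)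
qed

lemma homeomorphic: "homeomorphic_map (topo \<Gamma>1) (topo \<Gamma>2) \<phi>"
  by (rule continuous_imp_homeomorphic_map[OF continuous A.compact_curve B.Hausdorff_curve])
     (use bij in \<open>auto simp: bij_betw_def\<close>)

lemma continuous_inverse: "continuous_map (topo \<Gamma>2) (topo \<Gamma>1) inv_map"
  unfolding continuous_map_def
proof (intro conjI allI impI)
  show "inv_map \<in> points \<Gamma>2 \<rightarrow> points \<Gamma>1" using inverse_in_points by auto
  fix U assume U: "openin (topo \<Gamma>1) U"
  have "{y \<in> points \<Gamma>2. inv_map y \<in> U} = \<phi> ` U"
    using openin_subset[OF U] inverse_left inverse_right in_points by force
  thus "openin (topo \<Gamma>2) {y \<in> points \<Gamma>2. inv_map y \<in> U}"
    using homeomorphic_imp_open_map[OF homeomorphic] U by (simp add: open_map_def)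
qed

lemma inverse_expansive_map: "expansive_map (1 / r) \<Gamma>2 \<Gamma>1 inv_map"
  unfolding expansive_map_def
proof (intro conjI ballI continuous_inverse)
  show "bij_betw inv_map (points \<Gamma>2) (points \<Gamma>1)"
    by (rule bij_betw_byWitness[of _ \<phi>]) (use inverse_left inverse_right in_points inverse_in_points in auto)
  show "bij_betw inv_map (finite_points \<Gamma>2) (finite_points \<Gamma>1)"
    by (rule bij_betw_byWitness[of _ \<phi>])
       (use inverse_left inverse_right in_finite_points inverse_in_finite_points
          A.finite_subset_points B.finite_subset_points in auto)
  fix u v assume uv: "u \<in> finite_points \<Gamma>2" "v \<in> finite_points \<Gamma>2"
  note i = inverse_in_finite_points[OF uv(1)] inverse_in_finite_points[OF uv(2)]
  have "B.rdist u v = r * A.rdist (inv_map u) (inv_map v)"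
    using rdist_image[OF i] inverse_right uv B.finite_subset_points by (simp add: subset_iff)
  thus "ereal (1 / r) * curve_dist \<Gamma>2 u v = curve_dist \<Gamma>1 (inv_map u) (inv_map v)"
    using uv i factor_pos by (simp add: A.curve_dist_eq_rdist B.curve_dist_eq_rdist)
qed

lemma inverse_expansive: "expansive \<Gamma>2 \<Gamma>1 (1 / r) inv_map"
  by unfold_locales (use factor_pos inverse_expansive_map in auto)

definition push :: "('a \<Rightarrow> ereal) \<Rightarrow> 'a \<Rightarrow> ereal" where
  "push f = (\<lambda>y\<in>points \<Gamma>2. ereal r * f (inv_map y))"

lemma continuous_push:
  assumes "PL UNIV \<Gamma>1 h"
  shows "continuous_map (topo \<Gamma>2) euclidean (\<lambda>y. ereal r * extend \<Gamma>1 h (inv_map y))"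
proof -
  have "continuous_map (topo \<Gamma>2) euclidean (\<lambda>y. extend \<Gamma>1 h (inv_map y))"
    using continuous_map_compose[OF continuous_inverse A.extend_continuous[OF assms]] by (simp add: comp_def)
  thus ?thesis unfolding B.continuous_map_curve_iff
    using continuous_on_compose2[OF continuous_on_affine_ereal[of UNIV r 0]] by auto
qed

text \<open>Both the topology and, up to the factor \<open>r\<close>, the distance are preserved by \<open>\<phi>\<close>, and
  \<open>r h\<close> differs by \<open>r\<close> times the multiples of the distance by which \<open>h\<close> differs.\<close>

lemma push_PL:
  assumes h: "PL UNIV \<Gamma>1 h"
  shows "PL UNIV \<Gamma>2 (\<lambda>y. r * h (inv_map y))"
proof (rule B.locally_integral_imp_PL[OF continuous_push[OF h]])
  show "ereal r * extend \<Gamma>1 h (inv_map y) = ereal (r * h (inv_map y))" if "y \<in> finite_points \<Gamma>2" for y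
    using A.extend_finite[OF h inverse_in_finite_points[OF that]] by simp
  show "B.locally_integral (\<lambda>y. r * h (inv_map y))"
    unfolding B.locally_integral_def
  proof
    fix y assume y: "y \<in> points \<Gamma>2"
    from A.PL_imp_locally_integral[OF h, unfolded A.locally_integral_def, THEN bspec, OF inverse_in_points[OF y]]
    obtain U z where U: "openin (topo \<Gamma>1) U" "inv_map y \<in> U" and z: "z \<in> finite_points \<Gamma>1"
      and mult: "\<forall>x\<in>U \<inter> finite_points \<Gamma>1. \<exists>m::int. h x = h z + of_int m * A.rdist z x"
      by (elim exE conjE) (rule that)
    have zp: "z \<in> points \<Gamma>1" using z A.finite_subset_points by blast
    show "\<exists>U z. openin (topo \<Gamma>2) U \<and> y \<in> U \<and> z \<in> finite_points \<Gamma>2 \<and>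
      (\<forall>y'\<in>U \<inter> finite_points \<Gamma>2. \<exists>m::int. r * h (inv_map y') = r * h (inv_map z) + of_int m * B.rdist z y')"
    proof (intro exI[of _ "\<phi> ` U"] exI[of _ "\<phi> z"] conjI ballI)
      show "openin (topo \<Gamma>2) (\<phi> ` U)"
        using homeomorphic_imp_open_map[OF homeomorphic] U by (simp add: open_map_def)
      show "y \<in> \<phi> ` U" using U(2) inverse_right[OF y] by force
      show "\<phi> z \<in> finite_points \<Gamma>2" by (rule in_finite_points[OF z])
      fix y' assume y': "y' \<in> \<phi> ` U \<inter> finite_points \<Gamma>2"
      then obtain x where x: "x \<in> U" "y' = \<phi> x" by blast
      have xi: "inv_map y' = x" using inverse_left openin_subset[OF U(1)] x by blast
      hence xf: "x \<in> finite_points \<Gamma>1" using inverse_in_finite_points[of y'] y' by simp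
      obtain m :: int where "h x = h z + of_int m * A.rdist z x" using mult x xf by blast
      hence "r * h x = r * h z + of_int m * (r * A.rdist z x)" by (simp add: algebra_simps)
      hence "r * h (inv_map y') = r * h (inv_map (\<phi> z)) + of_int m * B.rdist (\<phi> z) y'"
        using xi x(2) inverse_left[OF zp] rdist_image[OF z xf] by simp
      thus "\<exists>m::int. r * h (inv_map y') = r * h (inv_map (\<phi> z)) + of_int m * B.rdist (\<phi> z) y'" by blast
    qed
  qed
qed

lemma push_extend:
  assumes h: "PL UNIV \<Gamma>1 h"
  shows "push (extend \<Gamma>1 h) = extend \<Gamma>2 (\<lambda>y. r * h (inv_map y))"
proof (rule B.extend_eqI[symmetric])
  show "continuous_map (topo \<Gamma>2) euclidean (push (extend \<Gamma>1 h))"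
    by (rule continuous_map_eq[OF continuous_push[OF h]]) (simp add: push_def)
  show "push (extend \<Gamma>1 h) y = ereal (r * h (inv_map y))" if "y \<in> finite_points \<Gamma>2" for y
    using that B.finite_subset_points A.extend_finite[OF h inverse_in_finite_points[OF that]] by (auto simp: push_def)
qed (simp add: push_def)

lemma push_zero: "push \<zero>\<^bsub>Rat \<Gamma>1\<^esub> = \<zero>\<^bsub>Rat \<Gamma>2\<^esub>"
  unfolding push_def A.Rat_zero B.Rat_zero by (rule restrict_ext) (use inverse_in_points factor_pos in simp)

lemma push_closed:
  assumes "f \<in> carrier (Rat \<Gamma>1)" shows "push f \<in> carrier (Rat \<Gamma>2)"
  using assms unfolding A.Rat_carrier
proof (cases rule: A.rational_function_cases)
  case 1
  thus ?thesis using push_zero B.Rat_zero_closed by (simp add: A.Rat_zero)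
next
  case (2 h)
  thus ?thesis by (simp add: push_extend B.Rat_carrier B.extend_in_rational_functions push_PL)
qed

lemma push_ops:
  assumes f: "f \<in> carrier (Rat \<Gamma>1)" and g: "g \<in> carrier (Rat \<Gamma>1)"
  shows "push (f \<otimes>\<^bsub>Rat \<Gamma>1\<^esub> g) = push f \<otimes>\<^bsub>Rat \<Gamma>2\<^esub> push g \<and>
         push (f \<oplus>\<^bsub>Rat \<Gamma>1\<^esub> g) = push f \<oplus>\<^bsub>Rat \<Gamma>2\<^esub> push g"
proof -
  have R: "f \<in> rational_functions \<Gamma>1" "g \<in> rational_functions \<Gamma>1" 
    "push f \<in> rational_functions \<Gamma>2" "push g \<in> rational_functions \<Gamma>2"
    using f g push_closed by (simp_all add: A.Rat_carrier B.Rat_carrier)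
  from R(1) show ?thesis
  proof (cases rule: A.rational_function_cases)
    case 1
    hence "f = \<zero>\<^bsub>Rat \<Gamma>1\<^esub>" by (simp add: A.Rat_zero)
    thus ?thesis using push_zero A.Rat_zero_ops[OF R(2)] B.Rat_zero_ops[OF R(4)] by simp
  next
    case h: (2 h)
    from R(2) show ?thesis
    proof (cases rule: A.rational_function_cases)
      case 1
      hence "g = \<zero>\<^bsub>Rat \<Gamma>1\<^esub>" by (simp add: A.Rat_zero)
      thus ?thesis using push_zero A.Rat_zero_ops[OF R(1)] B.Rat_zero_ops[OF R(3)] by simp
    next
      case k: (2 k)
      have "max (r * a) (r * b) = r * max a b" for a b
        using factor_pos by (simp add: max_mult_distrib_left)
      thus ?thesis using h k
        by (simp add: A.Rat_mult A.Rat_add push_extend B.Rat_mult B.Rat_add push_PL PL_add PL_max distrib_left)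
    qed
  qed
qed

text \<open>The inverse of \<open>\<phi>\<close> is \<open>(1 / r)\<close>-expansive, and pushing forward along it is inverse to
  \<open>push\<close>.\<close>

lemma push_semiring_iso: "restrict push (carrier (Rat \<Gamma>1)) \<in> semiring_isos (Rat \<Gamma>1) (Rat \<Gamma>2)"
proof (rule semiring_isosI)
  interpret I: expansive \<Gamma>2 \<Gamma>1 "1 / r" inv_map by (rule inverse_expansive)
  have Iinv: "I.inv_map x = \<phi> x" if "x \<in> points \<Gamma>1" for x
    using I.inverse_left[OF in_points[OF that]] inverse_left[OF that] by simp
  have ext: "f \<in> extensional (points \<Gamma>)" if "f \<in> carrier (Rat \<Gamma>)" "trop \<Gamma>" for f and \<Gamma> :: "('a, 'e) curve"
    using trop.rational_function_regular(1)[OF that(2)] that(1) by (simp add: trop.Rat_carrier[OF that(2)])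
  have 1: "I.push (push f) = f" if "f \<in> carrier (Rat \<Gamma>1)" for f
    by (rule extensionalityI[of _ "points \<Gamma>1"])
       (use ext[OF that A.trop_axioms] Iinv in_points inverse_left factor_pos
         in \<open>auto simp: I.push_def push_def ereal_times_inverse\<close>)
  have 2: "push (I.push f) = f" if "f \<in> carrier (Rat \<Gamma>2)" for f
    by (rule extensionalityI[of _ "points \<Gamma>2"])
       (use ext[OF that B.trop_axioms] Iinv inverse_in_points inverse_right factor_pos
         in \<open>auto simp: I.push_def push_def ereal_times_inverse\<close>)
  have "bij_betw push (carrier (Rat \<Gamma>1)) (carrier (Rat \<Gamma>2))"
    by (rule bij_betw_byWitness[of _ I.push]) (use 1 2 push_closed I.push_closed in auto)
  thus "bij_betw (restrict push (carrier (Rat \<Gamma>1))) (carrier (Rat \<Gamma>1)) (carrier (Rat \<Gamma>2))"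
    by (simp cong: bij_betw_cong)
  show "restrict push (carrier (Rat \<Gamma>1)) \<zero>\<^bsub>Rat \<Gamma>1\<^esub> = \<zero>\<^bsub>Rat \<Gamma>2\<^esub>"
    using A.Rat_zero_closed push_zero by simp
  show "restrict push (carrier (Rat \<Gamma>1)) \<one>\<^bsub>Rat \<Gamma>1\<^esub> = \<one>\<^bsub>Rat \<Gamma>2\<^esub>"
    using A.Rat_one_closed push_extend[OF PL_const, of 0] by (simp add: A.Rat_one B.Rat_one)
qed (use push_ops A.Rat_closed in auto)

lemma push_image: "x \<in> points \<Gamma>1 \<Longrightarrow> push f (\<phi> x) = ereal r * f x"
  by (simp add: push_def in_points inverse_left)

end

section \<open>The two groupoids\<close>

lemma tropical_trop: "tropical_curve \<Gamma> \<longleftrightarrow> trop \<Gamma>"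
  by (simp add: trop_def)

lemma semifield_groupoid: "is_groupoid (semifield_groupoid :: (('a, 'e) curve, _) cat)"
proof -
  let ?C = "semifield_groupoid :: (('a, 'e) curve, _) cat"
  have ob: "X \<in> Ob ?C \<longleftrightarrow> tropical_curve X" for X by (simp add: semifield_groupoid_def)
  have hom: "Hom ?C X Y = semiring_isos (Rat X) (Rat Y)" for X Y by (simp add: semifield_groupoid_def)
  have comp: "Comp ?C X Y Z g f = compose (carrier (Rat X)) g f" for X Y Z g f
    by (simp add: semifield_groupoid_def)
  have ident: "Ident ?C X = restrict (\<lambda>f. f) (carrier (Rat X))" for X by (simp add: semifield_groupoid_def)
  have closed: "ops_closed (Rat X)" if "tropical_curve X" for X :: "('a, 'e) curve"
    using trop.Rat_ops_closed that by (simp add: tropical_trop)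
  have maps: "f \<in> carrier (Rat X) \<rightarrow> carrier (Rat Y)" if "f \<in> semiring_isos (Rat X) (Rat Y)"
    for f and X Y :: "('a, 'e) curve" using semiring_isosD(5)[OF that] by auto
  have "is_category ?C"
    unfolding is_category_def hom comp ident
  proof (intro conjI ballI)
    fix X Y f assume f: "f \<in> semiring_isos (Rat X) (Rat Y)"
    show "compose (carrier (Rat X)) f (restrict (\<lambda>f. f) (carrier (Rat X))) = f"
      by (rule extensionalityI[of _ "carrier (Rat X)"]) (use semiring_isosD(1)[OF f] in \<open>auto simp: compose_eq\<close>)
    show "compose (carrier (Rat X)) (restrict (\<lambda>f. f) (carrier (Rat Y))) f = f"
      by (rule extensionalityI[of _ "carrier (Rat X)"])
         (use semiring_isosD(1,5)[OF f] in \<open>auto simp: compose_eq\<close>)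
  next
    fix W X Y Z :: "('a, 'e) curve" and f g h :: "('a \<Rightarrow> ereal) \<Rightarrow> 'a \<Rightarrow> ereal"
    assume "f \<in> semiring_isos (Rat W) (Rat X)"
    thus "compose (carrier (Rat W)) h (compose (carrier (Rat W)) g f) =
          compose (carrier (Rat W)) (compose (carrier (Rat X)) h g) f"
      using compose_assoc[OF maps] by blast
  next
    fix X Y Z :: "('a, 'e) curve" and f g :: "('a \<Rightarrow> ereal) \<Rightarrow> 'a \<Rightarrow> ereal"
    assume "X \<in> Ob ?C" "f \<in> semiring_isos (Rat X) (Rat Y)" "g \<in> semiring_isos (Rat Y) (Rat Z)"
    thus "compose (carrier (Rat X)) g f \<in> semiring_isos (Rat X) (Rat Z)"
      using closed ob semiring_isos_compose by blast
  qed (use closed ob semiring_isos_identity in blast)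
  moreover have "\<exists>g\<in>semiring_isos (Rat Y) (Rat X).
      compose (carrier (Rat X)) g f = restrict (\<lambda>f. f) (carrier (Rat X)) \<and>
      compose (carrier (Rat Y)) f g = restrict (\<lambda>f. f) (carrier (Rat Y))"
    if XY: "tropical_curve X" "tropical_curve Y" and f: "f \<in> semiring_isos (Rat X) (Rat Y)"
    for X Y :: "('a, 'e) curve" and f
  proof (intro bexI conjI)
    let ?g = "restrict (inv_into (carrier (Rat X)) f) (carrier (Rat Y))"
    note bij = semiring_isosD(4)[OF f]
    show "?g \<in> semiring_isos (Rat Y) (Rat X)" by (rule semiring_isos_inverse[OF f closed closed]) (use XY in auto)
    show "compose (carrier (Rat X)) ?g f = restrict (\<lambda>f. f) (carrier (Rat X))"
      by (rule extensionalityI[of _ "carrier (Rat X)"])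
         (use bij semiring_isosD(5)[OF f] in \<open>auto simp: compose_eq bij_betw_inv_into_left\<close>)
    show "compose (carrier (Rat Y)) f ?g = restrict (\<lambda>f. f) (carrier (Rat Y))"
      by (rule extensionalityI[of _ "carrier (Rat Y)"])
         (use bij in \<open>auto simp: compose_eq bij_betw_inv_into_right\<close>)
  qed
  ultimately show ?thesis unfolding is_groupoid_def by (simp add: ob hom comp ident)
qed

lemma expansive_map_identity: "expansive_map 1 \<Gamma> \<Gamma> (restrict (\<lambda>x. x) (points \<Gamma>))"
  unfolding expansive_map_def
proof (intro conjI ballI)
  show "continuous_map (topo \<Gamma>) (topo \<Gamma>) (restrict (\<lambda>x. x) (points \<Gamma>))"
    by (rule continuous_map_eq[of _ _ "\<lambda>x. x"]) auto
qed (auto simp: finite_points_def bij_betw_def inj_on_def)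

lemma expansive_map_compose:
  assumes f: "expansive_map r X Y f" and g: "expansive_map s Y Z g"
  shows "expansive_map (s * r) X Z (compose (points X) g f)"
proof -
  have sub: "finite_points X \<subseteq> points X" by (auto simp: finite_points_def)
  have "continuous_map (topo X) (topo Z) (g \<circ> f)"
    using f g unfolding expansive_map_def by (blast intro: continuous_map_compose)
  hence 1: "continuous_map (topo X) (topo Z) (compose (points X) g f)"
    by (rule continuous_map_eq) (simp add: compose_eq)
  have "bij_betw (g \<circ> f) (points X) (points Z)" "bij_betw (g \<circ> f) (finite_points X) (finite_points Z)"
    using f g unfolding expansive_map_def by (blast intro: bij_betw_trans)+
  hence 2: "bij_betw (compose (points X) g f) (points X) (points Z)"
    "bij_betw (compose (points X) g f) (finite_points X) (finite_points Z)"
    using sub by (auto simp: compose_eq subset_iff cong: bij_betw_cong)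
  have 3: "ereal (s * r) * curve_dist X x y = curve_dist Z (compose (points X) g f x) (compose (points X) g f y)"
    if xy: "x \<in> finite_points X" "y \<in> finite_points X" for x y
  proof -
    have "f x \<in> finite_points Y" "f y \<in> finite_points Y"
      using f xy unfolding expansive_map_def bij_betw_def by auto
    hence "curve_dist Z (g (f x)) (g (f y)) = ereal s * (ereal r * curve_dist X x y)"
      using f g xy unfolding expansive_map_def by simp
    moreover have "compose (points X) g f x = g (f x)" "compose (points X) g f y = g (f y)"
      using xy sub by (auto simp: compose_eq)
    ultimately show ?thesis by (simp add: mult.assoc flip: times_ereal.simps(1))
  qed
  show ?thesis unfolding expansive_map_def using 1 2 3 by blast
qed

lemma expansive_groupoid: "is_groupoid (expansive_groupoid :: (('a, 'e) curve, _) cat)"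
proof -
  let ?D = "expansive_groupoid :: (('a, 'e) curve, _) cat"
  have ob: "X \<in> Ob ?D \<longleftrightarrow> tropical_curve X" for X by (simp add: expansive_groupoid_def)
  have hom: "p \<in> Hom ?D X Y \<longleftrightarrow> 0 < fst p \<and> snd p \<in> extensional (points X) \<and> expansive_map (fst p) X Y (snd p)"
    for X Y p by (cases p) (simp add: expansive_groupoid_def)
  have comp: "Comp ?D X Y Z q p = (fst q * fst p, compose (points X) (snd q) (snd p))" for X Y Z q p
    by (cases p; cases q) (simp add: expansive_groupoid_def)
  have ident: "Ident ?D X = (1, restrict (\<lambda>x. x) (points X))" for X by (simp add: expansive_groupoid_def)
  have maps: "f \<in> points X \<rightarrow> points Y" if "expansive_map r X Y f" for f r and X Y :: "('a, 'e) curve"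
    using that unfolding expansive_map_def by (auto simp: bij_betw_def)
  have "is_category ?D"
    unfolding is_category_def
  proof (intro conjI ballI)
    fix X show "Ident ?D X \<in> Hom ?D X X" by (simp add: hom ident expansive_map_identity)
  next
    fix X Y Z p q assume "p \<in> Hom ?D X Y" "q \<in> Hom ?D Y Z"
    thus "Comp ?D X Y Z q p \<in> Hom ?D X Z"
      by (auto simp: hom comp intro: expansive_map_compose)
  next
    fix X Y p assume p: "p \<in> Hom ?D X Y"
    have "compose (points X) (snd p) (restrict (\<lambda>x. x) (points X)) = snd p"
      by (rule extensionalityI[of _ "points X"]) (use p in \<open>auto simp: compose_eq hom\<close>)
    thus "Comp ?D X X Y p (Ident ?D X) = p" by (simp add: comp ident)
    have "compose (points X) (restrict (\<lambda>x. x) (points Y)) (snd p) = snd p"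
      by (rule extensionalityI[of _ "points X"]) (use p maps in \<open>auto simp: compose_eq hom Pi_iff\<close>)
    thus "Comp ?D X Y Y (Ident ?D Y) p = p" by (simp add: comp ident)
  next
    fix W X Y Z p q u assume "p \<in> Hom ?D W X"
    hence "snd p \<in> points W \<rightarrow> points X" using maps hom by blast
    thus "Comp ?D W Y Z u (Comp ?D W X Y q p) = Comp ?D W X Z (Comp ?D X Y Z u q) p"
      using compose_assoc[of "snd p" "points W" "points X" "snd u" "snd q"] by (simp add: comp mult.assoc)
  qed
  moreover have "\<exists>q\<in>Hom ?D Y X. Comp ?D X Y X q p = Ident ?D X \<and> Comp ?D Y X Y p q = Ident ?D Y"
    if XY: "tropical_curve X" "tropical_curve Y" and p: "p \<in> Hom ?D X Y" for X Y p
  proof -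
    interpret E: expansive X Y "fst p" "snd p"
      using XY p by (auto simp: expansive_def trop_def expansive_axioms_def hom)
    have "compose (points X) E.inv_map (snd p) = restrict (\<lambda>x. x) (points X)"
      by (rule extensionalityI[of _ "points X"]) (auto simp: compose_eq E.inverse_left)
    moreover have "compose (points Y) (snd p) E.inv_map = restrict (\<lambda>x. x) (points Y)"
      by (rule extensionalityI[of _ "points Y"]) (auto simp: compose_eq E.inverse_right)
    moreover have "E.inv_map \<in> extensional (points Y)" by (simp add: E.inv_map_def)
    ultimately show ?thesis using E.inverse_expansive_map E.factor_pos
      by (intro bexI[of _ "(1 / fst p, E.inv_map)"]) (auto simp: comp ident hom)
  qed
  ultimately show ?thesis unfolding is_groupoid_def using ob by blast
qed

text \<open>The inverses of the bijections on morphisms are again compatible with composition and identities.\<close>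

lemma isomorphic_categories_if_bijective_on_Hom:
  assumes D: "is_category D" and ob: "Ob C = Ob D" and G: "is_functor D C (\<lambda>X. X) G"
    and bij: "\<And>X Y. X \<in> Ob D \<Longrightarrow> Y \<in> Ob D \<Longrightarrow> bij_betw (G X Y) (Hom D X Y) (Hom C X Y)"
  shows "isomorphic_categories C D"
proof -
  define F where "F X Y = inv_into (Hom D X Y) (G X Y)" for X Y
  have FG: "F X Y (G X Y g) = g" if "X \<in> Ob D" "Y \<in> Ob D" "g \<in> Hom D X Y" for X Y g
    unfolding F_def using bij_betw_inv_into_left[OF bij] that by blast
  have GF: "G X Y (F X Y f) = f" if "X \<in> Ob D" "Y \<in> Ob D" "f \<in> Hom C X Y" for X Y f
    unfolding F_def using bij_betw_inv_into_right[OF bij] that by blast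
  have F_in: "F X Y f \<in> Hom D X Y" if "X \<in> Ob D" "Y \<in> Ob D" "f \<in> Hom C X Y" for X Y f
    using bij_betw_inv_into[OF bij[OF that(1,2)]] that(3) unfolding F_def bij_betw_def by blast
  have "is_functor C D (\<lambda>X. X) F"
    unfolding is_functor_def ob
  proof (intro conjI ballI)
    fix X assume X: "X \<in> Ob D"
    have "Ident D X \<in> Hom D X X" using D X unfolding is_category_def by blast
    moreover have "G X X (Ident D X) = Ident C X" using G X unfolding is_functor_def by blast
    ultimately show "F X X (Ident C X) = Ident D X" using FG X by metis
  next
    fix X Y Z f g assume XYZ: "X \<in> Ob D" "Y \<in> Ob D" "Z \<in> Ob D" and fg: "f \<in> Hom C X Y" "g \<in> Hom C Y Z"
    let ?f = "F X Y f" and ?g = "F Y Z g"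
    have in_D: "?f \<in> Hom D X Y" "?g \<in> Hom D Y Z" using F_in XYZ fg by auto
    have "G X Z (Comp D X Y Z ?g ?f) = Comp C X Y Z (G Y Z ?g) (G X Y ?f)"
      using G XYZ in_D unfolding is_functor_def by blast
    also have "\<dots> = Comp C X Y Z g f" using GF XYZ fg by simp
    finally have "F X Z (Comp C X Y Z g f) = F X Z (G X Z (Comp D X Y Z ?g ?f))" by simp
    also have "\<dots> = Comp D X Y Z ?g ?f"
      by (rule FG) (use D XYZ in_D in \<open>auto simp: is_category_def\<close>)
    finally show "F X Z (Comp C X Y Z g f) = Comp D X Y Z ?g ?f" .
  qed (use F_in in auto)
  thus ?thesis unfolding isomorphic_categories_def
    by (intro exI[of _ "\<lambda>X. X"] exI[of _ F] exI[of _ G] conjI G) (use FG GF ob in auto)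
qed

definition induced_iso :: "('a, 'e) curve \<Rightarrow> ('a, 'e) curve \<Rightarrow> real \<times> ('a \<Rightarrow> 'a) \<Rightarrow> ('a \<Rightarrow> ereal) \<Rightarrow> 'a \<Rightarrow> ereal" where
  "induced_iso X Y p = (\<lambda>f\<in>carrier (Rat X). expansive.push X Y (fst p) (snd p) f)"

lemma induced_iso_in_semiring_isos:
  assumes "expansive X Y r \<phi>" shows "induced_iso X Y (r, \<phi>) \<in> semiring_isos (Rat X) (Rat Y)"
  using expansive.push_semiring_iso[OF assms] by (simp add: induced_iso_def)

lemma induced_iso_image:
  assumes "expansive X Y r \<phi>" "f \<in> carrier (Rat X)" "x \<in> points X"
  shows "induced_iso X Y (r, \<phi>) f (\<phi> x) = ereal r * f x"
  using expansive.push_image[OF assms(1,3)] assms(2) by (simp add: induced_iso_def)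

text \<open>As \<open>\<phi>\<close> is onto, the condition determines all values. It is the tool for recognising
  identities and composites as induced isomorphisms.\<close>

lemma induced_iso_unique:
  assumes "expansive X Y r \<phi>" and \<psi>: "\<psi> \<in> semiring_isos (Rat X) (Rat Y)"
    and image: "\<And>f x. f \<in> carrier (Rat X) \<Longrightarrow> x \<in> points X \<Longrightarrow> \<psi> f (\<phi> x) = ereal r * f x"
  shows "\<psi> = induced_iso X Y (r, \<phi>)"
proof (rule extensionalityI[of _ "carrier (Rat X)"])
  interpret expansive X Y r \<phi> by fact
  fix f assume f: "f \<in> carrier (Rat X)"
  show "\<psi> f = induced_iso X Y (r, \<phi>) f"
  proof (rule extensionalityI[of _ "points Y"])
    show "\<psi> f \<in> extensional (points Y)"
      using semiring_isosD(5)[OF \<psi> f] B.rational_function_regular by (simp add: B.Rat_carrier)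
    show "induced_iso X Y (r, \<phi>) f \<in> extensional (points Y)" using f by (simp add: induced_iso_def push_def)
    fix y assume y: "y \<in> points Y"
    show "\<psi> f y = induced_iso X Y (r, \<phi>) f y"
      using image[OF f inverse_in_points[OF y]] induced_iso_image[OF expansive_axioms f inverse_in_points[OF y]]
      by (simp add: inverse_right[OF y])
  qed
qed (use semiring_isosD(1)[OF \<psi>] in \<open>auto simp: induced_iso_def\<close>)

text \<open>The value of the isomorphism on the constant \<open>1\<close> recovers the factor, also on a curve
  consisting of one point; then \<open>\<phi>\<close> is recovered since functions separate points.\<close>

lemma induced_iso_inj:
  assumes "expansive X Y r \<phi>" "expansive X Y s \<xi>" and ext: "\<phi> \<in> extensional (points X)" "\<xi> \<in> extensional (points X)"
    and eq: "induced_iso X Y (r, \<phi>) = induced_iso X Y (s, \<xi>)"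
  shows "r = s \<and> \<phi> = \<xi>"
proof -
  interpret P: expansive X Y r \<phi> by fact
  interpret Q: expansive X Y s \<xi> by fact
  have same: "ereal r * extend X h (P.inv_map y) = ereal s * extend X h (Q.inv_map y)"
    if "PL UNIV X h" "y \<in> points Y" for h y
  proof -
    have f: "extend X h \<in> carrier (Rat X)"
      using P.A.extend_in_rational_functions[OF that(1)] by (simp add: P.A.Rat_carrier)
    show ?thesis
      using induced_iso_image[OF P.expansive_axioms f P.inverse_in_points[OF that(2)]]
        induced_iso_image[OF Q.expansive_axioms f Q.inverse_in_points[OF that(2)]] eq
      by (simp add: P.inverse_right[OF that(2)] Q.inverse_right[OF that(2)])
  qed
  obtain y where "y \<in> points Y" using P.B.finite_points_nonempty P.B.finite_subset_points by blast
  hence "r = s"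
    using same[OF PL_const[of _ 1]] P.inverse_in_points Q.inverse_in_points by (simp add: P.A.extend_const)
  have "P.inv_map y = Q.inv_map y" if y: "y \<in> points Y" for y
  proof (rule ccontr)
    assume "P.inv_map y \<noteq> Q.inv_map y"
    then obtain h c where h: "PL UNIV X h" "extend X h (Q.inv_map y) \<le> ereal c" "ereal c < extend X h (P.inv_map y)"
      by (rule P.A.points_separated[OF P.inverse_in_points[OF y] Q.inverse_in_points[OF y]])
    have "extend X h (P.inv_map y) = ereal (1 / r) * (ereal r * extend X h (P.inv_map y))"
      using P.factor_pos by (simp add: ereal_times_inverse)
    also have "\<dots> = extend X h (Q.inv_map y)"
      using same[OF h(1) y] \<open>r = s\<close> P.factor_pos by (simp add: ereal_times_inverse)
    finally show False using h by simp
  qed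
  hence "\<phi> x = \<xi> x" if "x \<in> points X" for x
    using P.in_points[OF that] P.inverse_left[OF that] Q.inverse_right by metis
  hence "\<phi> = \<xi>" using ext by (intro extensionalityI[of _ "points X"]) auto
  thus ?thesis using \<open>r = s\<close> by blast
qed

theorem corollary1p2:
  fixes C :: "(('a, 'e) curve, ('a \<Rightarrow> ereal) \<Rightarrow> 'a \<Rightarrow> ereal) cat"
    and D :: "(('a, 'e) curve, real \<times> ('a \<Rightarrow> 'a)) cat"
  assumes "C = semifield_groupoid" and "D = expansive_groupoid"
  shows "is_groupoid C \<and> is_groupoid D \<and> isomorphic_categories C D"
proof (intro conjI)
  show "is_groupoid C" unfolding assms by (rule semifield_groupoid)
  show grpD: "is_groupoid D" unfolding assms by (rule expansive_groupoid)
  have obD: "X \<in> Ob D \<longleftrightarrow> tropical_curve X" for X by (simp add: assms expansive_groupoid_def)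
  have homD: "(r, \<phi>) \<in> Hom D X Y \<longleftrightarrow> expansive X Y r \<phi> \<and> \<phi> \<in> extensional (points X)"
    if "X \<in> Ob D" "Y \<in> Ob D" for X Y r \<phi>
    using that by (auto simp: assms expansive_groupoid_def expansive_def expansive_axioms_def trop_def)
  have homC: "Hom C X Y = semiring_isos (Rat X) (Rat Y)" for X Y by (simp add: assms semifield_groupoid_def)
  show "isomorphic_categories C D"
  proof (rule isomorphic_categories_if_bijective_on_Hom)
    show "is_category D" using grpD by (simp add: is_groupoid_def)
    show "Ob C = Ob D" by (simp add: assms semifield_groupoid_def expansive_groupoid_def)
    show "is_functor D C (\<lambda>X. X) induced_iso"
      unfolding is_functor_def
    proof (intro conjI ballI)
      fix X assume "X \<in> Ob D" thus "X \<in> Ob C" by (simp add: assms semifield_groupoid_def expansive_groupoid_def)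
    next
      fix X Y p assume "X \<in> Ob D" "Y \<in> Ob D" "p \<in> Hom D X Y"
      thus "induced_iso X Y p \<in> Hom C X Y"
        using homD induced_iso_in_semiring_isos by (cases p) (auto simp: homC)
    next
      fix X assume X: "X \<in> Ob D"
      have "(1, restrict (\<lambda>x. x) (points X)) \<in> Hom D X X"
        by (simp add: assms expansive_groupoid_def expansive_map_identity)
      hence e: "expansive X X 1 (restrict (\<lambda>x. x) (points X))" using homD X by blast
      have "restrict (\<lambda>f. f) (carrier (Rat X)) = induced_iso X X (1, restrict (\<lambda>x. x) (points X))"
        by (rule induced_iso_unique[OF e semiring_isos_identity])
           (use trop.Rat_ops_closed X in \<open>auto simp: trop_def obD simp flip: one_ereal_def\<close>)
      thus "induced_iso X X (Ident D X) = Ident C X"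
        by (simp add: assms semifield_groupoid_def expansive_groupoid_def)
    next
      fix X Y Z p q assume XYZ: "X \<in> Ob D" "Y \<in> Ob D" "Z \<in> Ob D" and pq: "p \<in> Hom D X Y" "q \<in> Hom D Y Z"
      obtain r \<phi> s \<xi> where p: "p = (r, \<phi>)" and q: "q = (s, \<xi>)" by (cases p; cases q)
      interpret P: expansive X Y r \<phi> using homD XYZ pq p by blast
      interpret Q: expansive Y Z s \<xi> using homD XYZ pq q by blast
      have pq_eq: "Comp D X Y Z q p = (s * r, compose (points X) \<xi> \<phi>)"
        by (simp add: p q assms expansive_groupoid_def)
      have "Comp D X Y Z q p \<in> Hom D X Z"
        using grpD XYZ pq unfolding is_groupoid_def is_category_def by blast
      hence e: "expansive X Z (s * r) (compose (points X) \<xi> \<phi>)" using homD XYZ pq_eq by auto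
      have isos: "induced_iso X Y p \<in> semiring_isos (Rat X) (Rat Y)" "induced_iso Y Z q \<in> semiring_isos (Rat Y) (Rat Z)"
        unfolding p q by (rule induced_iso_in_semiring_isos, unfold_locales)+
      have "compose (carrier (Rat X)) (induced_iso Y Z q) (induced_iso X Y p) = induced_iso X Z (Comp D X Y Z q p)"
        unfolding pq_eq
      proof (rule induced_iso_unique[OF e semiring_isos_compose[OF P.A.Rat_ops_closed isos]])
        fix f x assume f: "f \<in> carrier (Rat X)" and x: "x \<in> points X"
        have "induced_iso Y Z q (induced_iso X Y p f) (\<xi> (\<phi> x)) = ereal s * (ereal r * f x)"
          using induced_iso_image[OF Q.expansive_axioms semiring_isosD(5)[OF isos(1) f] P.in_points[OF x]]
            induced_iso_image[OF P.expansive_axioms f x] by (simp add: p q)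
        thus "compose (carrier (Rat X)) (induced_iso Y Z q) (induced_iso X Y p) f (compose (points X) \<xi> \<phi> x)
            = ereal (s * r) * f x"
          using f x by (simp add: compose_eq mult.assoc flip: times_ereal.simps(1))
      qed
      thus "induced_iso X Z (Comp D X Y Z q p) = Comp C X Y Z (induced_iso Y Z q) (induced_iso X Y p)"
        by (simp add: assms semifield_groupoid_def)
    qed
    fix X Y assume XY: "X \<in> Ob D" "Y \<in> Ob D"
    show "bij_betw (induced_iso X Y) (Hom D X Y) (Hom C X Y)"
      unfolding bij_betw_def
    proof (intro conjI equalityI subsetI)
      show "inj_on (induced_iso X Y) (Hom D X Y)"
        by (rule inj_onI) (use homD[OF XY] induced_iso_inj in \<open>metis prod.collapse\<close>)
      fix \<psi> assume "\<psi> \<in> induced_iso X Y ` Hom D X Y"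
      thus "\<psi> \<in> Hom C X Y" using homD[OF XY] induced_iso_in_semiring_isos by (auto simp: homC)
    next
      fix \<psi> assume \<psi>: "\<psi> \<in> Hom C X Y"
      interpret rat_iso X Y \<psi>
        using XY \<psi> by (simp add: rat_iso_def trop_def rat_iso_axioms_def obD homC)
      obtain r \<phi> where r\<phi>: "0 < r" "\<phi> \<in> extensional (points X)" "expansive_map r X Y \<phi>"
        "\<And>f x. f \<in> carrier (Rat X) \<Longrightarrow> x \<in> points X \<Longrightarrow> \<psi> f (\<phi> x) = ereal r * f x"
        by (rule induced_by_expansive_map, rule that)
      have "expansive X Y r \<phi>" by unfold_locales (use r\<phi> in auto)
      thus "\<psi> \<in> induced_iso X Y ` Hom D X Y"
        using homD[OF XY] r\<phi> induced_iso_unique[OF _ iso] by blast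
    qed
  qed
qed

end
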